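(* Let $n\ge3$, let $\Omega\subset\mathbb R^n$ be a (possibly unbounded) domain possessing a positive Green function $g_\Omega$ associated with $-\Delta$ in $\Omega$. Let $0<\gamma<\infty$, $M\ge1$, $q_1,\dots,q_M\in(0,1)$, and let $\sigma_1,\dots,\sigma_M,\omega$ be nonnegative functions on $\Omega$ (identified with the measures $\sigma_i\,dx$, $\omega\,dx$), not all identically zero, such that $$\sigma_i\in L^{r_i,\rho_i}(\Omega),\quad r_i=\frac{n(\gamma+1)}{n(1-q_i)+2(\gamma+q_i)},\quad \rho_i=\frac{\gamma+1}{1-q_i},\qquad i=1,\dots,M,$$ $$\omega\in L^{\tilde r,\tilde\rho}(\Omega),\quad \tilde r=\frac{n(\gamma+1)}{n+2\gamma},\quad\tilde\rho=\gamma+1.$$ Then there exists a positive superharmonic solution $u\in L^{r,\rho}(\Omega)$, with $r=\frac{n(\gamma+1)}{n-2}$ and $\rho=\gamma+1$, to the problem $$(P)\qquad -\Delta u=\sum_{i=1}^M\sigma_iu^{q_i}+\omega\ \text{ in }\Omega,\qquad \liminf_{x\to y}u(x)=0,\quad y\in\partial_\infty\Omega,$$ with solutions understood in the sense of the integral equation given in the context.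
   Context: For a nonnegative locally finite Borel measure $\mu$ on $\Omega$ the Green potential is $\mathcal G\mu(x)=\int_\Omega g_\Omega(x,y)\,d\mu(y)\in[0,+\infty]$, $x\in\Omega$. $\partial_\infty\Omega$ denotes the boundary of $\Omega$, including the point at infinity when $\Omega$ is unbounded. Solution: a solution to $(P)$ is by definition a nonnegative superharmonic function $u$ on $\Omega$ with $u\in L^{q_i}_{loc}(\Omega,d\sigma_i)$ for all $i=1,\dots,M$ satisfying the integral equation $u=\sum_{i=1}^M\mathcal G(u^{q_i}d\sigma_i)+\mathcal G\omega$ in $\Omega$. Lorentz space: for $0<r,\rho<\infty$, $L^{r,\rho}(\Omega)$ is the set of Lebesgue measurable $f$ on $\Omega$ with $\|f\|_{L^{r,\rho}}=\big(\int_0^\infty (t^{1/r}f^*(t))^\rho\frac{dt}{t}\big)^{1/\rho}<\infty$, $f^*$ being the decreasing rearrangement of $f$ with respect to Lebesgue measure. *)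

theory Defs
  imports "HOL-Analysis.Analysis"
begin

text \<open>Power with a positive real exponent on \<open>[0, \<infinity>]\<close>, with \<open>\<infinity> ^ p = \<infinity>\<close>.\<close>

definition epowr :: "ennreal \<Rightarrow> real \<Rightarrow> ennreal" where
  "epowr a p = (if a = \<infinity> then \<infinity> else ennreal (enn2real a powr p))"


section \<open>Harmonic and superharmonic functions\<close>

text \<open>\<open>D\<close> is the gradient and \<open>H x\<close> the (continuous) Hessian of \<open>h\<close>; the Laplacian is the
  trace of the Hessian.  Intended for open \<open>S\<close>.\<close>

definition harmonic_on :: "'a::euclidean_space set \<Rightarrow> ('a \<Rightarrow> real) \<Rightarrow> bool" where
  "harmonic_on S h \<longleftrightarrow>
     (\<exists>(D :: 'a \<Rightarrow> 'a) (H :: 'a \<Rightarrow> 'a \<Rightarrow> 'a).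
        (\<forall>x\<in>S. (h has_derivative (\<lambda>v. D x \<bullet> v)) (at x)) \<and>
        (\<forall>x\<in>S. (D has_derivative H x) (at x)) \<and>
        (\<forall>v. continuous_on S (\<lambda>x. H x v)) \<and>
        (\<forall>x\<in>S. (\<Sum>b\<in>Basis. H x b \<bullet> b) = 0))"

text \<open>Superharmonic functions with values in \<open>[0, \<infinity>]\<close> on a domain: lower semicontinuous, not
  identically \<open>\<infinity>\<close>, and at least their mean over every closed ball contained in the domain.\<close>

definition nonneg_superharmonic_on :: "'a::euclidean_space set \<Rightarrow> ('a \<Rightarrow> ennreal) \<Rightarrow> bool" where
  "nonneg_superharmonic_on S u \<longleftrightarrow>
     (\<forall>a. openin (top_of_set S) {x\<in>S. a < u x}) \<and>
     (\<exists>x\<in>S. u x < \<infinity>) \<and>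
     (\<forall>x r. 0 < r \<and> cball x r \<subseteq> S \<longrightarrow>
        (\<integral>\<^sup>+ y\<in>cball x r. u y \<partial>lborel) / emeasure lborel (cball x r) \<le> u x)"


section \<open>Green functions and Green potentials\<close>

text \<open>The fundamental solution of \<open>-\<Delta>\<close> for dimension \<open>n \<ge> 3\<close>, normalised by
  the surface area \<open>n * unit_ball_vol n\<close> of the unit sphere so that \<open>-\<Delta>\<close> of it is the unit point
  mass at the origin.\<close>

definition fundamental_solution :: "'a::euclidean_space \<Rightarrow> ereal" where
  "fundamental_solution z =
     (if z = 0 then \<infinity>
      else ereal (norm z powr (2 - real DIM('a)) /
             ((real DIM('a) - 2) * (real DIM('a) * unit_ball_vol (real DIM('a))))))"

definition greatest_harmonic_minorant ::
  "'a::euclidean_space set \<Rightarrow> ('a \<Rightarrow> ereal) \<Rightarrow> ('a \<Rightarrow> real) \<Rightarrow> bool" where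
  "greatest_harmonic_minorant S f h \<longleftrightarrow>
     harmonic_on S h \<and> (\<forall>x\<in>S. ereal (h x) \<le> f x) \<and>
     (\<forall>k. harmonic_on S k \<and> (\<forall>x\<in>S. ereal (k x) \<le> f x) \<longrightarrow> (\<forall>x\<in>S. k x \<le> h x))"

text \<open>The classical definition: the Green function with pole \<open>y\<close> is the fundamental solution with
  pole \<open>y\<close> minus its greatest harmonic minorant.  This determines \<open>g\<close> on \<open>\<Omega> \<times> \<Omega>\<close>.\<close>

definition is_green_function ::
  "'a::euclidean_space set \<Rightarrow> ('a \<Rightarrow> 'a \<Rightarrow> ereal) \<Rightarrow> bool" where
  "is_green_function \<Omega> g \<longleftrightarrow>
     (\<forall>y\<in>\<Omega>. \<exists>h. greatest_harmonic_minorant \<Omega> (\<lambda>x. fundamental_solution (x - y)) h \<and>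
        (\<forall>x\<in>\<Omega>. g x y = fundamental_solution (x - y) - ereal (h x)))"

text \<open>Here \<open>\<mu>\<close> is a measure whose space is \<open>\<Omega>\<close>.\<close>

definition green_potential ::
  "('a \<Rightarrow> 'a \<Rightarrow> ereal) \<Rightarrow> 'a measure \<Rightarrow> 'a \<Rightarrow> ennreal" where
  "green_potential g \<mu> x = (\<integral>\<^sup>+ y. e2ennreal (g x y) \<partial>\<mu>)"


section \<open>Solutions\<close>

definition Lq_loc :: "'a::euclidean_space set \<Rightarrow> 'a measure \<Rightarrow> real \<Rightarrow> ('a \<Rightarrow> ennreal) \<Rightarrow> bool" where
  "Lq_loc \<Omega> \<mu> q u \<longleftrightarrow>
     u \<in> borel_measurable \<mu> \<and>
     (\<forall>K. compact K \<and> K \<subseteq> \<Omega> \<longrightarrow> (\<integral>\<^sup>+ x\<in>K. epowr (u x) q \<partial>\<mu>) < \<infinity>)"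

definition is_solution ::
  "'a::euclidean_space set \<Rightarrow> ('a \<Rightarrow> 'a \<Rightarrow> ereal) \<Rightarrow> nat \<Rightarrow> (nat \<Rightarrow> real) \<Rightarrow>
   (nat \<Rightarrow> 'a measure) \<Rightarrow> 'a measure \<Rightarrow> ('a \<Rightarrow> ennreal) \<Rightarrow> bool" where
  "is_solution \<Omega> g M q \<sigma> \<omega> u \<longleftrightarrow>
     nonneg_superharmonic_on \<Omega> u \<and>
     (\<forall>i\<in>{1..M}. Lq_loc \<Omega> (\<sigma> i) (q i) u) \<and>
     (\<forall>x\<in>\<Omega>. u x =
        (\<Sum>i=1..M. green_potential g (density (\<sigma> i) (\<lambda>y. epowr (u y) (q i))) x)
        + green_potential g \<omega> x)"


section \<open>Lorentz spaces\<close>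

text \<open>Only nonnegative functions occur, so \<open>f\<close> takes values in \<open>[0, \<infinity>]\<close> and no absolute
  value is needed.\<close>

definition decreasing_rearrangement ::
  "'a::euclidean_space set \<Rightarrow> ('a \<Rightarrow> ennreal) \<Rightarrow> real \<Rightarrow> ennreal" where
  "decreasing_rearrangement \<Omega> f t =
     Inf {s. emeasure (lebesgue_on \<Omega>) {x\<in>\<Omega>. s < f x} \<le> ennreal t}"

definition lorentz_norm ::
  "'a::euclidean_space set \<Rightarrow> real \<Rightarrow> real \<Rightarrow> ('a \<Rightarrow> ennreal) \<Rightarrow> ennreal" where
  "lorentz_norm \<Omega> r \<rho> f =
     epowr (\<integral>\<^sup>+ t\<in>{0<..}. epowr (ennreal (t powr (1 / r)) * decreasing_rearrangement \<Omega> f t) \<rho>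
              * ennreal (1 / t) \<partial>lborel) (1 / \<rho>)"

definition lorentz_space ::
  "'a::euclidean_space set \<Rightarrow> real \<Rightarrow> real \<Rightarrow> ('a \<Rightarrow> ennreal) set" where
  "lorentz_space \<Omega> r \<rho> =
     {f. f \<in> borel_measurable (lebesgue_on \<Omega>) \<and> lorentz_norm \<Omega> r \<rho> f < \<infinity>}"

end

theory Submission
  imports Defs
begin

text \<open>
  The Green kernel \<open>G\<close> lies between \<open>0\<close> and the Newtonian kernel \<open>c |x - y|\<^sup>2\<^sup>-\<^sup>n\<close>, because \<open>0\<close> is a harmonic
  minorant of the latter.  Hence \<open>\<integral>\<^sub>E G(x, y) dy\<close> and \<open>\<integral>\<^sub>E G(x, y) dx\<close> are at most \<open>C |E|\<^sup>2\<^sup>/\<^sup>n\<close>, and a layer-cake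
  argument bounds the decreasing rearrangement of a potential by a Hardy operator acting on the
  rearrangement of its density.  Together with \<open>(\<sigma> u\<^sup>q)\<^sup>*(2t) \<le> \<sigma>\<^sup>*(t) u\<^sup>*(t)\<^sup>q\<close> and a Young inequality with small
  parameter this shows that the operator \<open>T u = \<Sum>\<^sub>i G(\<sigma>\<^sub>i u\<^sup>q\<^sub>i) + G \<omega>\<close> satisfies \<open>X(T u) \<le> X(u) / 2 + K\<close>, where
  \<open>X\<close> is the power \<open>\<rho>\<close> of the Lorentz norm.  The monotone iteration of \<open>T\<close> from a subsolution (zero, or a
  small multiple of the indicator of a compact set on which some \<open>\<sigma>\<^sub>i\<close> does not vanish) therefore
  converges to a solution in the Lorentz space.

  No symmetry of \<open>G\<close> is needed: comparing fundamental solutions with neighbouring poles shows that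
  the greatest harmonic minorant is upper semicontinuous in both variables jointly, so \<open>G\<close> is lower
  semicontinuous.  This yields measurability and lower semicontinuity of potentials and positive
  lower bounds of \<open>G\<close> on compact sets; the mean value inequality for \<open>G\<close> comes from the one for
  twice continuously differentiable superharmonic functions.
\<close>

section \<open>Powers on the extended half-line\<close>

text \<open>Put \<alpha> = 2/n, \<beta> = (n-2)/(n(\<gamma>+1)), \<rho> = \<gamma>+1. The exponents
  of the theorem are those dictated by scaling: the target space has 1/r = \<beta>, the space of
  \<omega> has 1/r = \<alpha>+\<beta>, and \<sigma>_i has 1/r_i = \<alpha>+\<beta>-q_i \<beta> and
  \<rho>_i = \<rho>/(1-q_i). If u is in the target space, Hoelder therefore places \<sigma>_i
  u^(q_i) in the space of \<omega>, and a potential lowers 1/r by exactly \<alpha>. Because q_i < 1,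
  u enters with a power below one and its contribution can be absorbed whatever the size of the
  data. Of the Lorentz functional only monotonicity and the passage to increasing limits are used,
  never a triangle inequality. Two obstacles shape the rest. If \<omega> vanishes, zero is a fixed
  point of T, so the iteration must start from something that it cannot lose. And the greatest
  harmonic minorant is chosen pole by pole, with no a priori regularity in the pole; its maximality
  is the only source from which measurability of the Green kernel can be drawn.\<close>

lemma epowr_top [simp]: "epowr \<infinity> p = \<infinity>" "epowr top p = \<infinity>"
  by (simp_all add: epowr_def infinity_ennreal_def)

lemma epowr_ennreal [simp]: "0 \<le> x \<Longrightarrow> epowr (ennreal x) p = ennreal (x powr p)"
  by (simp add: epowr_def)

lemma epowr_0 [simp]: "epowr 0 p = 0"
  by (simp add: epowr_def)


lemma epowr_1 [simp]: "epowr a 1 = a"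
  by (cases a) auto

lemma epowr_eq_top_iff [simp]: "epowr a p = \<infinity> \<longleftrightarrow> a = \<infinity>" "epowr a p = top \<longleftrightarrow> a = top"
  by (auto simp: epowr_def infinity_ennreal_def)

lemma epowr_less_top_iff [simp]: "epowr a p < \<infinity> \<longleftrightarrow> a < \<infinity>" "epowr a p < top \<longleftrightarrow> a < top"
  by (auto simp: epowr_def infinity_ennreal_def less_top)

lemma epowr_eq_0_iff [simp]: "epowr a p = 0 \<longleftrightarrow> a = 0"
  by (cases a) (auto simp: epowr_def)

lemma epowr_mono: "a \<le> b \<Longrightarrow> 0 \<le> p \<Longrightarrow> epowr a p \<le> epowr b p"
  by (cases a; cases b) (auto intro: powr_mono2 simp: top_unique)

lemma epowr_epowr: "epowr (epowr a p) p' = epowr a (p * p')"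
  by (cases a) (auto simp: powr_powr)

lemma epowr_mult: "0 < p \<Longrightarrow> epowr (a * b) p = epowr a p * epowr b p"
proof -
  assume p: "0 < p"
  show ?thesis
  proof (cases "a = top \<or> b = top")
    case True
    then show ?thesis
    proof
      assume [simp]: "a = top"
      show ?thesis by (cases "b = 0") (auto simp: ennreal_top_mult)
    next
      assume [simp]: "b = top"
      show ?thesis by (cases "a = 0") (auto simp: ennreal_mult_top)
    qed
  next
    case False
    then show ?thesis
      by (cases a; cases b) (auto simp: ennreal_mult[symmetric] powr_mult)
  qed
qed

lemma epowr_le_iff: "0 < p \<Longrightarrow> epowr a p \<le> b \<longleftrightarrow> a \<le> epowr b (1 / p)"
  using epowr_mono[of "epowr a p" b "1 / p"] epowr_mono[of a "epowr b (1 / p)" p]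
  by (auto simp: epowr_epowr)

text \<open>\<open>epowr_le_iff\<close> makes the powers with exponents \<open>p\<close> and
  \<open>1 / p\<close> an adjoint pair, and a lower adjoint preserves suprema.\<close>

lemma epowr_SUP: "0 < p \<Longrightarrow> epowr (SUP k. a k) p = (SUP k. epowr (a k) p)"
proof (rule antisym)
  assume p: "0 < p"
  have "a k \<le> epowr (SUP k. epowr (a k) p) (1 / p)" for k
    unfolding epowr_le_iff[OF p, symmetric] by (rule SUP_upper) simp
  then show "epowr (SUP k. a k) p \<le> (SUP k. epowr (a k) p)"
    unfolding epowr_le_iff[OF p] by (rule SUP_least)
  show "(SUP k. epowr (a k) p) \<le> epowr (SUP k. a k) p"
    using p by (intro SUP_least epowr_mono SUP_upper) auto
qed

lemma borel_measurable_epowr [measurable (raw)]: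
  assumes [measurable]: "f \<in> borel_measurable M"
  shows "(\<lambda>x. epowr (f x) p) \<in> borel_measurable M"
  unfolding epowr_def by measurable

text \<open>A sum is at most its number of terms times its largest term. The constant is crude, but
  the argument is uniform in \<open>p\<close>, and in \<open>lorentz_potential_contraction\<close>
  only its finiteness matters.\<close>

lemma epowr_sum_le:
  assumes "finite J" "0 < p"
  shows "epowr (\<Sum>j\<in>J. a j) p \<le> ennreal (real (card J) powr p) * (\<Sum>j\<in>J. epowr (a j) p)"
proof (cases "J = {}")
  case False
  define m where "m = Max (a ` J)"
  have "m \<in> a ` J" unfolding m_def using False assms by (intro Max_in) auto
  then obtain i where i: "i \<in> J" "m = a i" by auto
  have "(\<Sum>j\<in>J. a j) \<le> (\<Sum>j\<in>J. m)" unfolding m_def using assms by (intro sum_mono Max_ge) auto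
  also have "\<dots> = ennreal (card J) * m" by (simp add: ennreal_of_nat_eq_real_of_nat)
  finally have "epowr (\<Sum>j\<in>J. a j) p \<le> epowr (ennreal (card J) * m) p" using assms by (intro epowr_mono) auto
  also have "\<dots> = ennreal (real (card J) powr p) * epowr (a i) p" using assms i by (simp add: epowr_mult)
  also have "\<dots> \<le> ennreal (real (card J) powr p) * (\<Sum>j\<in>J. epowr (a j) p)"
    using i assms by (intro mult_left_mono member_le_sum) auto
  finally show ?thesis .
qed simp

text \<open>After taking powers the product is the weighted geometric mean A^(1-q) B^q. If A is at
  most \<kappa> B, replace A by \<kappa> B, otherwise replace B by A/\<kappa>. The choice
  \<kappa>^(1-q) = \<delta> puts the small factor on the term to be absorbed and \<kappa>^(-q) on
  the other.\<close>

lemma epowr_young: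
  assumes q: "0 < q" "q < 1" and \<rho>: "0 < \<rho>" and \<delta>: "0 < \<delta>"
  obtains C where "0 < C"
    "\<And>a b. epowr (a * epowr b q) \<rho> \<le> ennreal C * epowr a (\<rho> / (1 - q)) + ennreal \<delta> * epowr b \<rho>"
proof
  define \<kappa> where "\<kappa> = \<delta> powr (1 / (1 - q))"
  have "1 - q \<noteq> 0" using q by simp
  then have \<kappa>: "0 < \<kappa>" "\<kappa> powr (1 - q) = \<delta>" using \<delta> by (simp_all add: \<kappa>_def powr_powr)
  show "0 < \<kappa> powr - q" using \<kappa> by simp
  fix a b
  show "epowr (a * epowr b q) \<rho> \<le> ennreal (\<kappa> powr - q) * epowr a (\<rho> / (1 - q)) + ennreal \<delta> * epowr b \<rho>"
  proof (cases "a = top \<or> b = top")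
    case True
    then show ?thesis using \<kappa> \<delta> by (auto simp: ennreal_mult_top)
  next
    case False
    then obtain x y where x: "a = ennreal x" "0 \<le> x" and y: "b = ennreal y" "0 \<le> y"
      by (cases a; cases b) auto
    define A B where "A = x powr (\<rho> / (1 - q))" and "B = y powr \<rho>"
    have nn: "0 \<le> A" "0 \<le> B" by (auto simp: A_def B_def)
    have "(x * y powr q) powr \<rho> = A powr (1 - q) * B powr q"
      using x y assms by (simp add: A_def B_def powr_mult powr_powr mult.commute)
    also have "\<dots> \<le> \<kappa> powr - q * A + \<delta> * B"
    proof (cases "A \<le> \<kappa> * B")
      case True
      have "A powr (1 - q) * B powr q \<le> (\<kappa> * B) powr (1 - q) * B powr q"
        using nn True assms by (intro mult_right_mono powr_mono2) auto
      also have "\<dots> = \<delta> * (B powr (1 - q) * B powr q)" using \<kappa> nn by (simp add: powr_mult)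
      also have "B powr (1 - q) * B powr q = B" using nn by (simp add: powr_add[symmetric])
      finally show ?thesis using nn \<kappa> by (simp add: add_increasing)
    next
      case False
      then have "B \<le> A / \<kappa>" using \<kappa> by (simp add: field_simps)
      then have "A powr (1 - q) * B powr q \<le> A powr (1 - q) * (A / \<kappa>) powr q"
        using nn assms by (intro mult_left_mono powr_mono2) auto
      also have "\<dots> = (A powr (1 - q) * A powr q) * \<kappa> powr - q" using \<kappa> nn by (simp add: powr_divide powr_minus_divide)
      also have "A powr (1 - q) * A powr q = A" using nn by (simp add: powr_add[symmetric])
      finally show ?thesis using nn \<delta> by (simp add: add_increasing2 mult.commute)
    qed
    finally have "ennreal ((x * y powr q) powr \<rho>) \<le> ennreal (\<kappa> powr - q * A + \<delta> * B)" by (rule ennreal_leI)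
    then show ?thesis using x y nn \<delta> by (simp add: A_def B_def ennreal_plus ennreal_mult[symmetric])
  qed
qed

text \<open>Jensen's inequality for a finite measure, up to a factor 2^\<rho>. It rests on a \<le> l
  + l^(1-\<rho>) a^\<rho> for every level l > 0: the first term suffices when a \<le> l, the second
  when a > l.\<close>

lemma nn_integral_epowr_le:
  assumes f[measurable]: "f \<in> borel_measurable M" and m: "emeasure M (space M) \<le> ennreal m" "0 < m" and \<rho>: "1 < \<rho>"
  shows "epowr (\<integral>\<^sup>+x. f x \<partial>M) \<rho> \<le> ennreal (2 powr \<rho> * m powr (\<rho> - 1)) * (\<integral>\<^sup>+x. epowr (f x) \<rho> \<partial>M)"
proof -
  have pt: "a \<le> ennreal l + ennreal (l powr (1 - \<rho>)) * epowr a \<rho>" if "0 < l" for l a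
  proof (cases a)
    case (real x)
    have "x \<le> l + l powr (1 - \<rho>) * x powr \<rho>"
    proof (cases "x \<le> l")
      case True then show ?thesis by (simp add: add_increasing2)
    next
      case False
      have "x = x powr (1 - \<rho>) * x powr \<rho>" using False that by (simp add: powr_add[symmetric])
      also have "\<dots> \<le> l powr (1 - \<rho>) * x powr \<rho>" using False that \<rho> by (intro mult_right_mono powr_mono2') auto
      finally show ?thesis using that by linarith
    qed
    then have "ennreal x \<le> ennreal (l + l powr (1 - \<rho>) * x powr \<rho>)" by (rule ennreal_leI)
    then show ?thesis using real that by (simp add: ennreal_plus ennreal_mult)
  next
    case top then show ?thesis using that by (simp add: ennreal_mult_top)
  qed
  have main: "(\<integral>\<^sup>+x. f x \<partial>M) \<le> ennreal (l * m) + ennreal (l powr (1 - \<rho>)) * (\<integral>\<^sup>+x. epowr (f x) \<rho> \<partial>M)" if "0 < l" for l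
  proof -
    have "(\<integral>\<^sup>+x. f x \<partial>M) \<le> (\<integral>\<^sup>+x. ennreal l + ennreal (l powr (1 - \<rho>)) * epowr (f x) \<rho> \<partial>M)"
      by (intro nn_integral_mono pt that)
    also have "\<dots> = ennreal l * emeasure M (space M) + ennreal (l powr (1 - \<rho>)) * (\<integral>\<^sup>+x. epowr (f x) \<rho> \<partial>M)"
      by (simp add: nn_integral_add nn_integral_cmult)
    also have "\<dots> \<le> ennreal (l * m) + ennreal (l powr (1 - \<rho>)) * (\<integral>\<^sup>+x. epowr (f x) \<rho> \<partial>M)"
      using that m by (auto simp: ennreal_mult intro!: add_right_mono mult_left_mono)
    finally show ?thesis .
  qed
  show ?thesis
  proof (cases "\<integral>\<^sup>+x. epowr (f x) \<rho> \<partial>M")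
    case top
    then show ?thesis using m by (simp add: ennreal_mult_top)
  next
    case (real i)
    show ?thesis
    proof (cases "i = 0")
      case True
      have "(\<integral>\<^sup>+x. f x \<partial>M) \<le> 0 + ennreal e" if "0 < e" for e
        using main[of "e / m"] m that real True by simp
      then have "(\<integral>\<^sup>+x. f x \<partial>M) \<le> 0" by (rule ennreal_le_epsilon) simp
      then show ?thesis by simp
    next
      case False
      \<comment> \<open>At this level the two terms of \<open>main\<close>, l m and l^(1-\<rho>) i,
        coincide.\<close>
      define l where "l = (i / m) powr (1 / \<rho>)"
      have i: "0 < i" using False real by simp
      have l: "0 < l" "l powr \<rho> = i / m" using i m \<rho> by (auto simp: l_def powr_powr)
      have "l powr (1 - \<rho>) * i = l * m" using l i m by (simp add: powr_diff field_simps)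
      then have "(\<integral>\<^sup>+x. f x \<partial>M) \<le> ennreal (2 * (l * m))"
        using main[OF l(1)] real l m by (simp add: ennreal_mult[symmetric] ennreal_plus[symmetric] del: ennreal_plus)
      then have "epowr (\<integral>\<^sup>+x. f x \<partial>M) \<rho> \<le> epowr (ennreal (2 * (l * m))) \<rho>" using \<rho> by (intro epowr_mono) auto
      also have "\<dots> = ennreal (2 powr \<rho> * (i / m * m powr \<rho>))" using l m by (simp add: powr_mult)
      also have "i / m * m powr \<rho> = m powr (\<rho> - 1) * i" using m by (simp add: powr_diff)
      finally show ?thesis using real by (simp add: ennreal_mult[symmetric] mult.assoc)
    qed
  qed
qed

section \<open>Decreasing rearrangements\<close>

text \<open>Stated for an arbitrary measure so that the kernel estimates are independent of
  \<Omega>; \<open>decreasing_rearrangement_eq_rearr\<close> makes the connection with the Lorentz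
  norm of the theorem.\<close>

definition rearr :: "'b measure \<Rightarrow> ('b \<Rightarrow> ennreal) \<Rightarrow> real \<Rightarrow> ennreal" where
  "rearr M f t = Inf {s. emeasure M {x \<in> space M. s < f x} \<le> ennreal t}"

lemma rearr_le: "emeasure M {x \<in> space M. s < f x} \<le> ennreal t \<Longrightarrow> rearr M f t \<le> s"
  unfolding rearr_def by (rule Inf_lower) simp

lemma emeasure_gt_mono:
  fixes f :: "'b \<Rightarrow> ennreal"
  assumes "f \<in> borel_measurable M" "s \<le> s'"
  shows "emeasure M {x \<in> space M. s' < f x} \<le> emeasure M {x \<in> space M. s < f x}"
proof (intro emeasure_mono subsetI)
  show "{x \<in> space M. s < f x} \<in> sets M" using assms(1) by measurable
qed (use assms(2) in \<open>auto intro: le_less_trans\<close>)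

lemma rearr_ge:
  assumes "f \<in> borel_measurable M" "ennreal t < emeasure M {x \<in> space M. s < f x}"
  shows "s \<le> rearr M f t"
  unfolding rearr_def
proof (rule Inf_greatest)
  fix s' assume "s' \<in> {s. emeasure M {x \<in> space M. s < f x} \<le> ennreal t}"
  then show "s \<le> s'"
    using emeasure_gt_mono[OF assms(1), of s' s] assms(2)
    by (cases "s' \<le> s") auto
qed

text \<open>The infimum defining \<open>rearr\<close> is attained: with strict inequalities, the
  level set at the infimum is an increasing union of level sets at larger heights, and continuity
  from below holds for infinite measures too.\<close>

lemma emeasure_gt_rearr:
  assumes f[measurable]: "f \<in> borel_measurable M"
  shows "emeasure M {x \<in> space M. rearr M f t < f x} \<le> ennreal t"
proof -
  let ?S = "{s. emeasure M {x \<in> space M. s < f x} \<le> ennreal t}"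
  have "top \<in> ?S" by simp
  then have "?S \<noteq> {}" by blast
  from ennreal_Inf_countable_INF[OF this] obtain h :: "nat \<Rightarrow> ennreal" where
    h: "decseq h" "range h \<subseteq> ?S" "Inf ?S = (INF i. h i)" by auto
  have "{x \<in> space M. rearr M f t < f x} = (\<Union>i. {x \<in> space M. h i < f x})"
    unfolding rearr_def h(3) by (auto simp: INF_less_iff)
  also have "emeasure M \<dots> = (SUP i. emeasure M {x \<in> space M. h i < f x})"
    using h(1) by (intro SUP_emeasure_incseq[symmetric]) (auto simp: incseq_def decseq_def intro: le_less_trans)
  also have "\<dots> \<le> ennreal t" using h(2) by (intro SUP_least) auto
  finally show ?thesis .
qed

lemma rearr_antimono: "t \<le> t' \<Longrightarrow> rearr M f t' \<le> rearr M f t"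
  unfolding rearr_def by (rule Inf_superset_mono) (auto intro: order.trans ennreal_leI)

lemma borel_measurable_rearr [measurable]: "rearr M f \<in> borel_measurable borel"
proof (rule borel_measurableI_greater)
  fix y
  have "is_interval {t. y < rearr M f t}"
    unfolding is_interval_1 by (auto intro: less_le_trans[OF _ rearr_antimono])
  then show "{t \<in> space borel. y < rearr M f t} \<in> sets borel"
    using real_interval_borel_measurable by simp
qed

text \<open>A level set of the supremum is the increasing union of the level sets of the terms. This
  is the source of the Fatou property \<open>lorentz_int_SUP\<close>.\<close>

lemma rearr_SUP:
  fixes u :: "nat \<Rightarrow> 'b \<Rightarrow> ennreal"
  assumes u[measurable]: "\<And>k. u k \<in> borel_measurable M" and inc: "incseq u"
  shows "rearr M (\<lambda>x. SUP k. u k x) t \<le> (SUP k. rearr M (u k) t)"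
proof (rule rearr_le)
  let ?s = "SUP k. rearr M (u k) t"
  have "{x \<in> space M. ?s < (SUP k. u k x)} = (\<Union>k. {x \<in> space M. ?s < u k x})"
    by (auto simp: less_SUP_iff)
  also have "emeasure M \<dots> = (SUP k. emeasure M {x \<in> space M. ?s < u k x})"
    using inc by (intro SUP_emeasure_incseq[symmetric]) (auto simp: incseq_def le_fun_def intro: less_le_trans)
  also have "\<dots> \<le> ennreal t"
  proof (rule SUP_least)
    fix k
    have "rearr M (u k) t \<le> ?s" by (rule SUP_upper) simp
    then show "emeasure M {x \<in> space M. ?s < u k x} \<le> ennreal t"
      using emeasure_gt_mono[OF u] emeasure_gt_rearr[OF u] order.trans by blast
  qed
  finally show "emeasure M {x \<in> space M. ?s < (SUP k. u k x)} \<le> ennreal t" .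
qed

text \<open>Each factor exceeds its rearrangement at \<open>t\<close> on a set of measure at most
  \<open>t\<close>. Off the union of the two sets the product is controlled, hence the argument
  \<open>2 * t\<close>.\<close>

lemma rearr_mult_epowr:
  assumes a[measurable]: "a \<in> borel_measurable M" and b[measurable]: "b \<in> borel_measurable M"
    and "0 < t" "0 \<le> q"
  shows "rearr M (\<lambda>x. a x * epowr (b x) q) (2 * t) \<le> rearr M a t * epowr (rearr M b t) q"
proof (rule rearr_le)
  have "{x \<in> space M. rearr M a t * epowr (rearr M b t) q < a x * epowr (b x) q}
    \<subseteq> {x \<in> space M. rearr M a t < a x} \<union> {x \<in> space M. rearr M b t < b x}"
  proof (rule subsetI, rule ccontr)
    fix x
    assume x: "x \<in> {x \<in> space M. rearr M a t * epowr (rearr M b t) q < a x * epowr (b x) q}"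
      and n: "x \<notin> {x \<in> space M. rearr M a t < a x} \<union> {x \<in> space M. rearr M b t < b x}"
    then have "a x * epowr (b x) q \<le> rearr M a t * epowr (rearr M b t) q"
      using \<open>0 \<le> q\<close> by (intro mult_mono epowr_mono) auto
    with x show False by auto
  qed
  then have "emeasure M {x \<in> space M. rearr M a t * epowr (rearr M b t) q < a x * epowr (b x) q}
    \<le> emeasure M ({x \<in> space M. rearr M a t < a x} \<union> {x \<in> space M. rearr M b t < b x})"
    by (intro emeasure_mono) auto
  also have "\<dots> \<le> emeasure M {x \<in> space M. rearr M a t < a x} + emeasure M {x \<in> space M. rearr M b t < b x}"
    by (intro emeasure_subadditive) auto
  also have "\<dots> \<le> ennreal t + ennreal t" by (intro add_mono emeasure_gt_rearr a b)
  also have "\<dots> = ennreal (2 * t)" using assms by (simp add: ennreal_plus[symmetric] del: ennreal_plus)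
  finally show "emeasure M {x \<in> space M. rearr M a t * epowr (rearr M b t) q < a x * epowr (b x) q} \<le> ennreal (2 * t)" .
qed

section \<open>Layer-cake formula on the half-line\<close>

lemma ennreal_eq_topI:
  assumes "\<And>B. ennreal B \<le> x"
  shows "x = top"
proof (cases x)
  case (real r)
  then show ?thesis using assms[of "r + 1"] by (simp add: ennreal_le_iff del: ennreal_plus)
qed

text \<open>The restriction to positive levels matters: \<open>ennreal\<close> sends negative reals
  to 0, so otherwise every negative \<open>s\<close> would count as lying below a positive
  \<open>c\<close>.\<close>

lemma emeasure_lborel_less: "emeasure lborel {s. 0 < s \<and> ennreal s < c} = c"
proof (cases c)
  case (real r)
  then have "{s. 0 < s \<and> ennreal s < c} = {0<..<r}" by (auto simp: ennreal_less_iff)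
  then show ?thesis using real by simp
next
  case top
  then have "{s. 0 < s \<and> ennreal s < c} = {0<..}" by auto
  moreover have "emeasure lborel {0::real<..} = \<infinity>"
  proof -
    have "ennreal B \<le> emeasure lborel {0::real<..}" for B
    proof -
      have "emeasure lborel {0<..<B} \<le> emeasure lborel {0::real<..}" by (intro emeasure_mono) auto
      then show ?thesis by (cases "0 \<le> B") (auto simp: ennreal_neg)
    qed
    then show ?thesis using ennreal_eq_topI by (simp add: infinity_ennreal_def)
  qed
  ultimately show ?thesis using top by (simp add: infinity_ennreal_def)
qed

lemma nn_integral_layer_cake: "(\<integral>\<^sup>+s. indicator {s. 0 < s \<and> ennreal s < c} s \<partial>lborel) = c"
proof -
  have "{s. 0 < s \<and> ennreal s < c} \<in> sets borel" by measurable
  then show ?thesis using emeasure_lborel_less by (subst nn_integral_indicator) auto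
qed

lemma emeasure_lborel_le: "emeasure lborel {s. 0 < s \<and> ennreal s \<le> c} = c"
proof (cases c)
  case (real r)
  then have "{s. 0 < s \<and> ennreal s \<le> c} = {0<..r}" by (auto simp: ennreal_le_iff)
  then show ?thesis using real by simp
next
  case top
  then have "{s. 0 < s \<and> ennreal s \<le> c} = {s. 0 < s \<and> (ennreal s < c)}" by auto
  then show ?thesis using emeasure_lborel_less[of c] by simp
qed

text \<open>The minimum of two competing bounds, for a level set of measure \<open>d\<close>,
  becomes an integral over \<tau> < d; in this form it can be integrated over all levels and the
  order exchanged. If d \<le> t the integrand is constantly t^(\<alpha>-1); if d > t it is at least
  d^(\<alpha>-1), because \<alpha> < 1.\<close>

lemma concave_kernel_bound:
  assumes \<alpha>: "0 < \<alpha>" "\<alpha> < 1" and t: "0 < t"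
  shows "min (epowr d \<alpha>) (d * ennreal (t powr (\<alpha> - 1)))
    \<le> (\<integral>\<^sup>+\<tau>. indicator {\<tau>. 0 < \<tau> \<and> ennreal \<tau> < d} \<tau> * ennreal (max \<tau> t powr (\<alpha> - 1)) \<partial>lborel)" (is "_ \<le> ?I d")
proof -
  have fin: "min (epowr (ennreal r) \<alpha>) (ennreal r * ennreal (t powr (\<alpha> - 1))) \<le> ?I (ennreal r)" if r: "0 < r" for r
  proof -
    have "min (epowr (ennreal r) \<alpha>) (ennreal r * ennreal (t powr (\<alpha> - 1))) \<le> ennreal r * ennreal (max r t powr (\<alpha> - 1))"
    proof (cases "r \<le> t")
      case True then show ?thesis by (simp add: max_absorb2)
    next
      case False then show ?thesis using r by (simp add: max_absorb1 ennreal_mult[symmetric] powr_mult_base)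
    qed
    also have "\<dots> = (\<integral>\<^sup>+\<tau>. ennreal (max r t powr (\<alpha> - 1)) * indicator {\<tau>. 0 < \<tau> \<and> ennreal \<tau> < ennreal r} \<tau> \<partial>lborel)"
      using nn_integral_layer_cake[of "ennreal r"] by (subst nn_integral_cmult) (auto simp: mult.commute)
    also have "\<dots> \<le> ?I (ennreal r)"
    proof (rule nn_integral_mono)
      fix \<tau> :: real
      show "ennreal (max r t powr (\<alpha> - 1)) * indicator {\<tau>. 0 < \<tau> \<and> ennreal \<tau> < ennreal r} \<tau>
        \<le> indicator {\<tau>. 0 < \<tau> \<and> ennreal \<tau> < ennreal r} \<tau> * ennreal (max \<tau> t powr (\<alpha> - 1))"
        using \<alpha> t r by (auto simp: indicator_def ennreal_less_iff intro!: ennreal_leI powr_mono2')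
    qed
    finally show ?thesis .
  qed
  show ?thesis
  proof (cases d)
    case (real r)
    then show ?thesis using fin[of r] by (cases "r = 0") auto
  next
    case top
    have "ennreal B \<le> ?I top" for B
    proof -
      \<comment> \<open>Large enough for both terms of the minimum to reach \<open>B\<close>: the
        first entry serves r^\<alpha>, the second r t^(\<alpha>-1).\<close>
      define r where "r = max (max B 1 powr (1 / \<alpha>)) (max B 1 * t powr (1 - \<alpha>))"
      have r0: "0 < r" unfolding r_def by (simp add: less_max_iff_disj)
      have "B \<le> (max B 1 powr (1 / \<alpha>)) powr \<alpha>" using \<alpha> by (simp add: powr_powr)
      also have "\<dots> \<le> r powr \<alpha>" unfolding r_def using \<alpha> by (intro powr_mono2) auto
      finally have 1: "B \<le> r powr \<alpha>" .
      have "B \<le> max B 1 * (t powr (1 - \<alpha>) * t powr (\<alpha> - 1))" using t by (simp add: powr_add[symmetric])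
      also have "\<dots> = (max B 1 * t powr (1 - \<alpha>)) * t powr (\<alpha> - 1)" by simp
      also have "\<dots> \<le> r * t powr (\<alpha> - 1)" unfolding r_def by (intro mult_right_mono) auto
      finally have 2: "B \<le> r * t powr (\<alpha> - 1)" .
      have "ennreal B \<le> min (epowr (ennreal r) \<alpha>) (ennreal r * ennreal (t powr (\<alpha> - 1)))"
        using 1 2 r0 by (auto simp: ennreal_mult[symmetric] intro!: ennreal_leI)
      also have "\<dots> \<le> ?I (ennreal r)" by (rule fin[OF r0])
      also have "\<dots> \<le> ?I top" by (intro nn_integral_mono mult_right_mono) (auto simp: indicator_def)
      finally show ?thesis .
    qed
    then have "?I top = top" by (rule ennreal_eq_topI)
    then show ?thesis using top by simp
  qed
qed

section \<open>Rearrangement bound for kernel potentials\<close>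

lemma borel_measurable_emeasure_gt [measurable]:
  fixes f :: "'b \<Rightarrow> ennreal"
  assumes f: "f \<in> borel_measurable M"
  shows "(\<lambda>s. emeasure M {x \<in> space M. ennreal s < f x}) \<in> borel_measurable borel"
proof (rule borel_measurableI_greater)
  fix y
  have "is_interval {s. y < emeasure M {x \<in> space M. ennreal s < f x}}"
    unfolding is_interval_1 by (auto intro: less_le_trans[OF _ emeasure_gt_mono[OF f]] ennreal_leI)
  then show "{s \<in> space borel. y < emeasure M {x \<in> space M. ennreal s < f x}} \<in> sets borel"
    using real_interval_borel_measurable by simp
qed

text \<open>Split at \<open>t\<close>, this is t^(\<alpha>-1) times the integral of H over (0,t),
  plus the integral of \<tau>^(\<alpha>-1) H(\<tau>) over (t,\<infinity>): the Hardy average and its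
  dual, as in O'Neil's inequality for Riesz potentials. The single kernel with \<open>max\<close>
  treats both at once.\<close>

definition hardy_op :: "real \<Rightarrow> (real \<Rightarrow> ennreal) \<Rightarrow> real \<Rightarrow> ennreal" where
  "hardy_op \<alpha> H t = (\<integral>\<^sup>+\<tau>. H \<tau> * ennreal (max \<tau> t powr (\<alpha> - 1)) * indicator {0<..} \<tau> \<partial>lborel)"

text \<open>Testing on sets expresses that \<open>k\<close> is in weak L^(1/(1-\<alpha>)) in either
  variable, uniformly in the other; for \<alpha> = 2/n this is the class of the Newtonian kernel.
  Both variables appear since \<open>k\<close> is not taken to be symmetric.\<close>

definition riesz_kernel :: "'b measure \<Rightarrow> ('b \<Rightarrow> 'b \<Rightarrow> ennreal) \<Rightarrow> ennreal \<Rightarrow> real \<Rightarrow> bool" where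
  "riesz_kernel M k C \<alpha> \<longleftrightarrow> sigma_finite_measure M \<and> (\<lambda>(x, y). k x y) \<in> borel_measurable (M \<Otimes>\<^sub>M M) \<and>
    (\<forall>x\<in>space M. \<forall>E\<in>sets M. (\<integral>\<^sup>+y. k x y * indicator E y \<partial>M) \<le> C * epowr (emeasure M E) \<alpha>) \<and>
    (\<forall>y\<in>space M. \<forall>E\<in>sets M. (\<integral>\<^sup>+x. k x y * indicator E x \<partial>M) \<le> C * epowr (emeasure M E) \<alpha>)"

lemma riesz_kernelD:
  assumes "riesz_kernel M k C \<alpha>"
  shows "sigma_finite_measure M" "(\<lambda>(x, y). k x y) \<in> borel_measurable (M \<Otimes>\<^sub>M M)"
    "\<And>x E. x \<in> space M \<Longrightarrow> E \<in> sets M \<Longrightarrow> (\<integral>\<^sup>+y. k x y * indicator E y \<partial>M) \<le> C * epowr (emeasure M E) \<alpha>"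
    "\<And>y E. y \<in> space M \<Longrightarrow> E \<in> sets M \<Longrightarrow> (\<integral>\<^sup>+x. k x y * indicator E x \<partial>M) \<le> C * epowr (emeasure M E) \<alpha>"
  using assms unfolding riesz_kernel_def by auto

text \<open>\<open>f\<close> is cut into its level sets. For each of them the double integral over
  level set and \<open>A\<close> has two bounds, one for each order of integration;
  \<open>concave_kernel_bound\<close> encodes the better one, and exchanging the integrals over
  levels and over \<tau> brings out the rearrangement of \<open>f\<close>.\<close>

lemma kernel_average_le:
  fixes k :: "'b \<Rightarrow> 'b \<Rightarrow> ennreal"
  assumes kern: "riesz_kernel M k C \<alpha>"
    and \<alpha>: "0 < \<alpha>" "\<alpha> < 1"
    and f[measurable]: "f \<in> borel_measurable M"
    and A[measurable]: "A \<in> sets M" and a: "emeasure M A = ennreal a" "0 < a"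
  shows "(\<integral>\<^sup>+x. (\<integral>\<^sup>+y. k x y * f y \<partial>M) * indicator A x \<partial>M)
    \<le> C * ennreal a * hardy_op \<alpha> (rearr M f) a"
proof -
  note k[measurable] = riesz_kernelD(2)[OF kern] and k1 = riesz_kernelD(3)[OF kern] and k2 = riesz_kernelD(4)[OF kern]
  interpret M: sigma_finite_measure M by (rule riesz_kernelD(1)[OF kern])
  interpret MM: pair_sigma_finite M M by unfold_locales
  interpret MR: pair_sigma_finite M "lborel :: real measure" by unfold_locales
  define \<kappa> where "\<kappa> y = (\<integral>\<^sup>+x. k x y * indicator A x \<partial>M)" for y
  have \<kappa>m[measurable]: "\<kappa> \<in> borel_measurable M" unfolding \<kappa>_def by measurable
  define d where "d s = emeasure M {y \<in> space M. ennreal s < f y}" for s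
  have dm[measurable]: "d \<in> borel_measurable borel" unfolding d_def using f by measurable
  define m where "m \<tau> = ennreal (max \<tau> a powr (\<alpha> - 1))" for \<tau>
  let ?J = "\<lambda>s \<tau>. indicator {0<..} s * (indicator {\<tau>. 0 < \<tau> \<and> ennreal \<tau> < d s} \<tau> * m \<tau>)" and ?I = "\<lambda>s y. \<kappa> y * indicator {s. 0 < s \<and> ennreal s < f y} s"
  have [measurable]: "m \<in> borel_measurable borel" unfolding m_def by measurable
  have swap: "(\<integral>\<^sup>+x. (\<integral>\<^sup>+y. k x y * h y \<partial>M) * indicator A x \<partial>M) = (\<integral>\<^sup>+y. \<kappa> y * h y \<partial>M)"
    if h[measurable]: "h \<in> borel_measurable M" for h
  proof -
    have "(\<integral>\<^sup>+x. (\<integral>\<^sup>+y. k x y * h y \<partial>M) * indicator A x \<partial>M) = (\<integral>\<^sup>+x. (\<integral>\<^sup>+y. k x y * h y * indicator A x \<partial>M) \<partial>M)"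
      by (intro nn_integral_cong nn_integral_multc[symmetric]) measurable
    also have "\<dots> = (\<integral>\<^sup>+y. (\<integral>\<^sup>+x. k x y * h y * indicator A x \<partial>M) \<partial>M)"
      by (rule MM.Fubini'[symmetric]) measurable
    also have "\<dots> = (\<integral>\<^sup>+y. (\<integral>\<^sup>+x. (k x y * indicator A x) * h y \<partial>M) \<partial>M)"
      by (simp add: mult_ac)
    also have "\<dots> = (\<integral>\<^sup>+y. \<kappa> y * h y \<partial>M)"
      unfolding \<kappa>_def by (intro nn_integral_cong nn_integral_multc) measurable
    finally show ?thesis .
  qed
  \<comment> \<open>Integrating in x first gives C a^\<alpha> d(s), integrating in y first gives C
    d(s)^\<alpha> a; C a can be factored out of the minimum of the two.\<close>
  have lev: "(\<integral>\<^sup>+y. \<kappa> y * indicator {y \<in> space M. ennreal s < f y} y \<partial>M)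
     \<le> C * ennreal a * (\<integral>\<^sup>+\<tau>. indicator {\<tau>. 0 < \<tau> \<and> ennreal \<tau> < d s} \<tau> * m \<tau> \<partial>lborel)" for s
  proof -
    let ?E = "{y \<in> space M. ennreal s < f y}"
    let ?L = "\<integral>\<^sup>+y. \<kappa> y * indicator ?E y \<partial>M"
    have E[measurable]: "?E \<in> sets M" by measurable
    have "?L \<le> (\<integral>\<^sup>+y. (C * epowr (ennreal a) \<alpha>) * indicator ?E y \<partial>M)"
      unfolding \<kappa>_def using k2[OF _ A] a by (intro nn_integral_mono mult_right_mono) auto
    also have "\<dots> = (C * epowr (ennreal a) \<alpha>) * d s" unfolding d_def by (rule nn_integral_cmult_indicator[OF E])
    also have "epowr (ennreal a) \<alpha> = ennreal a * ennreal (a powr (\<alpha> - 1))"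
      using a by (simp add: ennreal_mult[symmetric] powr_mult_base)
    finally have 1: "?L \<le> C * ennreal a * (d s * ennreal (a powr (\<alpha> - 1)))"
      by (simp add: mult_ac)
    have "?L = (\<integral>\<^sup>+x. (\<integral>\<^sup>+y. k x y * indicator ?E y \<partial>M) * indicator A x \<partial>M)"
      by (rule swap[symmetric]) measurable
    also have "\<dots> \<le> (\<integral>\<^sup>+x. (C * epowr (d s) \<alpha>) * indicator A x \<partial>M)"
      unfolding d_def using k1[OF _ E] by (intro nn_integral_mono mult_right_mono) auto
    also have "\<dots> = (C * epowr (d s) \<alpha>) * ennreal a" unfolding a(1)[symmetric] by (rule nn_integral_cmult_indicator[OF A])
    finally have 2: "?L \<le> C * ennreal a * epowr (d s) \<alpha>"
      by (simp add: mult_ac)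
    have "?L \<le> C * ennreal a * min (epowr (d s) \<alpha>) (d s * ennreal (a powr (\<alpha> - 1)))"
      using 1 2 by (simp add: min_def)
    also have "\<dots> \<le> C * ennreal a * (\<integral>\<^sup>+\<tau>. indicator {\<tau>. 0 < \<tau> \<and> ennreal \<tau> < d s} \<tau> * m \<tau> \<partial>lborel)"
      unfolding m_def by (intro mult_left_mono concave_kernel_bound \<alpha> a) auto
    finally show ?thesis .
  qed
  have "(\<integral>\<^sup>+x. (\<integral>\<^sup>+y. k x y * f y \<partial>M) * indicator A x \<partial>M) = (\<integral>\<^sup>+y. \<kappa> y * f y \<partial>M)" by (rule swap[OF f])
  also have "\<dots> = (\<integral>\<^sup>+y. \<kappa> y * (\<integral>\<^sup>+s. indicator {s. 0 < s \<and> ennreal s < f y} s \<partial>lborel) \<partial>M)"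
    by (simp only: nn_integral_layer_cake)
  also have "\<dots> = (\<integral>\<^sup>+y. (\<integral>\<^sup>+s. ?I s y \<partial>lborel) \<partial>M)"
    by (intro nn_integral_cong nn_integral_cmult[symmetric]) measurable
  also have "\<dots> = (\<integral>\<^sup>+s. (\<integral>\<^sup>+y. ?I s y \<partial>M) \<partial>lborel)"
    by (rule MR.Fubini'[symmetric]) measurable
  also have "\<dots> = (\<integral>\<^sup>+s. (\<integral>\<^sup>+y. \<kappa> y * indicator {y \<in> space M. ennreal s < f y} y \<partial>M) * indicator {0<..} s \<partial>lborel)"
    by (intro nn_integral_cong) (auto simp: indicator_def intro!: nn_integral_cong)
  also have "\<dots> \<le> (\<integral>\<^sup>+s. (C * ennreal a * (\<integral>\<^sup>+\<tau>. indicator {\<tau>. 0 < \<tau> \<and> ennreal \<tau> < d s} \<tau> * m \<tau> \<partial>lborel)) * indicator {0<..} s \<partial>lborel)"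
    by (intro nn_integral_mono mult_right_mono lev) auto
  also have "\<dots> = (\<integral>\<^sup>+s. C * ennreal a * (\<integral>\<^sup>+\<tau>. ?J s \<tau> \<partial>lborel) \<partial>lborel)"
    by (intro nn_integral_cong) (auto simp: indicator_def)
  also have "\<dots> = C * ennreal a * (\<integral>\<^sup>+s. (\<integral>\<^sup>+\<tau>. ?J s \<tau> \<partial>lborel) \<partial>lborel)"
    by (rule nn_integral_cmult) measurable
  also have "(\<integral>\<^sup>+s. (\<integral>\<^sup>+\<tau>. ?J s \<tau> \<partial>lborel) \<partial>lborel)
    = (\<integral>\<^sup>+\<tau>. (\<integral>\<^sup>+s. ?J s \<tau> \<partial>lborel) \<partial>lborel)"
    by (rule lborel_pair.Fubini'[symmetric]) measurable
  also have "\<dots> \<le> (\<integral>\<^sup>+\<tau>. rearr M f \<tau> * m \<tau> * indicator {0<..} \<tau> \<partial>lborel)"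
  proof (rule nn_integral_mono)
    fix \<tau> :: real
    \<comment> \<open>After the exchange, \<tau> is fixed and \<open>s\<close> runs over the levels
      with d(s) > \<tau>. They fill at most the interval from 0 to
      \<open>rearr M f \<tau>\<close>.\<close>
    have sub: "{s. 0 < s \<and> ennreal \<tau> < d s} \<subseteq> {s. 0 < s \<and> ennreal s \<le> rearr M f \<tau>}"
      unfolding d_def using rearr_ge[OF f, of \<tau>] by blast
    have "(\<integral>\<^sup>+s. ?J s \<tau> \<partial>lborel)
      \<le> (\<integral>\<^sup>+s. (m \<tau> * indicator {0<..} \<tau>) * indicator {s. 0 < s \<and> ennreal s \<le> rearr M f \<tau>} s \<partial>lborel)"
      using sub by (intro nn_integral_mono) (auto simp: indicator_def)
    also have "\<dots> = (m \<tau> * indicator {0<..} \<tau>) * emeasure lborel {s. 0 < s \<and> ennreal s \<le> rearr M f \<tau>}"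
      by (rule nn_integral_cmult_indicator) measurable
    finally show "(\<integral>\<^sup>+s. ?J s \<tau> \<partial>lborel)
      \<le> rearr M f \<tau> * m \<tau> * indicator {0<..} \<tau>" by (simp add: emeasure_lborel_le mult_ac)
  qed
  finally show ?thesis unfolding m_def hardy_op_def by (simp add: mult_left_mono)
qed

text \<open>If U exceeded s on a set of measure more than t, its mean over a subset of finite
  measure a > t would be at least s, while \<open>kernel_average_le\<close> bounds that mean by the
  right-hand side, which decreases in t. Means are additive and rearrangements are not, so handling
  the whole sum at once keeps every summand at t.\<close>

lemma rearr_kernel_le:
  fixes k :: "'b \<Rightarrow> 'b \<Rightarrow> ennreal"
  assumes kern: "riesz_kernel M k C \<alpha>"
    and \<alpha>: "0 < \<alpha>" "\<alpha> < 1"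
    and J: "finite J" and f[measurable]: "\<And>j. j \<in> J \<Longrightarrow> f j \<in> borel_measurable M"
    and U[measurable]: "U \<in> borel_measurable M"
    and Uf: "\<And>x. x \<in> space M \<Longrightarrow> U x \<le> (\<Sum>j\<in>J. \<integral>\<^sup>+y. k x y * f j y \<partial>M)"
    and t: "0 < t"
  shows "rearr M U t \<le> C * (\<Sum>j\<in>J. hardy_op \<alpha> (rearr M (f j)) t)"
    (is "_ \<le> ?\<Phi>")
proof (rule dense_ge)
  note k[measurable] = riesz_kernelD(2)[OF kern]
  interpret M: sigma_finite_measure M by (rule riesz_kernelD(1)[OF kern])
  fix s assume s: "?\<Phi> < s"
  show "rearr M U t \<le> s"
  proof (rule rearr_le, rule ccontr)
    let ?E = "{x \<in> space M. s < U x}"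
    assume "\<not> emeasure M ?E \<le> ennreal t"
    then have gt: "ennreal t < emeasure M ?E" by simp
    \<comment> \<open>The level set may have infinite measure; an exhaustion yields a part of finite
      measure that still exceeds \<open>t\<close>.\<close>
    obtain B :: "nat \<Rightarrow> 'b set" where B: "range B \<subseteq> sets M" "(\<Union>i. B i) = space M" "\<And>i. emeasure M (B i) \<noteq> \<infinity>" "incseq B"
      by (rule M.sigma_finite_incseq) blast
    have E[measurable]: "?E \<in> sets M" by measurable
    have "incseq (\<lambda>i. B i \<inter> ?E)" using B(4) unfolding incseq_def by blast
    then have "(SUP i. emeasure M (B i \<inter> ?E)) = emeasure M (\<Union>i. B i \<inter> ?E)"
      using B(1) E by (intro SUP_emeasure_incseq) auto
    also have "(\<Union>i. B i \<inter> ?E) = ?E" using B(2) by blast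
    finally have "ennreal t < (SUP i. emeasure M (B i \<inter> ?E))" using gt by simp
    then obtain i where i: "ennreal t < emeasure M (B i \<inter> ?E)" unfolding less_SUP_iff by auto
    define A where "A = B i \<inter> ?E"
    have A[measurable]: "A \<in> sets M" unfolding A_def using B(1) E by blast
    have "emeasure M A \<le> emeasure M (B i)" unfolding A_def using B(1) by (intro emeasure_mono) auto
    then have "emeasure M A \<noteq> top" using B(3)[of i] by (auto simp: top_unique)
    then obtain a where a: "emeasure M A = ennreal a" "0 \<le> a" by (cases "emeasure M A") auto
    then have ta: "t < a" using i t unfolding A_def[symmetric] by (simp add: ennreal_less_iff)
    have a0: "0 < a" using ta t by simp
    have "s * ennreal a = (\<integral>\<^sup>+x. s * indicator A x \<partial>M)" using a(1) by (simp add: nn_integral_cmult_indicator)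
    also have "\<dots> \<le> (\<integral>\<^sup>+x. (\<Sum>j\<in>J. \<integral>\<^sup>+y. k x y * f j y \<partial>M) * indicator A x \<partial>M)"
    proof (rule nn_integral_mono)
      fix x assume x: "x \<in> space M"
      show "s * indicator A x \<le> (\<Sum>j\<in>J. \<integral>\<^sup>+y. k x y * f j y \<partial>M) * indicator A x"
        using Uf[OF x] by (cases "x \<in> A") (auto simp: A_def)
    qed
    also have "\<dots> = (\<integral>\<^sup>+x. (\<Sum>j\<in>J. (\<integral>\<^sup>+y. k x y * f j y \<partial>M) * indicator A x) \<partial>M)"
      by (simp add: sum_distrib_right)
    also have "\<dots> = (\<Sum>j\<in>J. \<integral>\<^sup>+x. (\<integral>\<^sup>+y. k x y * f j y \<partial>M) * indicator A x \<partial>M)"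
    proof (rule nn_integral_sum)
      fix j assume [simp]: "j \<in> J"
      note f[OF this, measurable]
      show "(\<lambda>x. (\<integral>\<^sup>+y. k x y * f j y \<partial>M) * indicator A x) \<in> borel_measurable M" by measurable
    qed
    also have "\<dots> \<le> (\<Sum>j\<in>J. C * ennreal a * hardy_op \<alpha> (rearr M (f j)) a)"
      by (intro sum_mono kernel_average_le[OF kern \<alpha> f A a(1) a0])
    also have "\<dots> \<le> (\<Sum>j\<in>J. C * ennreal a * hardy_op \<alpha> (rearr M (f j)) t)"
      unfolding hardy_op_def using \<alpha> t ta by (intro sum_mono mult_left_mono nn_integral_mono mult_right_mono ennreal_leI powr_mono2') auto
    also have "\<dots> = ?\<Phi> * ennreal a" by (simp add: sum_distrib_left sum_distrib_right mult_ac)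
    also have "\<dots> < s * ennreal a" using s a0 by (simp add: ennreal_mult_strict_right_mono less_top)
    finally show False by simp
  qed
qed

section \<open>Hardy inequality with power weights\<close>

lemma nn_integral_dilate:
  fixes f :: "real \<Rightarrow> ennreal"
  assumes f: "f \<in> borel_measurable borel" and c: "0 < c"
  shows "(\<integral>\<^sup>+x. f x * indicator {0<..} x \<partial>lborel) = ennreal c * (\<integral>\<^sup>+x. f (c * x) * indicator {0<..} x \<partial>lborel)"
proof -
  have "(\<integral>\<^sup>+x. f x * indicator {0<..} x \<partial>lborel) = ennreal \<bar>c\<bar> * (\<integral>\<^sup>+x. f (0 + c * x) * indicator {0<..} (0 + c * x) \<partial>lborel)"
    by (rule nn_integral_real_affine[of "\<lambda>x. f x * indicator {0<..} x" c 0]) (use f c in auto)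
  also have "(\<lambda>x. indicator {0<..} (0 + c * x) :: ennreal) = indicator {0<..}"
    using c by (auto simp: fun_eq_iff indicator_def zero_less_mult_iff)
  finally show ?thesis using c by simp
qed

lemma nn_integral_set_has_integral:
  fixes f :: "real \<Rightarrow> real"
  assumes "(f has_integral I) A" "\<And>x. x \<in> A \<Longrightarrow> 0 \<le> f x"
  shows "(\<integral>\<^sup>+x. ennreal (f x) * indicator A x \<partial>lborel) = ennreal I"
proof -
  have "(\<integral>\<^sup>+x. ennreal (f x) * indicator A x \<partial>lborel) = (\<integral>\<^sup>+x. ennreal (indicator A x * f x) \<partial>lborel)"
    by (intro nn_integral_cong) (auto simp: indicator_def)
  also have "\<dots> = ennreal I" using nn_integral_has_integral_lebesgue[OF assms(2,1)] by simp
  finally show ?thesis .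
qed

text \<open>With \<open>a = \<alpha> + \<beta>\<close> and \<open>b = \<beta>\<close> this is the
  mass of the dilation kernel in \<open>hardy_inequality\<close>. The two hypotheses give
  integrability at 0 and at infinity.\<close>

lemma hardy_weight_finite:
  assumes "a < 1" "0 < b"
  shows "\<exists>m>0. (\<integral>\<^sup>+v. ennreal (v powr (- a) * max v 1 powr (a - b - 1)) * indicator {0<..} v \<partial>lborel) \<le> ennreal m"
proof -
  have 1: "((\<lambda>v. v powr (- a)) has_integral (1 powr (- a + 1) / (- a + 1))) {0..1}"
    by (rule has_integral_powr_from_0) (use assms in auto)
  have 2: "((\<lambda>v. v powr (- b - 1)) has_integral - (1 powr ((- b - 1) + 1)) / ((- b - 1) + 1)) {1..}"
    by (rule has_integral_powr_to_inf) (use assms in auto)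
  have n1: "(\<integral>\<^sup>+v. ennreal (v powr (- a)) * indicator {0..1} v \<partial>lborel) = ennreal (1 / (- a + 1))"
    using nn_integral_set_has_integral[OF 1] by simp
  have n2: "(\<integral>\<^sup>+v. ennreal (v powr (- b - 1)) * indicator {1..} v \<partial>lborel) = ennreal (1 / b)"
    using nn_integral_set_has_integral[OF 2] by simp
  have "(\<integral>\<^sup>+v. ennreal (v powr (- a) * max v 1 powr (a - b - 1)) * indicator {0<..} v \<partial>lborel)
    \<le> (\<integral>\<^sup>+v. ennreal (v powr (- a)) * indicator {0..1} v + ennreal (v powr (- b - 1)) * indicator {1..} v \<partial>lborel)"
  proof (rule nn_integral_mono)
    fix v :: real
    have "v powr (- a) * v powr (a - b - 1) = v powr (- b - 1)" if "1 \<le> v" using that by (simp add: powr_add[symmetric])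
    then show "ennreal (v powr (- a) * max v 1 powr (a - b - 1)) * indicator {0<..} v
      \<le> ennreal (v powr (- a)) * indicator {0..1} v + ennreal (v powr (- b - 1)) * indicator {1..} v"
      by (cases "v \<le> 1") (auto simp: indicator_def max_def)
  qed
  also have "\<dots> = ennreal (1 / (1 - a)) + ennreal (1 / b)"
    by (subst nn_integral_add) (auto simp: n1 n2 add.commute)
  also have "\<dots> = ennreal (1 / (1 - a) + 1 / b)" using assms by (intro ennreal_plus[symmetric]) auto
  finally show ?thesis using assms by (intro exI[of _ "1 / (1 - a) + 1 / b"]) (auto intro!: add_pos_pos)
qed

lemma borel_measurable_hardy_op [measurable]:
  assumes [measurable]: "H \<in> borel_measurable borel"
  shows "hardy_op \<alpha> H \<in> borel_measurable borel"
  unfolding hardy_op_def[abs_def] by measurable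

text \<open>\<beta> stands for the reciprocal of the first Lorentz index. The outer root 1/\<rho> is
  left out, which keeps the later estimates additive.\<close>

definition weighted_int :: "real \<Rightarrow> real \<Rightarrow> (real \<Rightarrow> ennreal) \<Rightarrow> ennreal" where
  "weighted_int \<beta> \<rho> H = (\<integral>\<^sup>+t\<in>{0<..}. epowr (ennreal (t powr \<beta>) * H t) \<rho> * ennreal (1 / t) \<partial>lborel)"

text \<open>The substitution \<tau> = t v turns t^\<beta> times the operator into the integral of
  F(t v) w(v) dv with F(t) = t^(\<alpha>+\<beta>) H(t), a superposition of dilations with a weight
  of finite mass. Jensen for that weight and the dilation invariance of dt/t finish the
  proof.\<close>

lemma hardy_inequality:
  assumes \<alpha>: "0 < \<alpha>" and \<beta>: "0 < \<beta>" "\<alpha> + \<beta> < 1" and \<rho>: "1 < \<rho>"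
  obtains C where "0 < C"
    "\<And>H. H \<in> borel_measurable borel \<Longrightarrow>
      weighted_int \<beta> \<rho> (hardy_op \<alpha> H) \<le> ennreal C * weighted_int (\<alpha> + \<beta>) \<rho> H"
proof -
  define w where "w v = ennreal (v powr - (\<alpha> + \<beta>) * max v 1 powr (\<alpha> - 1)) * indicator {0<..} v" for v :: real
  have wm[measurable]: "w \<in> borel_measurable borel" unfolding w_def by measurable
  obtain m where m: "0 < m" "(\<integral>\<^sup>+v. w v \<partial>lborel) \<le> ennreal m"
    using hardy_weight_finite[of "\<alpha> + \<beta>" \<beta>] \<beta> unfolding w_def by auto
  define c where "c = 2 powr \<rho> * m powr (\<rho> - 1)"
  show ?thesis
  proof (rule that[of "c * m"])
    show "0 < c * m" using m by (simp add: c_def)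
    fix H :: "real \<Rightarrow> ennreal" assume H[measurable]: "H \<in> borel_measurable borel"
    define F where "F t = ennreal (t powr (\<alpha> + \<beta>)) * H t" for t
    let ?e = "\<lambda>t v. epowr (F (t * v)) \<rho> * w v * (ennreal (1 / t) * indicator {0<..} t)"
    let ?Q = "\<lambda>t. \<integral>\<^sup>+v. epowr (F (t * v)) \<rho> * w v \<partial>lborel"
    let ?S = "\<integral>\<^sup>+t\<in>{0<..}. epowr (F t) \<rho> * ennreal (1 / t) \<partial>lborel"
    have Fm[measurable]: "F \<in> borel_measurable borel" unfolding F_def by measurable
    have inner: "ennreal (t powr \<beta>) * hardy_op \<alpha> H t
        = (\<integral>\<^sup>+v. F (t * v) * w v \<partial>lborel)" if t: "0 < t" for t
    proof -
      have "ennreal (t powr \<beta>) * hardy_op \<alpha> H t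
        = ennreal (t powr \<beta>) * (ennreal t * (\<integral>\<^sup>+v. H (t * v) * ennreal (max (t * v) t powr (\<alpha> - 1)) * indicator {0<..} v \<partial>lborel))"
        unfolding hardy_op_def by (subst nn_integral_dilate[OF _ t]) measurable
      also have "\<dots> = (\<integral>\<^sup>+v. ennreal (t powr \<beta>) * (ennreal t * (H (t * v) * ennreal (max (t * v) t powr (\<alpha> - 1)) * indicator {0<..} v)) \<partial>lborel)"
        by (simp add: nn_integral_cmult)
      also have "\<dots> = (\<integral>\<^sup>+v. F (t * v) * w v \<partial>lborel)"
      proof (rule nn_integral_cong)
        fix v :: real
        show "ennreal (t powr \<beta>) * (ennreal t * (H (t * v) * ennreal (max (t * v) t powr (\<alpha> - 1)) * indicator {0<..} v)) = F (t * v) * w v"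
        proof (cases "0 < v")
          case True
          \<comment> \<open>Homogeneity count: the outer weight gives t^\<beta>, the measure gives
            t, the kernel gives t^(\<alpha>-1), together the power t^(\<alpha>+\<beta>) that belongs
            to F.\<close>
          have "max (t * v) t = t * max v 1" using t by (simp add: max_mult_distrib_left)
          then have "t powr \<beta> * (t * max (t * v) t powr (\<alpha> - 1)) = (t powr \<beta> * (t * t powr (\<alpha> - 1))) * max v 1 powr (\<alpha> - 1)"
            using t True by (simp add: powr_mult)
          also have "t powr \<beta> * (t * t powr (\<alpha> - 1)) = t powr (\<alpha> + \<beta>)"
            using t by (simp add: powr_mult_base powr_add[symmetric] add.commute)
          also have "\<dots> = (t * v) powr (\<alpha> + \<beta>) * v powr - (\<alpha> + \<beta>)"
            using t True by (simp add: powr_mult powr_minus del: minus_add_distrib)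
          finally have "ennreal (t powr \<beta> * (t * max (t * v) t powr (\<alpha> - 1))) = ennreal ((t * v) powr (\<alpha> + \<beta>) * v powr - (\<alpha> + \<beta>) * max v 1 powr (\<alpha> - 1))"
            by simp
          moreover have "ennreal (t powr \<beta>) * (ennreal t * (h * ennreal b * 1)) = h * ennreal (t powr \<beta> * (t * b))" if "0 \<le> b" for h b
            using t that by (simp add: ennreal_mult mult_ac)
          moreover have "ennreal ((t * v) powr (\<alpha> + \<beta>)) * h * (ennreal (b * b') * 1) = h * ennreal ((t * v) powr (\<alpha> + \<beta>) * b * b')" if "0 \<le> b" "0 \<le> b'" for h b b'
            using that by (simp add: ennreal_mult mult_ac)
          ultimately show ?thesis using True unfolding F_def w_def by simp
        qed (simp add: w_def)
      qed
      finally show ?thesis .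
    qed
    have jensen: "epowr (\<integral>\<^sup>+v. F (t * v) * w v \<partial>lborel) \<rho> \<le> ennreal c * ?Q t" for t
    proof -
      have "epowr (\<integral>\<^sup>+v. F (t * v) \<partial>density lborel w) \<rho> \<le> ennreal c * (\<integral>\<^sup>+v. epowr (F (t * v)) \<rho> \<partial>density lborel w)"
        unfolding c_def by (rule nn_integral_epowr_le) (use m \<rho> in \<open>auto simp: emeasure_density\<close>)
      then show ?thesis by (simp add: nn_integral_density mult.commute)
    qed
    have "weighted_int \<beta> \<rho> (hardy_op \<alpha> H)
      \<le> (\<integral>\<^sup>+t\<in>{0<..}. (ennreal c * ?Q t) * ennreal (1 / t) \<partial>lborel)"
      unfolding weighted_int_def
    proof (rule nn_integral_mono)
      fix t :: real
      show "epowr (ennreal (t powr \<beta>) * hardy_op \<alpha> H t) \<rho> * ennreal (1 / t) * indicator {0<..} t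
        \<le> (ennreal c * ?Q t) * ennreal (1 / t) * indicator {0<..} t"
        using jensen[of t] inner[of t] by (cases "0 < t") (auto intro!: mult_right_mono)
    qed
    also have "\<dots> = (\<integral>\<^sup>+t. ennreal c * (\<integral>\<^sup>+v. ?e t v \<partial>lborel) \<partial>lborel)"
    proof (rule nn_integral_cong)
      fix t :: real
      have "(\<integral>\<^sup>+v. ?e t v \<partial>lborel)
        = ?Q t * (ennreal (1 / t) * indicator {0<..} t)"
        by (rule nn_integral_multc) measurable
      then show "ennreal c * ?Q t * ennreal (1 / t) * indicator {0<..} t
        = ennreal c * (\<integral>\<^sup>+v. ?e t v \<partial>lborel)"
        by (simp add: mult.assoc)
    qed
    also have "\<dots> = ennreal c * (\<integral>\<^sup>+t. (\<integral>\<^sup>+v. ?e t v \<partial>lborel) \<partial>lborel)"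
      by (rule nn_integral_cmult) measurable
    also have "(\<integral>\<^sup>+t. (\<integral>\<^sup>+v. ?e t v \<partial>lborel) \<partial>lborel)
      = (\<integral>\<^sup>+v. (\<integral>\<^sup>+t. ?e t v \<partial>lborel) \<partial>lborel)"
      by (rule lborel_pair.Fubini'[symmetric]) measurable
    also have "\<dots> = (\<integral>\<^sup>+v. w v * ?S \<partial>lborel)"
    proof (rule nn_integral_cong)
      fix v :: real
      show "(\<integral>\<^sup>+t. ?e t v \<partial>lborel) = w v * ?S"
      proof (cases "0 < v")
        case True
        \<comment> \<open>Invariance of dt/t: the Jacobian v cancels the v in 1/(v t).\<close>
        have "?S = ennreal v * (\<integral>\<^sup>+t\<in>{0<..}. epowr (F (v * t)) \<rho> * ennreal (1 / (v * t)) \<partial>lborel)"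
          by (rule nn_integral_dilate[OF _ True]) measurable
        also have "\<dots> = (\<integral>\<^sup>+t. ennreal v * (epowr (F (v * t)) \<rho> * ennreal (1 / (v * t)) * indicator {0<..} t) \<partial>lborel)"
          by (rule nn_integral_cmult[symmetric]) measurable
        also have "\<dots> = (\<integral>\<^sup>+t. epowr (F (t * v)) \<rho> * (ennreal (1 / t) * indicator {0<..} t) \<partial>lborel)"
        proof (rule nn_integral_cong)
          fix t :: real
          have "ennreal v * ennreal (1 / (v * t)) = ennreal (1 / t)" if "0 < t" using that True by (simp add: ennreal_mult[symmetric])
          then show "ennreal v * (epowr (F (v * t)) \<rho> * ennreal (1 / (v * t)) * indicator {0<..} t) = epowr (F (t * v)) \<rho> * (ennreal (1 / t) * indicator {0<..} t)"
            by (cases "0 < t") (simp_all add: mult_ac mult.left_commute[of "ennreal v"])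
        qed
        finally have "w v * ?S = (\<integral>\<^sup>+t. w v * (epowr (F (t * v)) \<rho> * (ennreal (1 / t) * indicator {0<..} t)) \<partial>lborel)"
          by (simp add: nn_integral_cmult)
        then show ?thesis by (simp add: mult_ac)
      qed (simp add: w_def)
    qed
    also have "\<dots> = (\<integral>\<^sup>+v. w v \<partial>lborel) * ?S"
      by (rule nn_integral_multc) measurable
    also have "ennreal c * \<dots> \<le> ennreal c * (ennreal m * ?S)"
      using m by (intro mult_left_mono mult_right_mono) auto
    also have "\<dots> = ennreal (c * m) * ?S"
      using m by (simp add: c_def ennreal_mult mult.assoc)
    finally show "weighted_int \<beta> \<rho> (hardy_op \<alpha> H) \<le> ennreal (c * m) * weighted_int (\<alpha> + \<beta>) \<rho> H"
      unfolding F_def weighted_int_def[of "\<alpha> + \<beta>"] .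
  qed
qed

section \<open>Absorption estimate in the Lorentz space\<close>

definition lorentz_int :: "'b measure \<Rightarrow> real \<Rightarrow> real \<Rightarrow> ('b \<Rightarrow> ennreal) \<Rightarrow> ennreal" where
  "lorentz_int M \<beta> \<rho> f =
    weighted_int \<beta> \<rho> (rearr M f)"

text \<open>The rearrangements of the products are controlled at 2 \<tau> only. A dilation of the
  Hardy integral brings them back to \<tau>: the Jacobian costs the factor 2, and the kernel only
  grows since it decreases in \<tau>.\<close>

lemma potential_rearr_le:
  fixes k :: "'b \<Rightarrow> 'b \<Rightarrow> ennreal" and m :: nat
  assumes kern: "riesz_kernel M k C \<alpha>"
    and \<alpha>: "0 < \<alpha>" "\<alpha> < 1"
    and q: "\<And>i. i \<in> {1..m} \<Longrightarrow> 0 < q i \<and> q i < 1"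
    and \<sigma>[measurable]: "\<And>i. i \<in> {1..m} \<Longrightarrow> \<sigma> i \<in> borel_measurable M"
    and \<omega>[measurable]: "\<omega> \<in> borel_measurable M"
    and u[measurable]: "u \<in> borel_measurable M" and U: "U \<in> borel_measurable M"
    and Uu: "\<And>x. x \<in> space M \<Longrightarrow> U x \<le> (\<Sum>i=1..m. \<integral>\<^sup>+y. k x y * (\<sigma> i y * epowr (u y) (q i)) \<partial>M) + (\<integral>\<^sup>+y. k x y * \<omega> y \<partial>M)"
    and t: "0 < t"
  shows "rearr M U t \<le> C * hardy_op \<alpha> (\<lambda>\<tau>. (\<Sum>i=1..m. 2 * (rearr M (\<sigma> i) \<tau> * epowr (rearr M u \<tau>) (q i))) + rearr M \<omega> \<tau>) t"
proof -
  \<comment> \<open>Index 0 carries \<omega>, so that all sources form one family for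
    \<open>rearr_kernel_le\<close>.\<close>
  define f where "f j = (if j = 0 then \<omega> else (\<lambda>y. \<sigma> j y * epowr (u y) (q j)))" for j :: nat
  define w where "w \<tau> = ennreal (max \<tau> t powr (\<alpha> - 1)) * indicator {0<..} \<tau>" for \<tau>
  let ?c = "\<lambda>i \<tau>. 2 * (rearr M (\<sigma> i) \<tau> * epowr (rearr M u \<tau>) (q i))"
  have [measurable]: "w \<in> borel_measurable borel" unfolding w_def by measurable
  have fm: "f j \<in> borel_measurable M" if "j \<in> {0..m}" for j
  proof (cases "j = 0")
    case False
    then have "\<sigma> j \<in> borel_measurable M" using that by (intro \<sigma>) auto
    then show ?thesis using u False by (simp add: f_def)
  qed (simp add: f_def \<omega>)
  have "rearr M U t \<le> C * (\<Sum>j\<in>{0..m}. hardy_op \<alpha> (rearr M (f j)) t)"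
  proof (rule rearr_kernel_le[OF kern \<alpha> _ fm U _ t])
    fix x assume x: "x \<in> space M"
    have "(\<Sum>j\<in>{0..m}. \<integral>\<^sup>+y. k x y * f j y \<partial>M) = (\<integral>\<^sup>+y. k x y * f 0 y \<partial>M) + (\<Sum>j\<in>{1..m}. \<integral>\<^sup>+y. k x y * f j y \<partial>M)"
      by (simp add: sum.atLeast_Suc_atMost)
    also have "(\<Sum>j\<in>{1..m}. \<integral>\<^sup>+y. k x y * f j y \<partial>M) = (\<Sum>i=1..m. \<integral>\<^sup>+y. k x y * (\<sigma> i y * epowr (u y) (q i)) \<partial>M)"
      by (intro sum.cong) (auto simp: f_def)
    finally show "U x \<le> (\<Sum>j\<in>{0..m}. \<integral>\<^sup>+y. k x y * f j y \<partial>M)"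
      using Uu[OF x] by (simp add: f_def add.commute)
  qed simp_all
  also have "(\<Sum>j\<in>{0..m}. hardy_op \<alpha> (rearr M (f j)) t)
    = (\<integral>\<^sup>+\<tau>. rearr M \<omega> \<tau> * w \<tau> \<partial>lborel) + (\<Sum>j\<in>{1..m}. \<integral>\<^sup>+\<tau>. rearr M (f j) \<tau> * w \<tau> \<partial>lborel)"
    by (simp add: sum.atLeast_Suc_atMost w_def f_def hardy_op_def mult.assoc)
  also have "\<dots> \<le> (\<integral>\<^sup>+\<tau>. rearr M \<omega> \<tau> * w \<tau> \<partial>lborel)
    + (\<Sum>i=1..m. \<integral>\<^sup>+\<tau>. ?c i \<tau> * w \<tau> \<partial>lborel)"
  proof (intro add_left_mono sum_mono)
    fix i assume i: "i \<in> {1..m}"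
    have w: "w \<tau> * indicator {0<..} \<tau> = w \<tau>" for \<tau> by (simp add: w_def indicator_def)
    have "(\<integral>\<^sup>+\<tau>. rearr M (f i) \<tau> * w \<tau> \<partial>lborel) = (\<integral>\<^sup>+\<tau>. rearr M (f i) \<tau> * w \<tau> * indicator {0<..} \<tau> \<partial>lborel)"
      by (simp only: mult.assoc w)
    also have "\<dots> = ennreal 2 * (\<integral>\<^sup>+\<tau>. rearr M (f i) (2 * \<tau>) * w (2 * \<tau>) * indicator {0<..} \<tau> \<partial>lborel)"
      by (rule nn_integral_dilate) auto
    also have "\<dots> = (\<integral>\<^sup>+\<tau>. ennreal 2 * (rearr M (f i) (2 * \<tau>) * w (2 * \<tau>) * indicator {0<..} \<tau>) \<partial>lborel)"
      by (rule nn_integral_cmult[symmetric]) measurable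
    also have "\<dots> \<le> (\<integral>\<^sup>+\<tau>. ?c i \<tau> * w \<tau> \<partial>lborel)"
    proof (rule nn_integral_mono)
      fix \<tau> :: real
      show "ennreal 2 * (rearr M (f i) (2 * \<tau>) * w (2 * \<tau>) * indicator {0<..} \<tau>) \<le> ?c i \<tau> * w \<tau>"
      proof (cases "0 < \<tau>")
        case True
        have "rearr M (f i) (2 * \<tau>) \<le> rearr M (\<sigma> i) \<tau> * epowr (rearr M u \<tau>) (q i)"
          using rearr_mult_epowr[OF \<sigma>[OF i] u True, of "q i"] q[OF i] i by (simp add: f_def)
        moreover have "w (2 * \<tau>) \<le> w \<tau>"
          using True t \<alpha> by (auto simp: w_def intro!: ennreal_leI powr_mono2')
        ultimately have "2 * (rearr M (f i) (2 * \<tau>) * w (2 * \<tau>)) \<le> 2 * (rearr M (\<sigma> i) \<tau> * epowr (rearr M u \<tau>) (q i) * w \<tau>)"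
          by (intro mult_left_mono mult_mono) auto
        then show ?thesis using True by (simp add: mult.assoc)
      qed simp
    qed
    finally show "(\<integral>\<^sup>+\<tau>. rearr M (f i) \<tau> * w \<tau> \<partial>lborel)
      \<le> (\<integral>\<^sup>+\<tau>. ?c i \<tau> * w \<tau> \<partial>lborel)" .
  qed
  also have "\<dots> = (\<integral>\<^sup>+\<tau>. ((\<Sum>i=1..m. ?c i \<tau>) + rearr M \<omega> \<tau>) * w \<tau> \<partial>lborel)"
    (is "_ = ?R")
  proof -
    have "?R = (\<integral>\<^sup>+\<tau>. rearr M \<omega> \<tau> * w \<tau> + (\<Sum>i=1..m. ?c i \<tau> * w \<tau>) \<partial>lborel)"
      by (intro nn_integral_cong) (simp add: sum_distrib_right distrib_right add.commute)
    also have "\<dots> = (\<integral>\<^sup>+\<tau>. rearr M \<omega> \<tau> * w \<tau> \<partial>lborel)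
      + (\<integral>\<^sup>+\<tau>. (\<Sum>i=1..m. ?c i \<tau> * w \<tau>) \<partial>lborel)"
      by (rule nn_integral_add) measurable
    also have "(\<integral>\<^sup>+\<tau>. (\<Sum>i=1..m. ?c i \<tau> * w \<tau>) \<partial>lborel)
      = (\<Sum>i=1..m. \<integral>\<^sup>+\<tau>. ?c i \<tau> * w \<tau> \<partial>lborel)"
      by (rule nn_integral_sum) measurable
    finally show ?thesis by (rule sym)
  qed
  finally show ?thesis unfolding w_def hardy_op_def by (simp add: mult_left_mono mult.assoc)
qed

text \<open>The weight factors as t^(\<alpha>+\<beta>) = t^(\<alpha>+\<beta>-q \<beta>)
  (t^\<beta>)^q. Hence Young's inequality, applied pointwise in t, produces exactly the integrands
  of the functionals of \<sigma>_i and of u, and no loss occurs in any exponent.\<close>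

lemma lorentz_potential_contraction:
  fixes k :: "'b \<Rightarrow> 'b \<Rightarrow> ennreal" and m :: nat
  assumes kern: "riesz_kernel M k (ennreal C) \<alpha>"
    and C: "0 < C"
    and \<alpha>: "0 < \<alpha>" and \<beta>: "0 < \<beta>" "\<alpha> + \<beta> < 1" and \<rho>: "1 < \<rho>"
    and q: "\<And>i. i \<in> {1..m} \<Longrightarrow> 0 < q i \<and> q i < 1"
    and \<sigma>[measurable]: "\<And>i. i \<in> {1..m} \<Longrightarrow> \<sigma> i \<in> borel_measurable M"
    and \<omega>[measurable]: "\<omega> \<in> borel_measurable M"
    and \<sigma>fin: "\<And>i. i \<in> {1..m} \<Longrightarrow> lorentz_int M (\<alpha> + \<beta> - q i * \<beta>) (\<rho> / (1 - q i)) (\<sigma> i) < \<infinity>"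
    and \<omega>fin: "lorentz_int M (\<alpha> + \<beta>) \<rho> \<omega> < \<infinity>"
  obtains K where "K < \<infinity>"
    "\<And>u U. u \<in> borel_measurable M \<Longrightarrow> U \<in> borel_measurable M \<Longrightarrow>
      (\<And>x. x \<in> space M \<Longrightarrow> U x \<le> (\<Sum>i=1..m. \<integral>\<^sup>+y. k x y * (\<sigma> i y * epowr (u y) (q i)) \<partial>M) + (\<integral>\<^sup>+y. k x y * \<omega> y \<partial>M)) \<Longrightarrow>
      lorentz_int M \<beta> \<rho> U \<le> ennreal (1/2) * lorentz_int M \<beta> \<rho> u + K"
proof -
  have \<alpha>1: "\<alpha> < 1" using \<beta> by simp
  obtain CH where CH: "0 < CH" and hardy: "\<And>H. H \<in> borel_measurable borel \<Longrightarrow>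
      weighted_int \<beta> \<rho> (hardy_op \<alpha> H) \<le> ennreal CH * weighted_int (\<alpha> + \<beta>) \<rho> H"
    using hardy_inequality[OF \<alpha> \<beta> \<rho>] by blast
  \<comment> \<open>Collects the constants of the kernel bound, of the Hardy inequality and of
    splitting a sum of m+1 terms.\<close>
  define B where "B = C powr \<rho> * CH * real (m + 1) powr \<rho>"
  have B: "0 < B" using C CH by (simp add: B_def)
  \<comment> \<open>Chosen so that the total coefficient B m 2^\<rho> \<delta> in front of the
    functional of \<open>u\<close> equals m/(2(m+1)), which is below 1/2.\<close>
  define \<delta> where "\<delta> = 1 / (2 * B * 2 powr \<rho> * real (m + 1))"
  have \<delta>: "0 < \<delta>" using B by (simp add: \<delta>_def)
  have "\<exists>D>0. \<forall>a b. epowr (a * epowr b (q i)) \<rho> \<le> ennreal D * epowr a (\<rho> / (1 - q i)) + ennreal \<delta> * epowr b \<rho>" if "i \<in> {1..m}" for i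
    using epowr_young[of "q i" \<rho> \<delta>] q[OF that] \<rho> \<delta> by (metis less_trans zero_less_one)
  then obtain D where D: "\<And>i. i \<in> {1..m} \<Longrightarrow> 0 < D i"
    "\<And>i a b. i \<in> {1..m} \<Longrightarrow> epowr (a * epowr b (q i)) \<rho> \<le> ennreal (D i) * epowr a (\<rho> / (1 - q i)) + ennreal \<delta> * epowr b \<rho>"
    by metis
  define K where "K = ennreal B * (ennreal (2 powr \<rho>) * (\<Sum>i=1..m. ennreal (D i) * lorentz_int M (\<alpha> + \<beta> - q i * \<beta>) (\<rho> / (1 - q i)) (\<sigma> i)) + lorentz_int M (\<alpha> + \<beta>) \<rho> \<omega>)"
  show ?thesis
  proof (rule that[of K])
    show "K < \<infinity>" unfolding K_def using \<sigma>fin \<omega>fin by (auto simp: ennreal_mult_less_top infinity_ennreal_def)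
    fix u U assume u[measurable]: "u \<in> borel_measurable M" and U: "U \<in> borel_measurable M"
      and Uu: "\<And>x. x \<in> space M \<Longrightarrow> U x \<le> (\<Sum>i=1..m. \<integral>\<^sup>+y. k x y * (\<sigma> i y * epowr (u y) (q i)) \<partial>M) + (\<integral>\<^sup>+y. k x y * \<omega> y \<partial>M)"
    define H where "H \<tau> = (\<Sum>i=1..m. 2 * (rearr M (\<sigma> i) \<tau> * epowr (rearr M u \<tau>) (q i))) + rearr M \<omega> \<tau>" for \<tau>
    have Hm[measurable]: "H \<in> borel_measurable borel" unfolding H_def by measurable
    have le: "rearr M U t \<le> ennreal C * hardy_op \<alpha> H t" if "0 < t" for t
      unfolding H_def[abs_def] by (rule potential_rearr_le[OF kern \<alpha> \<alpha>1 q \<sigma> \<omega> u U Uu that])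
    define XU where "XU i t = epowr (ennreal (t powr (\<alpha> + \<beta> - q i * \<beta>)) * rearr M (\<sigma> i) t) (\<rho> / (1 - q i))" for i t
    define Xu where "Xu t = epowr (ennreal (t powr \<beta>) * rearr M u t) \<rho>" for t
    define X\<omega> where "X\<omega> t = epowr (ennreal (t powr (\<alpha> + \<beta>)) * rearr M \<omega> t) \<rho>" for t
    have [measurable]: "XU i \<in> borel_measurable borel" "Xu \<in> borel_measurable borel" "X\<omega> \<in> borel_measurable borel" for i
      unfolding XU_def Xu_def X\<omega>_def by measurable
    let ?R = "\<lambda>t. X\<omega> t + (\<Sum>i=1..m. ennreal (2 powr \<rho>) * (ennreal (D i) * XU i t + ennreal \<delta> * Xu t))"
    have pt: "epowr (ennreal (t powr (\<alpha> + \<beta>)) * H t) \<rho>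
      \<le> ennreal (real (m + 1) powr \<rho>) * ?R t" if t: "0 < t" for t
    proof -
      define h where "h j = (if j = 0 then ennreal (t powr (\<alpha> + \<beta>)) * rearr M \<omega> t
         else 2 * (ennreal (t powr (\<alpha> + \<beta> - q j * \<beta>)) * rearr M (\<sigma> j) t * epowr (ennreal (t powr \<beta>) * rearr M u t) (q j)))" for j :: nat
      have hj: "ennreal (t powr (\<alpha> + \<beta>)) * (2 * (rearr M (\<sigma> j) t * epowr (rearr M u t) (q j))) = h j" if j: "j \<in> {1..m}" for j
      proof -
        have "t powr (\<alpha> + \<beta>) = t powr (\<alpha> + \<beta> - q j * \<beta>) * (t powr \<beta>) powr q j"
          using t by (simp add: powr_powr powr_add[symmetric] mult.commute)
        then have "ennreal (t powr (\<alpha> + \<beta>)) = ennreal (t powr (\<alpha> + \<beta> - q j * \<beta>)) * epowr (ennreal (t powr \<beta>)) (q j)"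
          by (simp add: ennreal_mult)
        then show ?thesis using j q[OF j] by (simp add: h_def epowr_mult mult_ac)
      qed
      have "ennreal (t powr (\<alpha> + \<beta>)) * H t = (\<Sum>j\<in>{1..m}. h j) + h 0"
        unfolding H_def distrib_left sum_distrib_left by (simp add: hj h_def[of 0])
      also have "\<dots> = (\<Sum>j\<in>{0..m}. h j)" by (simp add: sum.atLeast_Suc_atMost add.commute)
      finally have "epowr (ennreal (t powr (\<alpha> + \<beta>)) * H t) \<rho> \<le> ennreal (real (m + 1) powr \<rho>) * (\<Sum>j\<in>{0..m}. epowr (h j) \<rho>)"
        using epowr_sum_le[of "{0..m}" \<rho> h] \<rho> by simp
      also have "(\<Sum>j\<in>{0..m}. epowr (h j) \<rho>) = X\<omega> t + (\<Sum>j\<in>{1..m}. epowr (h j) \<rho>)"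
        by (simp add: sum.atLeast_Suc_atMost X\<omega>_def h_def)
      also have "\<dots> \<le> X\<omega> t + (\<Sum>i=1..m. ennreal (2 powr \<rho>) * (ennreal (D i) * XU i t + ennreal \<delta> * Xu t))"
      proof (intro add_left_mono sum_mono)
        fix i assume i: "i \<in> {1..m}"
        have "epowr (h i) \<rho> = ennreal (2 powr \<rho>) * epowr (ennreal (t powr (\<alpha> + \<beta> - q i * \<beta>)) * rearr M (\<sigma> i) t * epowr (ennreal (t powr \<beta>) * rearr M u t) (q i)) \<rho>"
          using i \<rho> epowr_ennreal[of 2 \<rho>] by (simp add: h_def epowr_mult)
        also have "\<dots> \<le> ennreal (2 powr \<rho>) * (ennreal (D i) * XU i t + ennreal \<delta> * Xu t)"
          unfolding XU_def Xu_def by (intro mult_left_mono D(2)[OF i]) auto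
        finally show "epowr (h i) \<rho> \<le> ennreal (2 powr \<rho>) * (ennreal (D i) * XU i t + ennreal \<delta> * Xu t)" .
      qed
      finally show ?thesis by (simp add: mult_left_mono)
    qed
    have "lorentz_int M \<beta> \<rho> U \<le> (\<integral>\<^sup>+t. ennreal (C powr \<rho>) * (epowr (ennreal (t powr \<beta>) * hardy_op \<alpha> H t) \<rho> * ennreal (1 / t) * indicator {0<..} t) \<partial>lborel)"
      unfolding lorentz_int_def weighted_int_def
    proof (rule nn_integral_mono)
      fix t :: real
      show "epowr (ennreal (t powr \<beta>) * rearr M U t) \<rho> * ennreal (1 / t) * indicator {0<..} t
        \<le> ennreal (C powr \<rho>) * (epowr (ennreal (t powr \<beta>) * hardy_op \<alpha> H t) \<rho> * ennreal (1 / t) * indicator {0<..} t)"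
      proof (cases "0 < t")
        case True
        have "epowr (ennreal (t powr \<beta>) * rearr M U t) \<rho> \<le> epowr (ennreal (t powr \<beta>) * (ennreal C * hardy_op \<alpha> H t)) \<rho>"
          using \<rho> le[OF True] by (intro epowr_mono mult_left_mono) auto
        also have "\<dots> = ennreal (C powr \<rho>) * epowr (ennreal (t powr \<beta>) * hardy_op \<alpha> H t) \<rho>"
          using \<rho> C by (simp add: epowr_mult mult_ac)
        finally have "epowr (ennreal (t powr \<beta>) * rearr M U t) \<rho> * ennreal (1 / t) \<le> ennreal (C powr \<rho>) * epowr (ennreal (t powr \<beta>) * hardy_op \<alpha> H t) \<rho> * ennreal (1 / t)"
          by (rule mult_right_mono) simp
        then show ?thesis using True by (simp add: mult.assoc)
      qed simp
    qed
    also have "\<dots> = ennreal (C powr \<rho>) * weighted_int \<beta> \<rho> (hardy_op \<alpha> H)"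
      unfolding weighted_int_def by (rule nn_integral_cmult) measurable
    also have "\<dots> \<le> ennreal (C powr \<rho>) * (ennreal CH * weighted_int (\<alpha> + \<beta>) \<rho> H)"
      using hardy[OF Hm] by (intro mult_left_mono) auto
    also have "\<dots> \<le> ennreal (C powr \<rho>) * (ennreal CH * (\<integral>\<^sup>+t. ennreal (real (m + 1) powr \<rho>) *
      (?R t * (ennreal (1 / t) * indicator {0<..} t)) \<partial>lborel))"
      unfolding weighted_int_def
    proof (intro mult_left_mono nn_integral_mono)
      fix t :: real
      show "epowr (ennreal (t powr (\<alpha> + \<beta>)) * H t) \<rho> * ennreal (1 / t) * indicator {0<..} t
        \<le> ennreal (real (m + 1) powr \<rho>) * (?R t * (ennreal (1 / t) * indicator {0<..} t))"
      proof (cases "0 < t")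
        case True
        from mult_right_mono[OF pt[OF True], of "ennreal (1 / t)"] True show ?thesis by (simp add: mult.assoc)
      qed simp
    qed auto
    also have "\<dots> = ennreal B * (\<integral>\<^sup>+t. ?R t * (ennreal (1 / t) * indicator {0<..} t) \<partial>lborel)"
      using C CH by (subst nn_integral_cmult) (auto simp: B_def ennreal_mult mult.assoc)
    also have "(\<integral>\<^sup>+t. ?R t * (ennreal (1 / t) * indicator {0<..} t) \<partial>lborel)
      = (\<integral>\<^sup>+t. X\<omega> t * ennreal (1 / t) * indicator {0<..} t + (\<Sum>i=1..m. ennreal (2 powr \<rho>) * (ennreal (D i) * (XU i t * ennreal (1 / t) * indicator {0<..} t) + ennreal \<delta> * (Xu t * ennreal (1 / t) * indicator {0<..} t))) \<partial>lborel)"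
      by (intro nn_integral_cong) (simp add: distrib_right distrib_left sum_distrib_right mult.assoc)
    also have "\<dots> = lorentz_int M (\<alpha> + \<beta>) \<rho> \<omega> + (\<Sum>i=1..m. ennreal (2 powr \<rho>) * (ennreal (D i) * lorentz_int M (\<alpha> + \<beta> - q i * \<beta>) (\<rho> / (1 - q i)) (\<sigma> i) + ennreal \<delta> * lorentz_int M \<beta> \<rho> u))"
      unfolding lorentz_int_def weighted_int_def XU_def[symmetric] Xu_def[symmetric] X\<omega>_def[symmetric]
      by (simp add: nn_integral_add nn_integral_sum nn_integral_cmult)
    also have "ennreal B * \<dots> = K + ennreal (B * (real m * (2 powr \<rho> * \<delta>))) * lorentz_int M \<beta> \<rho> u"
    proof -
      have s1: "(\<Sum>i=1..m. p * (L i + c)) = p * (\<Sum>i=1..m. L i) + of_nat m * (p * c)" for p c :: ennreal and L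
        by (simp add: sum.distrib distrib_left sum_distrib_left)
      have s2: "ennreal (B * (real m * (2 powr \<rho> * \<delta>))) = ennreal B * (of_nat m * (ennreal (2 powr \<rho>) * ennreal \<delta>))"
        using B \<delta> by (simp add: ennreal_mult ennreal_of_nat_eq_real_of_nat)
      show ?thesis unfolding K_def s1 s2 by (simp add: distrib_left mult_ac add_ac)
    qed
    also have "\<dots> \<le> K + ennreal (1/2) * lorentz_int M \<beta> \<rho> u"
    proof (intro add_left_mono mult_right_mono ennreal_leI)
      have "B * (real m * (2 powr \<rho> * \<delta>)) = (1/2) * (real m / real (m + 1))"
      proof -
        have "B * (a * (p * (1 / (2 * B * p * c)))) = (1/2) * (a / c)" if "0 < p" "0 < c" for a p c
          using B that by (simp add: field_simps)
        from this[of "2 powr \<rho>" "real (m + 1)"] show ?thesis unfolding \<delta>_def by simp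
      qed
      also have "\<dots> \<le> 1/2" by (simp add: field_simps)
      finally show "B * (real m * (2 powr \<rho> * \<delta>)) \<le> 1/2" .
    qed auto
    finally show "lorentz_int M \<beta> \<rho> U \<le> ennreal (1/2) * lorentz_int M \<beta> \<rho> u + K" by (simp add: add.commute)
  qed
qed

section \<open>Mean value inequality for twice differentiable functions\<close>

lemma integral_difference_translate:
  fixes F :: "'a::euclidean_space \<Rightarrow> real"
  assumes "integrable lborel F"
  shows "integrable lborel (\<lambda>z. F (z + e))" "(\<integral>z. F (z + e) \<partial>lborel) = (\<integral>z. F z \<partial>lborel)"
proof -
  have m: "(\<lambda>z. z + e) \<in> lborel \<rightarrow>\<^sub>M (lborel :: 'a measure)" by simp
  have d: "distr lborel lborel (\<lambda>z. z + e) = (lborel :: 'a measure)"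
    using lborel_distr_plus[of e] by (simp add: add.commute cong: distr_cong)
  have Fm: "F \<in> borel_measurable lborel" using assms by auto
  show "integrable lborel (\<lambda>z. F (z + e))"
    using integrable_distr[OF m, of F] d assms by simp
  show "(\<integral>z. F (z + e) \<partial>lborel) = (\<integral>z. F z \<partial>lborel)"
    using integral_distr[OF m Fm] d by simp
qed

text \<open>Difference quotients integrate to zero by translation invariance, and the Lipschitz
  bound dominates them on a common ball, so the same holds for their limit. Differentiability almost
  everywhere suffices, which admits functions with a kink on the unit sphere.\<close>

lemma integral_directional_derivative_eq_0:
  fixes F f :: "'a::euclidean_space \<Rightarrow> real"
  assumes Fint: "integrable lborel F"
    and lip: "\<And>x y. \<bar>F x - F y\<bar> \<le> L * norm (x - y)"
    and supp: "\<And>x. 1 \<le> norm x \<Longrightarrow> F x = 0"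
    and der: "AE z in lborel. ((\<lambda>t. F (z + t *\<^sub>R e)) has_real_derivative f z) (at 0)"
    and fm: "f \<in> borel_measurable borel"
  shows "(\<integral>z. f z \<partial>lborel) = 0"
proof -
  define s where "s k z = (F (z + (1 / Suc k) *\<^sub>R e) - F z) / (1 / Suc k)" for k z
  \<comment> \<open>The increments are at most |e| long, so beyond radius 1 + |e| both values in
    every difference quotient vanish.\<close>
  define w where "w z = indicator (cball 0 (1 + norm e)) z *\<^sub>R (L * norm e)" for z :: 'a
  have t0: "(\<lambda>k. 1 / real (Suc k)) \<longlonglongrightarrow> 0"
    using LIMSEQ_inverse_real_of_nat by (simp add: inverse_eq_divide)
  have sm: "s k \<in> borel_measurable lborel" for k
    unfolding s_def using Fint integral_difference_translate(1)[OF Fint] by (intro borel_measurable_divide borel_measurable_diff) auto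
  have lim: "AE z in lborel. (\<lambda>k. s k z) \<longlonglongrightarrow> f z"
    using der
  proof eventually_elim
    case (elim z)
    have "((\<lambda>t. (F (z + t *\<^sub>R e) - F z) / t) \<longlongrightarrow> f z) (at 0)"
      using elim unfolding has_field_derivative_iff by simp
    have *: "\<And>X. filterlim X (at 0) sequentially \<Longrightarrow> (\<lambda>k. (F (z + X k *\<^sub>R e) - F z) / X k) \<longlonglongrightarrow> f z"
      using filterlim_compose[OF \<open>((\<lambda>t. (F (z + t *\<^sub>R e) - F z) / t) \<longlongrightarrow> f z) (at 0)\<close>] by blast
    have "filterlim (\<lambda>k. 1 / real (Suc k)) (at 0) sequentially"
      unfolding filterlim_at using t0 by auto
    from *[OF this] show ?case unfolding s_def .
  qed
  have Lnn: "0 \<le> L * norm e" using lip[of e 0] abs_ge_zero[of "F e - F 0"] by simp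
  have bnd: "norm (s k z) \<le> w z" for k z
  proof (cases "norm z \<le> 1 + norm e")
    case True
    have "\<bar>F (z + (1 / Suc k) *\<^sub>R e) - F z\<bar> \<le> L * norm e * (1 / Suc k)"
      using lip[of "z + (1 / Suc k) *\<^sub>R e" z] by simp
    then have "\<bar>F (z + (1 / Suc k) *\<^sub>R e) - F z\<bar> / (1 / Suc k) \<le> L * norm e"
      by (subst pos_divide_le_eq) (auto simp del: of_nat_Suc)
    then show ?thesis unfolding s_def w_def using True by (simp add: abs_mult)
  next
    case False
    have "norm ((1 / Suc k) *\<^sub>R e) \<le> norm e" by (simp add: field_simps)
    then have "norm (z + (1 / Suc k) *\<^sub>R e) \<ge> 1" using False norm_diff_ineq[of z "(1 / Suc k) *\<^sub>R e"] by linarith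
    moreover have "norm z \<ge> 1" using False norm_ge_zero[of e] by linarith
    ultimately show ?thesis unfolding s_def w_def using supp False by simp
  qed
  have wint: "integrable lborel w" unfolding w_def
    by (rule borel_integrable_compact) (auto intro: continuous_on_const)
  have fm': "f \<in> borel_measurable lborel" using fm by simp
  note dc = integral_dominated_convergence[OF fm' sm wint lim]
  have b': "\<And>k. AE z in lborel. norm (s k z) \<le> w z" using bnd by simp

  have "(\<integral>z. s k z \<partial>lborel) = 0" for k
    unfolding s_def using integral_difference_translate[OF Fint, of "(1 / Suc k) *\<^sub>R e"] Fint
    by (simp del: of_nat_Suc)
  then have "(\<lambda>k. \<integral>z. s k z \<partial>lborel) = (\<lambda>k. 0)" by simp
  with dc[OF b'] show "(\<integral>z. f z \<partial>lborel) = 0"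
    by (simp add: LIMSEQ_const_iff)
qed

text \<open>The weight \<open>1 - |z|\<^sup>2\<close> vanishes on the unit sphere and has gradient \<open>- 2 z\<close>, so this integration by
  parts has no boundary term; in each coordinate direction it is translation invariance of the integral.\<close>

lemma ball_divergence:
  fixes E :: "'a::euclidean_space \<Rightarrow> 'a" and J :: "'a \<Rightarrow> 'a \<Rightarrow> 'a"
  assumes der: "\<And>z. z \<in> cball 0 1 \<Longrightarrow> (E has_derivative J z) (at z)"
    and cont: "\<And>v. continuous_on (cball 0 1) (\<lambda>z. J z v)"
  shows "2 * (\<integral>z. indicator (cball 0 1) z * (E z \<bullet> z) \<partial>lborel) =
    (\<integral>z. indicator (cball 0 1) z * ((1 - z \<bullet> z) * (\<Sum>b\<in>Basis. J z b \<bullet> b)) \<partial>lborel)"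
proof -
  let ?C = "cball 0 1 :: 'a set"
  have Ec: "continuous_on ?C E"
    using der by (meson continuous_at_imp_continuous_on has_derivative_continuous)
  obtain M0 where M0: "\<And>z. z \<in> ?C \<Longrightarrow> norm (E z) \<le> M0"
    using compact_imp_bounded[OF compact_continuous_image[OF Ec compact_cball]]
    unfolding bounded_iff by blast
  have "\<exists>c. \<forall>z\<in>?C. norm (J z v) \<le> c" for v
    using compact_imp_bounded[OF compact_continuous_image[OF cont[of v] compact_cball]]
    unfolding bounded_iff by blast
  then obtain c where c: "\<And>v z. z \<in> ?C \<Longrightarrow> norm (J z v) \<le> c v" by metis
  define M1 where "M1 = (\<Sum>b\<in>Basis. c b)"
  \<comment> \<open>Continuity is given for each fixed vector \<open>v\<close> only; by linearity
    the operator norm is controlled through the finitely many basis vectors.\<close>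
  have on: "onorm (J z) \<le> M1" if "z \<in> ?C" for z
  proof (rule onorm_le)
    fix v
    have "linear (J z)" using der[OF that] has_derivative_linear by blast
    then have "J z (\<Sum>b\<in>Basis. (v \<bullet> b) *\<^sub>R b) = (\<Sum>b\<in>Basis. (v \<bullet> b) *\<^sub>R J z b)"
      by (simp add: linear_sum linear_scale)
    then have "J z v = (\<Sum>b\<in>Basis. (v \<bullet> b) *\<^sub>R J z b)"
      by (simp add: euclidean_representation)
    also have "norm \<dots> \<le> (\<Sum>b\<in>Basis. norm v * c b)"
      by (intro order.trans[OF norm_sum] sum_mono) (auto intro!: mult_mono c[OF that] Basis_le_norm)
    finally show "norm (J z v) \<le> M1 * norm v" unfolding M1_def sum_distrib_left[symmetric] by (simp add: mult.commute)
  qed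
  have Elip: "norm (E x - E y) \<le> M1 * norm (x - y)" if "x \<in> ?C" "y \<in> ?C" for x y
    by (rule differentiable_bound[OF convex_cball[of 0 1] _ on]) (use that der in \<open>auto intro: has_derivative_at_withinI\<close>)
  have M0nn: "0 \<le> M0" using order.trans[OF norm_ge_zero M0[of 0]] by simp
  have M1nn: "0 \<le> M1" unfolding M1_def by (intro sum_nonneg) (auto intro: order.trans[OF norm_ge_zero c[of 0]])
  define F where "F b z = (if norm z \<le> 1 then (E z \<bullet> b) * (1 - z \<bullet> z) else 0)" for b z
  define f where "f b z = indicator ?C z *\<^sub>R ((J z b \<bullet> b) * (1 - z \<bullet> z) - 2 * ((E z \<bullet> b) * (z \<bullet> b)))" for b z
  have sq: "\<bar>x \<bullet> x - y \<bullet> y\<bar> \<le> 2 * norm (x - y)" if "norm x \<le> 1" "norm y \<le> 1" for x y :: 'a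
  proof -
    have "\<bar>x \<bullet> x - y \<bullet> y\<bar> = \<bar>(x - y) \<bullet> (x + y)\<bar>" by (simp add: inner_diff_left inner_add_right inner_commute algebra_simps)
    also have "\<dots> \<le> norm (x - y) * norm (x + y)" by (rule Cauchy_Schwarz_ineq2)
    also have "\<dots> \<le> norm (x - y) * 2" using that norm_triangle_ineq[of x y] by (intro mult_left_mono) auto
    finally show ?thesis by simp
  qed
  have F0: "F b x = 0" if "1 \<le> norm x" for b x
    using that unfolding F_def by (auto simp: dot_square_norm)
  \<comment> \<open>The extension by zero stays Lipschitz across the sphere because the weight
    vanishes there: for x inside and y outside, 1-|x|^2 \<le> 2(1-|x|) \<le> 2|x-y|.\<close>
  have Flip: "\<bar>F b x - F b y\<bar> \<le> (2 * M0 + M1) * norm (x - y)" if b: "b \<in> Basis" for b x y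
  proof -
    have Eb: "\<bar>E z \<bullet> b\<bar> \<le> M0" if "norm z \<le> 1" for z
      using M0[of z] Basis_le_norm[OF b, of "E z"] that by simp
    have in_out: "\<bar>F b x - F b y\<bar> \<le> 2 * M0 * norm (x - y)" if "norm x \<le> 1" "norm y \<ge> 1" for x y
    proof -
      have n: "x \<bullet> x = (norm x)\<^sup>2" by (simp add: dot_square_norm)
      have "0 \<le> 1 - x \<bullet> x" unfolding n using that by (simp add: power_le_one)
      moreover have "1 - x \<bullet> x \<le> 2 * norm (x - y)"
      proof -
        have "1 - (norm x)\<^sup>2 = (1 - norm x) * (1 + norm x)" by (simp add: power2_eq_square algebra_simps)
        also have "\<dots> \<le> (1 - norm x) * 2" using that by (intro mult_left_mono) auto
        also have "\<dots> \<le> 2 * norm (x - y)" using norm_triangle_ineq3[of x y] that by auto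
        finally show ?thesis unfolding n .
      qed
      ultimately have "\<bar>E x \<bullet> b\<bar> * \<bar>1 - x \<bullet> x\<bar> \<le> M0 * (2 * norm (x - y))"
        using Eb[OF that(1)] M0nn by (intro mult_mono) auto
      then show ?thesis using F0[OF that(2)] that(1) by (simp add: F_def abs_mult)
    qed
    have mm: "2 * M0 * norm (x - y) \<le> (2 * M0 + M1) * norm (x - y)" using M1nn by (intro mult_right_mono) auto
    consider "norm x \<le> 1 \<and> norm y \<le> 1" | "norm x \<le> 1 \<and> norm y \<ge> 1" | "norm x \<ge> 1 \<and> norm y \<le> 1"
      | "norm x \<ge> 1 \<and> norm y \<ge> 1" by linarith
    then show ?thesis
    proof cases
      case 1
      have "F b x - F b y = (E x \<bullet> b) * (y \<bullet> y - x \<bullet> x) + ((E x - E y) \<bullet> b) * (1 - y \<bullet> y)"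
        using 1 by (simp add: F_def inner_diff_left algebra_simps)
      also have "\<bar>\<dots>\<bar> \<le> M0 * (2 * norm (x - y)) + (M1 * norm (x - y)) * 1"
      proof (intro order.trans[OF abs_triangle_ineq] add_mono)
        show "\<bar>(E x \<bullet> b) * (y \<bullet> y - x \<bullet> x)\<bar> \<le> M0 * (2 * norm (x - y))"
          unfolding abs_mult using Eb 1 sq[of y x] M0nn by (intro mult_mono) (auto simp: norm_minus_commute)
        have "\<bar>(E x - E y) \<bullet> b\<bar> \<le> M1 * norm (x - y)"
          using Basis_le_norm[OF b, of "E x - E y"] Elip[of x y] 1 by simp
        moreover have "\<bar>1 - y \<bullet> y\<bar> \<le> 1" using 1 by (simp add: dot_square_norm power_le_one)
        ultimately show "\<bar>((E x - E y) \<bullet> b) * (1 - y \<bullet> y)\<bar> \<le> (M1 * norm (x - y)) * 1"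
          unfolding abs_mult using M1nn by (intro mult_mono) auto
      qed
      finally show ?thesis by (simp add: algebra_simps)
    next
      case 2 then show ?thesis using in_out[of x y] mm by linarith
    next
      case 3 then show ?thesis using in_out[of y x] mm by (simp add: norm_minus_commute abs_minus_commute)
    next
      case 4 then show ?thesis using F0[of x b] F0[of y b] M0nn M1nn by simp
    qed
  qed
  have Fcont: "continuous_on UNIV (F b)" if "b \<in> Basis" for b
    using Flip[OF that] M0nn M1nn
    by (intro lipschitz_on_continuous_on[of "2 * M0 + M1"] lipschitz_onI) (auto simp: dist_norm)
  have Fint: "integrable lborel (F b)" if "b \<in> Basis" for b
  proof -
    have "integrable lborel (\<lambda>z. indicator ?C z *\<^sub>R F b z)"
      by (rule borel_integrable_compact) (use Fcont[OF that] continuous_on_subset in auto)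
    moreover have "(\<lambda>z. indicator ?C z *\<^sub>R F b z) = F b"
      using F0 by (auto simp: fun_eq_iff indicator_def)
    ultimately show ?thesis by simp
  qed
  have fint1: "integrable lborel (\<lambda>z. indicator ?C z *\<^sub>R ((1 - z \<bullet> z) * (J z b \<bullet> b)))" for b
    by (rule borel_integrable_compact) (intro compact_cball continuous_intros cont)+
  have fint2: "integrable lborel (\<lambda>z. indicator ?C z *\<^sub>R (E z \<bullet> z))"
    by (rule borel_integrable_compact) (intro compact_cball continuous_intros Ec)+
  have fint: "integrable lborel (f b)" for b
    unfolding f_def by (rule borel_integrable_compact) (intro compact_cball continuous_intros cont Ec)+
  have deriv: "AE z in lborel. ((\<lambda>t. F b (z + t *\<^sub>R b)) has_real_derivative f b z) (at 0)" if b: "b \<in> Basis" for b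
  proof -
    \<comment> \<open>On the sphere the extended function may have a kink; the sphere is a null
      set.\<close>
    have "AE z in lborel. z \<notin> sphere (0::'a) 1"
      using negligible_sphere[of "0::'a" 1] by (auto simp: negligible_iff_null_sets AE_not_in AE_completion_iff dest: AE_not_in)
    then show ?thesis
    proof eventually_elim
      case (elim z)
      let ?p = "\<lambda>t. z + t *\<^sub>R b"
      have tz: "((\<lambda>t. z + t *\<^sub>R b) \<longlongrightarrow> z) (at 0)" by (rule tendsto_eq_intros refl | simp)+
      have nh: "((\<lambda>t. norm (?p t)) \<longlongrightarrow> norm z) (nhds 0)"
        using tendsto_norm[OF tz] tendsto_at_iff_tendsto_nhds[of "\<lambda>t. norm (?p t)" 0] by simp
      show ?case
      proof (cases "norm z < 1")
        case True
        have "((\<lambda>t. (E (?p t) \<bullet> b) * (1 - (?p t) \<bullet> (?p t))) has_derivative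
          (\<lambda>t. (E (z + 0 *\<^sub>R b) \<bullet> b) * (0 - ((z + 0 *\<^sub>R b) \<bullet> (t *\<^sub>R b) + (t *\<^sub>R b) \<bullet> (z + 0 *\<^sub>R b)))
            + (J (z + 0 *\<^sub>R b) (t *\<^sub>R b) \<bullet> b) * (1 - (z + 0 *\<^sub>R b) \<bullet> (z + 0 *\<^sub>R b)))) (at 0)"
          by (rule derivative_eq_intros has_derivative_compose[of "\<lambda>t. z + t *\<^sub>R b" _ _ UNIV E] der | use True in \<open>force\<close>)+
        moreover have "linear (J z)" using der[of z] True has_derivative_linear by force
        ultimately have "((\<lambda>t. (E (?p t) \<bullet> b) * (1 - (?p t) \<bullet> (?p t))) has_real_derivative f b z) (at 0)"
          using True unfolding has_field_derivative_def
          by (elim has_derivative_eq_rhs) (simp add: fun_eq_iff f_def linear_scale inner_commute algebra_simps)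
        moreover have "\<forall>\<^sub>F t in nhds 0. norm (?p t) \<le> 1"
          using order_tendstoD(2)[OF nh True] by (rule eventually_mono) simp
        then have "\<forall>\<^sub>F t in nhds 0. F b (?p t) = (E (?p t) \<bullet> b) * (1 - (?p t) \<bullet> (?p t))"
          by eventually_elim (simp add: F_def)
        ultimately show ?thesis using DERIV_cong_ev[OF refl _ refl] by fast
      next
        case False
        then have gt: "norm z > 1" using elim by auto
        from order_tendstoD(1)[OF nh gt] have ev: "\<forall>\<^sub>F t in nhds 0. F b (?p t) = 0"
          by eventually_elim (simp add: F_def)
        then have "((\<lambda>t. F b (?p t)) has_real_derivative 0) (at 0)"
          using DERIV_cong_ev[OF refl ev refl, of "0::real"] by simp
        then show ?thesis using gt by (simp add: f_def)
      qed
    qed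
  qed
  have z: "(\<integral>z. f b z \<partial>lborel) = 0" if "b \<in> Basis" for b
    by (rule integral_directional_derivative_eq_0[OF Fint[OF that] Flip[OF that] F0 deriv[OF that]])
       (use fint[of b] in auto)
  have "0 = (\<integral>z. (\<Sum>b\<in>Basis. f b z) \<partial>lborel)"
    using z fint by (subst Bochner_Integration.integral_sum) auto
  also have "(\<lambda>z. \<Sum>b\<in>Basis. f b z) = (\<lambda>z. (\<Sum>b\<in>Basis. indicator ?C z *\<^sub>R ((1 - z \<bullet> z) * (J z b \<bullet> b))) - 2 * (indicator ?C z *\<^sub>R (E z \<bullet> z)))"
  proof
    fix z
    show "(\<Sum>b\<in>Basis. f b z) = (\<Sum>b\<in>Basis. indicator ?C z *\<^sub>R ((1 - z \<bullet> z) * (J z b \<bullet> b))) - 2 * (indicator ?C z *\<^sub>R (E z \<bullet> z))"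
      unfolding f_def euclidean_inner[of "E z" z]
      by (cases "z \<in> ?C") (simp_all add: sum_subtractf sum_distrib_left mult_ac)
  qed
  also have "(\<integral>z. \<dots> z \<partial>lborel) = (\<integral>z. (\<Sum>b\<in>Basis. indicator ?C z *\<^sub>R ((1 - z \<bullet> z) * (J z b \<bullet> b))) \<partial>lborel) - 2 * (\<integral>z. indicator ?C z *\<^sub>R (E z \<bullet> z) \<partial>lborel)"
    by (subst Bochner_Integration.integral_diff[OF Bochner_Integration.integrable_sum integrable_mult_right[OF fint2]])
       (rule fint1, simp only: integral_mult_right_zero)
  finally show ?thesis by (simp add: sum_distrib_left)
qed

text \<open>The integral of h(x+s z) over the unit ball has derivative equal to the integral of
  D(x+s z) . z, and \<open>ball_divergence\<close> rewrites this as s/2 times the integral of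
  (1-|z|^2) times the Laplacian of h at x+s z, which is nonpositive. So it does not exceed its value
  at s = 0. Solid balls instead of spheres avoid surface measure.\<close>

lemma mean_value_inequality_C2:
  fixes h :: "'a::euclidean_space \<Rightarrow> real" and D :: "'a \<Rightarrow> 'a" and H :: "'a \<Rightarrow> 'a \<Rightarrow> 'a"
  assumes S: "open S"
    and hD: "\<And>x. x \<in> S \<Longrightarrow> (h has_derivative (\<lambda>v. D x \<bullet> v)) (at x)"
    and DH: "\<And>x. x \<in> S \<Longrightarrow> (D has_derivative H x) (at x)"
    and Hc: "\<And>v. continuous_on S (\<lambda>x. H x v)"
    and tr: "\<And>x. x \<in> S \<Longrightarrow> (\<Sum>b\<in>Basis. H x b \<bullet> b) \<le> 0"
    and r: "0 < r" "cball x r \<subseteq> S"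
  shows "(\<integral>y. indicator (cball x r) y *\<^sub>R h y \<partial>lborel) \<le> measure lborel (cball x r) * h x"
proof -
  let ?C = "cball 0 1 :: 'a set"
  let ?a = "\<lambda>s z. x + s *\<^sub>R z" and ?B = "indicator (cball x r) :: 'a \<Rightarrow> real" and ?I = "indicator ?C :: 'a \<Rightarrow> real"
  \<comment> \<open>A slightly larger ball inside \<open>S\<close>, so that the two-sided derivative
    exists at the endpoint s = r too.\<close>
  obtain R where R: "r < R" "cball x R \<subseteq> S"
  proof -
    obtain e where e: "e > 0" "(\<Union>y\<in>cball x r. ball y e) \<subseteq> S"
      using compact_subset_open_imp_ball_epsilon_subset[OF compact_cball S r(2)] by blast
    have "cball x (r + e/2) \<subseteq> S"
    proof
      fix z assume z: "z \<in> cball x (r + e/2)"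
      show "z \<in> S"
      proof (cases "dist x z \<le> r")
        case True then show ?thesis using r(2) by auto
      next
        case False
        define y where "y = x + (r / dist x z) *\<^sub>R (z - x)"
        have d: "dist x z > 0" using False r by linarith
        have "dist x y = r" unfolding y_def using d r by (simp add: dist_norm norm_minus_commute)
        moreover have "z - y = (1 - r / dist x z) *\<^sub>R (z - x)" unfolding y_def by (simp add: algebra_simps)
        then have "dist y z = \<bar>1 - r / dist x z\<bar> * dist x z"
          by (metis dist_commute dist_norm norm_scaleR)
        moreover have "r / dist x z < 1" using d False by simp
        ultimately have "dist y z = dist x z - r" using d by (simp add: left_diff_distrib)
        moreover have "dist x y = r" by fact
        ultimately show ?thesis using e z by force
      qed
    qed
    with that[of "r + e/2"] e(1) show ?thesis by simp
  qed
  have Dc: "continuous_on S D" using DH by (meson continuous_at_imp_continuous_on has_derivative_continuous)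
  have hc: "continuous_on S h" using hD by (meson continuous_at_imp_continuous_on has_derivative_continuous)
  obtain L where L: "\<And>y. y \<in> cball x R \<Longrightarrow> norm (D y) \<le> L"
    using compact_imp_bounded[OF compact_continuous_image[OF continuous_on_subset[OF Dc R(2)] compact_cball]]
    unfolding bounded_iff by blast
  have hlip: "norm (h y - h z) \<le> L * norm (y - z)" if "y \<in> cball x R" "z \<in> cball x R" for y z
  proof (rule differentiable_bound[OF convex_cball[of x R], of h "\<lambda>y v. D y \<bullet> v"])
    show "(h has_derivative (\<bullet>) (D y)) (at y within cball x R)" if "y \<in> cball x R" for y
      by (rule has_derivative_at_withinI[OF hD]) (use R(2) that in auto)
    show "onorm ((\<bullet>) (D y)) \<le> L" if "y \<in> cball x R" for y
      using L[OF that] by (intro onorm_le order.trans[OF Cauchy_Schwarz_ineq2[folded real_norm_def]] mult_right_mono) auto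
  qed (use that in auto)
  have inR: "x + s *\<^sub>R z \<in> cball x R" if "\<bar>s\<bar> \<le> R" "z \<in> ?C" for s z
    using mult_mono[of "\<bar>s\<bar>" R "norm z" 1] that by (simp add: dist_norm)
  define \<phi> where "\<phi> s = (\<integral>z. ?I z *\<^sub>R h (?a s z) \<partial>lborel)" for s
  define \<phi>' where "\<phi>' s = (\<integral>z. ?I z *\<^sub>R (D (?a s z) \<bullet> z) \<partial>lborel)" for s
  have cm: "continuous_on ?C (\<lambda>z. x + s *\<^sub>R z)" for s by (intro continuous_intros)
  have img: "(\<lambda>z. x + s *\<^sub>R z) ` ?C \<subseteq> S" if "\<bar>s\<bar> \<le> R" for s using inR[OF that] R(2) by blast
  have int1: "integrable lborel (\<lambda>z. ?I z *\<^sub>R h (?a s z))" if "\<bar>s\<bar> \<le> R" for s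
    by (rule borel_integrable_compact[OF compact_cball continuous_on_compose2[OF hc cm img[OF that]]])
  have cD: "continuous_on ?C (\<lambda>z. D (?a s z))" if "\<bar>s\<bar> \<le> R" for s
    by (rule continuous_on_compose2[OF Dc cm img[OF that]])
  have int2: "integrable lborel (\<lambda>z. ?I z *\<^sub>R (D (?a s z) \<bullet> z))" if "\<bar>s\<bar> \<le> R" for s
    by (rule borel_integrable_compact[OF compact_cball]) (intro continuous_intros cD[OF that])
  have der: "(\<phi> has_real_derivative \<phi>' s) (at s)" if s: "\<bar>s\<bar> < R" for s
    unfolding DERIV_def
  proof (subst tendsto_at_iff_sequentially, intro allI impI)
    fix X :: "nat \<Rightarrow> real" assume X: "\<forall>i. X i \<in> UNIV - {0}" and X0: "X \<longlonglongrightarrow> 0"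
    obtain N where N: "\<And>k. k \<ge> N \<Longrightarrow> \<bar>X k\<bar> < R - \<bar>s\<bar>"
      using X0 s unfolding LIMSEQ_iff by (metis diff_gt_0_iff_gt diff_zero real_norm_def)
    \<comment> \<open>Dropping the first N terms keeps |s + Y k| \<le> R, where the Lipschitz bound
      for \<open>h\<close> is available.\<close>
    define Y where "Y k = X (k + N)" for k
    have Y: "Y k \<noteq> 0" for k using X unfolding Y_def by auto
    have YR: "\<bar>s + Y k\<bar> \<le> R" for k
      using N[of "k+N"] abs_triangle_ineq[of s "X (k + N)"] unfolding Y_def by simp
    have Y0: "Y \<longlonglongrightarrow> 0" unfolding Y_def using X0 by (rule LIMSEQ_ignore_initial_segment)
    define q where "q k z = (?I z *\<^sub>R h (?a (s + Y k) z) - ?I z *\<^sub>R h (?a s z)) / Y k" for k z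
    have sR: "\<bar>s\<bar> \<le> R" using s by simp
    have qm: "integrable lborel (q k)" for k
      unfolding q_def using int1[OF YR] int1[OF sR] by (intro integrable_divide_zero Bochner_Integration.integrable_diff) auto
    have lim: "(\<lambda>k. q k z) \<longlonglongrightarrow> ?I z *\<^sub>R (D (?a s z) \<bullet> z)" for z
    proof (cases "z \<in> ?C")
      case True
      have "x + s *\<^sub>R z \<in> S" using inR[OF sR True] R(2) by auto
      then have "((\<lambda>t. h (?a (s + t) z)) has_derivative (\<lambda>t. D (x + (s + 0) *\<^sub>R z) \<bullet> ((0 + t) *\<^sub>R z))) (at 0)"
        by (intro has_derivative_compose[of "\<lambda>t. x + (s + t) *\<^sub>R z" _ _ UNIV h] derivative_eq_intros hD) auto
      then have "((\<lambda>t. h (?a (s + t) z)) has_real_derivative (D (?a s z) \<bullet> z)) (at 0)"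
        unfolding has_field_derivative_def by (elim has_derivative_eq_rhs) (auto simp: fun_eq_iff)
      then have "((\<lambda>t. (h (?a (s + t) z) - h (?a s z)) / t) \<longlongrightarrow> D (?a s z) \<bullet> z) (at 0)"
        unfolding has_field_derivative_iff by simp
      moreover have "filterlim Y (at 0) sequentially" unfolding filterlim_at using Y0 Y by auto
      ultimately have "(\<lambda>k. (h (?a (s + Y k) z) - h (?a s z)) / Y k) \<longlonglongrightarrow> D (?a s z) \<bullet> z"
        by (rule filterlim_compose)
      then show ?thesis using True by (simp add: q_def)
    qed (simp add: q_def)
    have bnd: "norm (q k z) \<le> ?I z *\<^sub>R L" for k z
    proof (cases "z \<in> ?C")
      case True
      have "norm (h (?a (s + Y k) z) - h (?a s z)) \<le> L * norm ((?a (s + Y k) z) - (?a s z))"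
        by (rule hlip[OF inR[OF YR True] inR[OF sR True]])
      also have "(?a (s + Y k) z) - (?a s z) = Y k *\<^sub>R z" by (simp add: algebra_simps)
      also have "L * norm (Y k *\<^sub>R z) \<le> L * \<bar>Y k\<bar>"
        using True order.trans[OF norm_ge_zero L[of x]] R r by (intro mult_left_mono) (auto simp: mult_left_le)
      finally show ?thesis using True Y[of k] by (simp add: q_def field_simps)
    qed (simp add: q_def)
    have "(\<lambda>k. \<integral>z. q k z \<partial>lborel) \<longlonglongrightarrow> \<phi>' s" unfolding \<phi>'_def
    proof (rule integral_dominated_convergence[where w="\<lambda>z. ?I z *\<^sub>R L"])
      show "integrable lborel (\<lambda>z. ?I z *\<^sub>R L)" by (rule borel_integrable_compact) auto
      show "(\<lambda>z. ?I z *\<^sub>R (D (?a s z) \<bullet> z)) \<in> borel_measurable lborel" using int2[OF sR] by auto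
    qed (use lim bnd qm in auto)
    moreover have "(\<integral>z. q k z \<partial>lborel) = (\<phi> (s + Y k) - \<phi> s) / Y k" for k
      unfolding q_def \<phi>_def using int1[OF YR] int1[OF sR] by simp
    ultimately have "(\<lambda>k. (\<phi> (s + X (k + N)) - \<phi> s) / X (k + N)) \<longlonglongrightarrow> \<phi>' s" by (simp add: Y_def)
    then show "((\<lambda>y. (\<phi> (s + y) - \<phi> s) / y) \<circ> X) \<longlonglongrightarrow> \<phi>' s"
      unfolding comp_def using LIMSEQ_offset[of "\<lambda>k. (\<phi> (s + X k) - \<phi> s) / X k" N] by simp
  qed
  have neg: "\<phi>' s \<le> 0" if s: "0 \<le> s" "s \<le> R" for s
  proof -
    have "2 * (\<integral>z. ?I z * (D (?a s z) \<bullet> z) \<partial>lborel) =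
      (\<integral>z. ?I z * ((1 - z \<bullet> z) * (\<Sum>b\<in>Basis. (s *\<^sub>R H (?a s z) b) \<bullet> b)) \<partial>lborel)"
    proof (rule ball_divergence)
      fix z :: 'a assume z: "z \<in> ?C"
      then have zS: "x + s *\<^sub>R z \<in> S" using inR[OF _ z, of s] R(2) s by auto
      have "((\<lambda>z. D (?a s z)) has_derivative (\<lambda>v. H (?a s z) (s *\<^sub>R v))) (at z)"
        by (rule has_derivative_compose[of "\<lambda>z. x + s *\<^sub>R z" _ _ UNIV D]) (auto intro!: derivative_eq_intros DH zS)
      moreover have "linear (H (?a s z))" using DH[OF zS] has_derivative_linear by blast
      ultimately show "((\<lambda>z. D (?a s z)) has_derivative (\<lambda>b. s *\<^sub>R H (?a s z) b)) (at z)"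
        by (simp add: linear_scale)
    next
      fix v
      show "continuous_on ?C (\<lambda>z. s *\<^sub>R H (?a s z) v)"
        using s by (intro continuous_intros continuous_on_compose2[OF Hc cm img]) auto
    qed
    also have "\<dots> \<le> 0"
    proof (rule neg_0_le_iff_le[THEN iffD1], subst integral_minus[symmetric], rule Bochner_Integration.integral_nonneg)
      fix z :: 'a
      show "0 \<le> - (?I z * ((1 - z \<bullet> z) * (\<Sum>b\<in>Basis. (s *\<^sub>R H (?a s z) b) \<bullet> b)))"
      proof (cases "z \<in> ?C")
        case True
        then have "x + s *\<^sub>R z \<in> S" using inR[OF _ True, of s] R(2) s by auto
        from tr[OF this] have "(\<Sum>b\<in>Basis. (s *\<^sub>R H (?a s z) b) \<bullet> b) \<le> 0"
          using s by (simp add: sum_distrib_left[symmetric] mult_nonneg_nonpos)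
        moreover have "z \<bullet> z \<le> 1" using True by (simp add: dot_square_norm power_le_one)
        ultimately show ?thesis using True by (simp add: mult_nonneg_nonpos)
      qed simp
    qed
    finally show ?thesis unfolding \<phi>'_def by simp
  qed
  have "\<phi> r \<le> \<phi> 0"
  proof (rule DERIV_nonpos_imp_nonincreasing[of 0 r \<phi>])
    show "0 \<le> r" using r by simp
    fix s assume "0 \<le> s" "s \<le> r"
    then show "\<exists>y. (\<phi> has_real_derivative y) (at s) \<and> y \<le> 0"
      using der[of s] neg[of s] R by (intro exI[of _ "\<phi>' s"]) auto
  qed
  have scale: "(\<integral>y. ?B y *\<^sub>R k y \<partial>lborel) = r ^ DIM('a) * (\<integral>z. ?I z *\<^sub>R k (x + r *\<^sub>R z) \<partial>lborel)"
    if k: "(\<lambda>y. indicator (cball x r) y *\<^sub>R k y) \<in> borel_measurable borel" for k :: "'a \<Rightarrow> real"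
  proof -
    have "(\<integral>y. ?B y *\<^sub>R k y \<partial>lborel) =
       (\<integral>y. ?B y *\<^sub>R k y \<partial>(density (distr lborel borel (\<lambda>y. x + r *\<^sub>R y)) (\<lambda>_. \<bar>r\<bar>^DIM('a))))"
      using lborel_affine[of r x] r by simp
    also have "\<dots> = (\<integral>y. (r^DIM('a)) *\<^sub>R (indicator (cball x r) y *\<^sub>R k y) \<partial>(distr lborel borel (\<lambda>y. x + r *\<^sub>R y)))"
      using r k by (subst integral_density) (auto simp: ennreal_power)
    also have "\<dots> = (\<integral>z. (r^DIM('a)) *\<^sub>R (?B (x + r *\<^sub>R z) *\<^sub>R k (x + r *\<^sub>R z)) \<partial>lborel)"
      using k by (subst integral_distr) auto
    also have "(\<lambda>z. ?B (x + r *\<^sub>R z) :: real) = indicator ?C"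
      using r by (auto simp: fun_eq_iff indicator_def dist_norm)
    finally show ?thesis by simp
  qed
  have mm: "(\<lambda>y. indicator (cball x r) y *\<^sub>R h x) \<in> borel_measurable borel"
    by (rule borel_measurable_continuous_on_indicator) auto
  have "(\<integral>y. ?B y *\<^sub>R h y \<partial>lborel) = r ^ DIM('a) * \<phi> r"
    unfolding \<phi>_def by (rule scale[OF borel_measurable_continuous_on_indicator])
      (use hc r(2) continuous_on_subset in auto)
  also have "\<dots> \<le> r ^ DIM('a) * \<phi> 0" using \<open>\<phi> r \<le> \<phi> 0\<close> r by (intro mult_left_mono) auto
  \<comment> \<open>At s = 0 the integrand is the constant h x, so this is \<open>scale\<close>
    applied to a constant function.\<close>
  also have "r ^ DIM('a) * \<phi> 0 = (\<integral>y. ?B y *\<^sub>R h x \<partial>lborel)"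
    unfolding \<phi>_def using scale[OF mm] by (simp only: scale_zero_left add_0_right)
  also have "\<dots> = measure lborel (cball x r) * h x" by simp
  finally show ?thesis .
qed

section \<open>The Newtonian kernel\<close>

definition newton_const :: "'a::euclidean_space itself \<Rightarrow> real" where
  "newton_const _ = (real DIM('a) - 2) * (real DIM('a) * unit_ball_vol (real DIM('a)))"

definition newton :: "'a::euclidean_space \<Rightarrow> ennreal" where
  "newton z = e2ennreal (fundamental_solution z)"

lemma newton_const_pos: "3 \<le> DIM('a::euclidean_space) \<Longrightarrow> 0 < newton_const TYPE('a)"
  unfolding newton_const_def by (intro mult_pos_pos) auto

lemma newton_0 [simp]: "newton 0 = top"
  by (simp add: newton_def fundamental_solution_def)

lemma newton_eq:
  fixes z :: "'a::euclidean_space"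
  shows "z \<noteq> 0 \<Longrightarrow> newton z = ennreal (norm z powr (2 - real DIM('a)) / newton_const TYPE('a))"
  by (simp add: newton_def fundamental_solution_def newton_const_def)

lemma newton_minus: "newton (- z) = newton z"
  by (simp add: newton_def fundamental_solution_def)

text \<open>The inverse of the radial profile of the kernel: \<open>newton_gt_iff\<close> identifies
  the superlevel set at \<open>s\<close> with the ball of this radius.\<close>

definition newton_radius :: "'a::euclidean_space itself \<Rightarrow> real \<Rightarrow> real" where
  "newton_radius _ s = (s * newton_const TYPE('a)) powr (- 1 / (real DIM('a) - 2))"

lemma newton_gt_iff:
  fixes z :: "'a::euclidean_space"
  assumes n: "3 \<le> DIM('a)" and s: "0 < s"
  shows "ennreal s < newton z \<longleftrightarrow> norm z < newton_radius TYPE('a) s"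
proof (cases "z = 0")
  case True
  then show ?thesis using s newton_const_pos[OF n] by (simp add: newton_radius_def)
next
  case False
  define c where "c = newton_const TYPE('a)"
  define p where "p = real DIM('a) - 2"
  have c: "0 < c" unfolding c_def by (rule newton_const_pos[OF n])
  have p: "0 < p" using n by (simp add: p_def)
  have z: "0 < norm z" using False by simp
  have "ennreal s < newton z \<longleftrightarrow> s * c < norm z powr - p"
    using newton_eq[OF False] s c unfolding c_def[symmetric] p_def by (simp add: ennreal_less_iff field_simps)
  also have "\<dots> \<longleftrightarrow> (norm z powr - p) powr (- 1 / p) < (s * c) powr (- 1 / p)"
    using s c z p by (metis divide_neg_pos mult_pos_pos neg_less_0_iff_less powr_gt_zero powr_less_mono2_neg zero_less_one linorder_neqE_linordered_idom order_less_asym less_irrefl)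
  also have "(norm z powr - p) powr (- 1 / p) = norm z" using z p by (simp add: powr_powr)
  finally show ?thesis unfolding newton_radius_def c_def p_def .
qed

lemma borel_measurable_newton [measurable]: "newton \<in> borel_measurable borel"
proof -
  have "newton = (\<lambda>z::'a. if z = 0 then top else ennreal (norm z powr (2 - real DIM('a)) / newton_const TYPE('a)))"
    by (auto simp: fun_eq_iff newton_eq)
  moreover have "\<dots> \<in> borel_measurable borel" by measurable
  ultimately show ?thesis by simp
qed

text \<open>In the layer-cake formula the part of E on which the kernel exceeds s has measure at
  most |E| and at most v s^(-b), with b = n/(n-2) > 1. The first bound is integrated over small s,
  the second over large s, and the outcome is a multiple of |E|^(1-1/b) = |E|^(2/n).\<close>

lemma newton_integral_bound:
  assumes n: "3 \<le> DIM('a::euclidean_space)"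
  obtains C where "0 < C" "\<And>(x::'a) E. E \<in> sets borel \<Longrightarrow>
    (\<integral>\<^sup>+y. newton (x - y) * indicator E y \<partial>lborel) \<le> ennreal C * epowr (emeasure lborel E) (2 / real DIM('a))"
proof -
  define d where "d = real DIM('a)"
  define b where "b = d / (d - 2)"
  define v where "v = unit_ball_vol d * newton_const TYPE('a) powr (- b)"
  have d: "3 \<le> d" using n by (simp add: d_def)
  have b: "1 < b" using d by (simp add: b_def)
  have cpos: "0 < newton_const TYPE('a)" by (rule newton_const_pos[OF n])
  have v: "0 < v" using cpos d by (simp add: v_def)
  have b2: "1 - 1 / b = 2 / d" using d by (simp add: b_def field_simps)
  have vol: "emeasure lborel (ball x (newton_radius TYPE('a) s)) = ennreal (v * s powr (- b))" if s: "0 < s" for s and x :: 'a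
  proof -
    have "newton_radius TYPE('a) s ^ DIM('a) = (s * newton_const TYPE('a)) powr (- b)"
      using s cpos d by (simp add: newton_radius_def b_def d_def powr_powr flip: powr_realpow)
    moreover have "0 \<le> newton_radius TYPE('a) s" by (simp add: newton_radius_def)
    ultimately show ?thesis using s cpos by (simp add: emeasure_ball v_def d_def powr_mult mult_ac)
  qed
  show ?thesis
  proof (rule that[of "1 + v / (b - 1)"])
    show "0 < 1 + v / (b - 1)" using v b by (simp add: add_pos_pos)
    fix x :: 'a and E :: "'a set" assume E[measurable]: "E \<in> sets borel"
    show "(\<integral>\<^sup>+y. newton (x - y) * indicator E y \<partial>lborel) \<le> ennreal (1 + v / (b - 1)) * epowr (emeasure lborel E) (2 / real DIM('a))"
    proof (cases "emeasure lborel E")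
      case top
      then show ?thesis using v b by (simp add: ennreal_mult_top add_pos_pos infinity_ennreal_def)
    next
      case (real e)
      show ?thesis
      proof (cases "e = 0")
        case True
        then have "AE y in lborel. y \<notin> E" using real by (intro AE_not_in) auto
        then have "AE y in lborel. newton (x - y) * indicator E y = 0" by eventually_elim simp
        then have "(\<integral>\<^sup>+y. newton (x - y) * indicator E y \<partial>lborel) = 0" by (subst nn_integral_0_iff_AE) auto
        then show ?thesis by simp
      next
        case False
        then have e: "0 < e" using real by simp
        let ?B = "\<lambda>s. ball x (newton_radius TYPE('a) s)"
          and ?L = "\<lambda>s. \<integral>\<^sup>+y. indicator {s. 0 < s \<and> ennreal s < newton (x - y)} s * indicator E y \<partial>lborel"
        \<comment> \<open>Where the two bounds agree up to the constant \<open>v\<close>, namely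
          s0^(-b) = e.\<close>
        define s0 where "s0 = e powr (- 1 / b)"
        have s0: "0 < s0" using e by (simp add: s0_def)
        have "(\<integral>\<^sup>+y. newton (x - y) * indicator E y \<partial>lborel)
          = (\<integral>\<^sup>+y. (\<integral>\<^sup>+s. indicator {s. 0 < s \<and> ennreal s < newton (x - y)} s \<partial>lborel) * indicator E y \<partial>lborel)"
          by (simp only: nn_integral_layer_cake)
        also have "\<dots> = (\<integral>\<^sup>+y. (\<integral>\<^sup>+s. indicator {s. 0 < s \<and> ennreal s < newton (x - y)} s * indicator E y \<partial>lborel) \<partial>lborel)"
          by (intro nn_integral_cong nn_integral_multc[symmetric]) measurable
        also have "\<dots> = (\<integral>\<^sup>+s. ?L s \<partial>lborel)"
          by (rule lborel_pair.Fubini'[symmetric]) measurable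
        also have "\<dots> \<le> (\<integral>\<^sup>+s. ennreal e * indicator {0..s0} s + ennreal v * (ennreal (s powr (- b)) * indicator {s0..} s) \<partial>lborel)"
        proof (rule nn_integral_mono)
          fix s :: real
          show "?L s
            \<le> ennreal e * indicator {0..s0} s + ennreal v * (ennreal (s powr (- b)) * indicator {s0..} s)"
          proof (cases "0 < s")
            case s: True
            have "?L s
              = (\<integral>\<^sup>+y. indicator (?B s \<inter> E) y \<partial>lborel)"
              using s by (intro nn_integral_cong) (auto simp: indicator_def newton_gt_iff[OF n s] dist_norm)
            also have "\<dots> = emeasure lborel (?B s \<inter> E)" by (rule nn_integral_indicator) auto
            finally have eq: "?L s = emeasure lborel (?B s \<inter> E)" .
            have 1: "emeasure lborel (?B s \<inter> E) \<le> ennreal e"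
              unfolding real(2)[symmetric] by (intro emeasure_mono) auto
            have "emeasure lborel (?B s \<inter> E) \<le> emeasure lborel (?B s)"
              by (intro emeasure_mono) auto
            then have 2: "emeasure lborel (?B s \<inter> E) \<le> ennreal v * ennreal (s powr (- b))"
              using vol[OF s] v by (simp add: ennreal_mult)
            show ?thesis
            proof (cases "s \<le> s0")
              case True
              then show ?thesis unfolding eq using 1 s by (simp add: add_increasing2)
            next
              case False
              then show ?thesis unfolding eq using 2 s by simp
            qed
          qed simp
        qed
        also have "\<dots> = ennreal e * ennreal s0 + ennreal v * ennreal (s0 powr (1 - b) / (b - 1))"
        proof -
          have hi: "((\<lambda>s. s powr (- b)) has_integral - (s0 powr (- b + 1)) / (- b + 1)) {s0..}"
            by (rule has_integral_powr_to_inf) (use b s0 in auto)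
          have "- (s0 powr (- b + 1)) / (- b + 1) = s0 powr (1 - b) / (b - 1)"
            using b by (simp add: field_simps)
          then have i2: "(\<integral>\<^sup>+s. ennreal (s powr (- b)) * indicator {s0..} s \<partial>lborel) = ennreal (s0 powr (1 - b) / (b - 1))"
            using nn_integral_set_has_integral[OF hi] by simp
          have i1: "(\<integral>\<^sup>+s. ennreal e * indicator {0..s0} s \<partial>lborel) = ennreal e * ennreal s0"
            using s0 by (simp add: nn_integral_cmult_indicator)
          show ?thesis unfolding i1[symmetric] i2[symmetric]
            by (subst nn_integral_add; (simp add: nn_integral_cmult)?)
        qed
        also have "\<dots> = ennreal ((1 + v / (b - 1)) * e powr (2 / d))"
        proof -
          have "e * s0 = e powr (2 / d)" unfolding b2[symmetric] s0_def using e by (simp add: powr_mult_base)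
          moreover have "s0 powr (1 - b) = e powr (2 / d)"
          proof -
            have "- 1 / b * (1 - b) = 1 - 1 / b" using b by (simp add: field_simps)
            then show ?thesis unfolding b2[symmetric] s0_def powr_powr by simp
          qed
          ultimately have "ennreal (e * s0) + ennreal (v * (s0 powr (1 - b) / (b - 1))) = ennreal (e powr (2 / d) + v * (e powr (2 / d) / (b - 1)))"
            using v b by (simp add: ennreal_plus)
          also have "e powr (2 / d) + v * (e powr (2 / d) / (b - 1)) = (1 + v / (b - 1)) * e powr (2 / d)"
            by (simp add: algebra_simps)
          finally show ?thesis using e s0 v b by (simp add: ennreal_mult[symmetric])
        qed
        finally show ?thesis using real e v b by (simp add: ennreal_mult d_def)
      qed
    qed
  qed
qed

text \<open>Adding e > 0 removes the pole and keeps the function superharmonic on the whole space: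
  with s = |z-y|^2 + e its Laplacian is (2-n) n e s^(p-2). Thus the inequality for twice
  differentiable functions applies also to balls that contain \<open>y\<close>.\<close>

lemma regularized_newton_mean_value:
  fixes x y :: "'a::euclidean_space"
  assumes n: "3 \<le> DIM('a)" and e: "0 < e" and r: "0 < r"
  defines "f \<equiv> \<lambda>z::'a. ((z - y) \<bullet> (z - y) + e) powr ((2 - real DIM('a)) / 2)"
  shows "(\<integral>z. indicator (cball x r) z *\<^sub>R f z \<partial>lborel) \<le> measure lborel (cball x r) * f x"
proof -
  define p where "p = (2 - real DIM('a)) / 2"
  define s where "s z = (z - y) \<bullet> (z - y) + e" for z
  define D where "D z = (2 * p * s z powr (p - 1)) *\<^sub>R (z - y)" for z
  define H where "H z v = (2 * p * s z powr (p - 1)) *\<^sub>R v + (4 * p * (p - 1) * s z powr (p - 2) * ((z - y) \<bullet> v)) *\<^sub>R (z - y)" for z v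
  have s0: "0 < s z" for z unfolding s_def using e by (simp add: add_nonneg_pos)
  have sd: "(s has_derivative (\<lambda>v. 2 * ((z - y) \<bullet> v))) (at z)" for z
    unfolding s_def by (auto intro!: derivative_eq_intros simp: inner_commute)
  have pd: "((\<lambda>z. s z powr a) has_derivative (\<lambda>v. (2 * a * s z powr (a - 1)) * ((z - y) \<bullet> v))) (at z)" for z a
  proof -
    have "((\<lambda>t. t powr a) has_real_derivative a * s z powr (a - 1)) (at (s z))"
      by (rule has_real_derivative_powr[OF s0])
    then have "((\<lambda>t. t powr a) has_derivative (*) (a * s z powr (a - 1))) (at (s z))"
      unfolding has_field_derivative_def .
    from has_derivative_compose[OF sd this] show ?thesis by (simp add: mult_ac)
  qed
  have fs: "f = (\<lambda>z. s z powr p)" unfolding f_def s_def p_def ..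
  show ?thesis
  proof (rule mean_value_inequality_C2[of UNIV f D H])
    fix z
    show "(f has_derivative (\<bullet>) (D z)) (at z)"
      unfolding fs D_def by (rule has_derivative_eq_rhs[OF pd]) (simp add: fun_eq_iff mult_ac)
    have "((\<lambda>z. (2 * p * s z powr (p - 1)) *\<^sub>R (z - y)) has_derivative
       (\<lambda>v. (2 * p * s z powr (p - 1)) *\<^sub>R v + (2 * p * ((2 * (p - 1) * s z powr (p - 1 - 1)) * ((z - y) \<bullet> v))) *\<^sub>R (z - y))) (at z)"
      by (rule derivative_eq_intros pd | simp)+
    then show "(D has_derivative H z) (at z)" unfolding D_def[abs_def]
      by (rule has_derivative_eq_rhs) (simp add: H_def fun_eq_iff mult_ac)
    have "H z b \<bullet> b = 2 * p * s z powr (p - 1) + (4 * p * (p - 1) * s z powr (p - 2)) * (((z - y) \<bullet> b) * ((z - y) \<bullet> b))"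
      if "b \<in> Basis" for b
      using that unfolding H_def by (simp add: inner_add_left)
    then have "(\<Sum>b\<in>Basis. H z b \<bullet> b) = (2 * p * s z powr (p - 1)) * real DIM('a) + (4 * p * (p - 1) * s z powr (p - 2)) * ((z - y) \<bullet> (z - y))"
      unfolding euclidean_inner[of "z - y" "z - y"]
      by (simp add: sum.distrib sum_distrib_left)
    also have "s z powr (p - 1) = s z powr (p - 2) * s z"
      using powr_add[of "s z" "p - 2" 1] s0[of z] by simp
    also have "(2 * p * (s z powr (p - 2) * s z)) * real DIM('a) + (4 * p * (p - 1) * s z powr (p - 2)) * ((z - y) \<bullet> (z - y))
      = 2 * p * s z powr (p - 2) * (real DIM('a) * s z + 2 * (p - 1) * ((z - y) \<bullet> (z - y)))"
      by (simp add: algebra_simps)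
    \<comment> \<open>This identity is what the exponent (2-n)/2 is for: the terms in |z-y|^2 cancel
      and only n e survives.\<close>
    also have "2 * (p - 1) = - real DIM('a)" by (simp add: p_def field_simps)
    also have "real DIM('a) * s z + - real DIM('a) * ((z - y) \<bullet> (z - y)) = real DIM('a) * e"
      by (simp add: s_def algebra_simps)
    also have "2 * p * s z powr (p - 2) * (real DIM('a) * e) \<le> 0"
      using n e mult_nonpos_nonneg[of "2 * p" "s z powr (p - 2) * (real DIM('a) * e)"] by (simp add: p_def mult.assoc)
    finally show "(\<Sum>b\<in>Basis. H z b \<bullet> b) \<le> 0" .
  next
    fix v
    show "continuous_on UNIV (\<lambda>z. H z v)"
      unfolding H_def s_def using s0 unfolding s_def by (intro continuous_intros) (auto simp: less_imp_neq[THEN not_sym])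
  qed (use r in auto)
qed

text \<open>Limit of the regularised inequality as the regularisation tends to 0: Fatou handles the
  left side, and at the centre the regularised kernels stay below the Newtonian one, which is
  infinite if x = y.\<close>

lemma newton_mean_value:
  fixes x y :: "'a::euclidean_space"
  assumes n: "3 \<le> DIM('a)" and r: "0 < r"
  shows "(\<integral>\<^sup>+z. newton (z - y) * indicator (cball x r) z \<partial>lborel) \<le> emeasure lborel (cball x r) * newton (x - y)"
proof -
  let ?I = "indicator (cball x r)" and ?V = "emeasure lborel (cball x r)"
  define c where "c = newton_const TYPE('a)"
  have c: "0 < c" unfolding c_def by (rule newton_const_pos[OF n])
  define p where "p = (2 - real DIM('a)) / 2"
  define f where "f k z = ((z - y) \<bullet> (z - y) + 1 / real (Suc k)) powr p" for k and z :: 'a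
  have fm[measurable]: "f k \<in> borel_measurable borel" for k unfolding f_def by measurable
  have sq: "((z - y) \<bullet> (z - y)) powr p = norm (z - y) powr (2 - real DIM('a))" for z
  proof -
    have "(z - y) \<bullet> (z - y) = norm (z - y) powr 2" by (simp add: dot_square_norm)
    then have "((z - y) \<bullet> (z - y)) powr p = norm (z - y) powr (2 * p)" by (metis powr_powr)
    also have "2 * p = 2 - real DIM('a)" by (simp add: p_def)
    finally show ?thesis .
  qed
  have fc: "continuous_on UNIV (f k)" for k
    unfolding f_def by (intro continuous_intros ballI) (metis add_pos_nonneg add.commute inner_ge_zero less_irrefl of_nat_0_less_iff zero_less_Suc zero_less_divide_1_iff)
  have lim: "(\<lambda>k. f k z) \<longlonglongrightarrow> norm (z - y) powr (2 - real DIM('a))" if "z \<noteq> y" for z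
  proof -
    have t0: "(\<lambda>k. 1 / real (Suc k)) \<longlonglongrightarrow> 0"
      using LIMSEQ_inverse_real_of_nat by (simp add: inverse_eq_divide)
    have "(\<lambda>k. f k z) \<longlonglongrightarrow> ((z - y) \<bullet> (z - y) + 0) powr p"
      unfolding f_def using that by (intro tendsto_intros t0) auto
    then show ?thesis by (simp add: sq)
  qed
  have [measurable]: "cball x r \<in> sets borel" by simp
  \<comment> \<open>At the pole the \<open>powr\<close> formula for the limit gives 0 whereas
    \<open>newton\<close> is infinite, so this null point is set aside.\<close>
  have AEy: "AE z in lborel. z \<noteq> y" using AE_lborel_singleton[of y] .
  have fle: "ennreal (f k x / c) \<le> newton (x - y)" for k
  proof (cases "x = y")
    case False
    have "f k x \<le> ((x - y) \<bullet> (x - y)) powr p"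
      unfolding f_def using False n by (intro powr_mono2') (auto simp: p_def)
    then show ?thesis using False c unfolding sq by (subst newton_eq) (auto simp: c_def[symmetric] divide_right_mono intro!: ennreal_leI)
  qed simp
  have "(\<integral>\<^sup>+z. newton (z - y) * ?I z \<partial>lborel) = (\<integral>\<^sup>+z. liminf (\<lambda>k. ennreal (f k z / c) * ?I z) \<partial>lborel)"
  proof (rule nn_integral_cong_AE)
    show "AE z in lborel. newton (z - y) * ?I z = liminf (\<lambda>k. ennreal (f k z / c) * ?I z)"
      using AEy
    proof eventually_elim
      case (elim z)
      have "(\<lambda>k. ennreal (f k z / c)) \<longlonglongrightarrow> ennreal (norm (z - y) powr (2 - real DIM('a)) / c)"
        using c by (intro tendsto_ennrealI tendsto_divide lim elim tendsto_const) auto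
      then have "liminf (\<lambda>k. ennreal (f k z / c)) = newton (z - y)"
        using elim by (simp add: newton_eq lim_imp_Liminf c_def[symmetric])
      then show ?case by (cases "z \<in> cball x r") (simp_all add: Liminf_const)
    qed
  qed
  also have "\<dots> \<le> liminf (\<lambda>k. \<integral>\<^sup>+z. ennreal (f k z / c) * ?I z \<partial>lborel)"
    by (rule nn_integral_liminf) measurable
  also have "\<dots> \<le> ?V * newton (x - y)"
  proof (rule order.trans[OF Liminf_le_Limsup Limsup_bounded])
    show "\<forall>\<^sub>F k in sequentially. (\<integral>\<^sup>+z. ennreal (f k z / c) * ?I z \<partial>lborel) \<le> ?V * newton (x - y)"
    proof (rule always_eventually, rule allI)
      fix k
      have int: "integrable lborel (\<lambda>z. ?I z *\<^sub>R f k z)"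
        by (intro borel_integrable_compact continuous_on_subset[OF fc]) auto
      have "(\<integral>\<^sup>+z. ennreal (f k z / c) * ?I z \<partial>lborel) = (\<integral>\<^sup>+z. ennreal (?I z *\<^sub>R f k z / c) \<partial>lborel)"
        by (intro nn_integral_cong) (auto simp: indicator_def)
      also have "\<dots> = ennreal (\<integral>z. ?I z *\<^sub>R f k z / c \<partial>lborel)"
        using int c by (intro nn_integral_eq_integral integrable_divide_zero) (auto simp: f_def)
      also have "\<dots> \<le> ennreal (measure lborel (cball x r) * (f k x / c))"
        using regularized_newton_mean_value[OF n, of "1 / real (Suc k)" r x y] r c unfolding f_def p_def
        by (intro ennreal_leI) (simp add: divide_right_mono)
      also have "\<dots> = ?V * ennreal (f k x / c)"
      proof -
        have "?V = ennreal (measure lborel (cball x r))"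
          using emeasure_lborel_cball_finite[of x r] by (intro emeasure_eq_ennreal_measure) auto
        then show ?thesis using c by (simp only: ennreal_mult[symmetric] measure_nonneg) (subst ennreal_mult; simp add: f_def)
      qed
      also have "\<dots> \<le> ?V * newton (x - y)" by (intro mult_left_mono fle) auto
      finally show "(\<integral>\<^sup>+z. ennreal (f k z / c) * ?I z \<partial>lborel) \<le> ?V * newton (x - y)" .
    qed
  qed simp
  finally show ?thesis .
qed

section \<open>The Green kernel\<close>

lemma harmonic_on_imp_continuous_on: "harmonic_on S h \<Longrightarrow> continuous_on S h"
  unfolding harmonic_on_def by (meson continuous_at_imp_continuous_on has_derivative_continuous)

lemma harmonic_on_const [simp]: "harmonic_on S (\<lambda>_. c)"
  unfolding harmonic_on_def
  by (intro exI[of _ "\<lambda>_. 0"] exI[of _ "\<lambda>_ _. 0"] conjI ballI allI has_derivative_eq_rhs[OF has_derivative_const])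
     (auto simp: fun_eq_iff)

lemma harmonic_on_cmult:
  assumes "harmonic_on S h"
  shows "harmonic_on S (\<lambda>x. c * h x)"
proof -
  obtain D H where DH: "\<forall>x\<in>S. (h has_derivative (\<lambda>v. D x \<bullet> v)) (at x)" "\<forall>x\<in>S. (D has_derivative H x) (at x)"
    "\<forall>v. continuous_on S (\<lambda>x. H x v)" "\<forall>x\<in>S. (\<Sum>b\<in>Basis. H x b \<bullet> b) = 0"
    using assms unfolding harmonic_on_def by blast
  show ?thesis unfolding harmonic_on_def
  proof (intro exI[of _ "\<lambda>x. c *\<^sub>R D x"] exI[of _ "\<lambda>x v. c *\<^sub>R H x v"] conjI ballI allI)
    fix x assume x: "x \<in> S"
    show "((\<lambda>x. c * h x) has_derivative (\<lambda>v. (c *\<^sub>R D x) \<bullet> v)) (at x)"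
      using has_derivative_mult_right[of h "\<lambda>v. D x \<bullet> v" "at x" c] DH(1) x by simp
    show "((\<lambda>x. c *\<^sub>R D x) has_derivative (\<lambda>v. c *\<^sub>R H x v)) (at x)"
      using DH(2) x by (intro has_derivative_scaleR_right) auto
    show "(\<Sum>b\<in>Basis. c *\<^sub>R H x b \<bullet> b) = 0" using DH(4) x by (simp add: sum_distrib_left[symmetric])
  next
    fix v show "continuous_on S (\<lambda>x. c *\<^sub>R H x v)" using DH(3) by (intro continuous_intros) auto
  qed
qed

lemma harmonic_mean_value:
  assumes S: "open S" and h: "harmonic_on S h" and r: "0 < r" "cball x r \<subseteq> S"
  shows "measure lborel (cball x r) * h x \<le> (\<integral>y. indicator (cball x r) y *\<^sub>R h y \<partial>lborel)"
proof -
  have "harmonic_on S (\<lambda>x. (- 1) * h x)" by (rule harmonic_on_cmult[OF h])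
  then obtain D H where DH: "\<forall>x\<in>S. ((\<lambda>x. (- 1) * h x) has_derivative (\<lambda>v. D x \<bullet> v)) (at x)" "\<forall>x\<in>S. (D has_derivative H x) (at x)"
    "\<forall>v. continuous_on S (\<lambda>x. H x v)" "\<forall>x\<in>S. (\<Sum>b\<in>Basis. H x b \<bullet> b) = 0"
    unfolding harmonic_on_def by blast
  have "(\<integral>y. indicator (cball x r) y *\<^sub>R ((- 1) * h y) \<partial>lborel) \<le> measure lborel (cball x r) * ((- 1) * h x)"
    by (rule mean_value_inequality_C2[OF S, of _ D H]) (use DH r in auto)
  then show ?thesis by simp
qed

lemma fundamental_solution_ge_iff:
  fixes z :: "'a::euclidean_space"
  assumes "3 \<le> DIM('a)" "0 \<le> a"
  shows "ereal a \<le> fundamental_solution z \<longleftrightarrow> ennreal a \<le> newton z"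
proof (cases "z = 0")
  case False
  then have "fundamental_solution z = ereal (norm z powr (2 - real DIM('a)) / newton_const TYPE('a))"
    by (simp add: fundamental_solution_def newton_const_def)
  then show ?thesis using newton_eq[OF False] newton_const_pos[OF assms(1)] by (simp add: ennreal_le_iff)
qed (simp add: fundamental_solution_def)

lemma fundamental_solution_nonneg:
  fixes z :: "'a::euclidean_space"
  assumes "3 \<le> DIM('a)"
  shows "0 \<le> fundamental_solution z"
  using newton_const_pos[OF assms] unfolding fundamental_solution_def newton_const_def by auto

text \<open>\<open>h y\<close> is selected separately for each pole \<open>y\<close>, so at this
  point not even measurability in \<open>y\<close> is known.\<close>

locale green_domain =
  fixes \<Omega> :: "'a::euclidean_space set" and h :: "'a \<Rightarrow> 'a \<Rightarrow> real"
  assumes dim: "3 \<le> DIM('a)" and open_dom: "open \<Omega>"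
    and minorant: "y \<in> \<Omega> \<Longrightarrow> greatest_harmonic_minorant \<Omega> (\<lambda>x. fundamental_solution (x - y)) (h y)"
begin

lemma h_harmonic: "y \<in> \<Omega> \<Longrightarrow> harmonic_on \<Omega> (h y)"
  using minorant unfolding greatest_harmonic_minorant_def by blast

lemma h_nonneg: "x \<in> \<Omega> \<Longrightarrow> y \<in> \<Omega> \<Longrightarrow> 0 \<le> h y x"
  using minorant[of y] harmonic_on_const[of \<Omega> 0] fundamental_solution_nonneg[OF dim]
  unfolding greatest_harmonic_minorant_def by (metis zero_ereal_def)

lemma h_le_newton: "x \<in> \<Omega> \<Longrightarrow> y \<in> \<Omega> \<Longrightarrow> ennreal (h y x) \<le> newton (x - y)"
  using minorant[of y] fundamental_solution_ge_iff[OF dim h_nonneg] unfolding greatest_harmonic_minorant_def by blast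

lemma h_greatest:
  assumes "y \<in> \<Omega>" "harmonic_on \<Omega> k" "\<And>x. x \<in> \<Omega> \<Longrightarrow> 0 \<le> k x" "\<And>x. x \<in> \<Omega> \<Longrightarrow> ennreal (k x) \<le> newton (x - y)" "x \<in> \<Omega>"
  shows "k x \<le> h y x"
  using assms minorant[of y] fundamental_solution_ge_iff[OF dim] unfolding greatest_harmonic_minorant_def by blast

lemma h_continuous_on: "y \<in> \<Omega> \<Longrightarrow> S \<subseteq> \<Omega> \<Longrightarrow> continuous_on S (h y)"
  using h_harmonic harmonic_on_imp_continuous_on continuous_on_subset by blast

lemma nn_integral_h:
  assumes "y \<in> \<Omega>" "cball x r \<subseteq> \<Omega>"
  shows "(\<integral>\<^sup>+z. ennreal (h y z) * indicator (cball x r) z \<partial>lborel) = ennreal (\<integral>z. indicator (cball x r) z *\<^sub>R h y z \<partial>lborel)"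
proof -
  have "integrable lborel (\<lambda>z. indicator (cball x r) z *\<^sub>R h y z)"
    by (rule borel_integrable_compact[OF compact_cball h_continuous_on[OF assms]])
  moreover have "(\<integral>\<^sup>+z. ennreal (h y z) * indicator (cball x r) z \<partial>lborel) = (\<integral>\<^sup>+z. ennreal (indicator (cball x r) z *\<^sub>R h y z) \<partial>lborel)"
    by (intro nn_integral_cong) (auto simp: indicator_def)
  moreover have "0 \<le> indicator (cball x r) z *\<^sub>R h y z" for z
    using assms h_nonneg[of z y] by (auto simp: indicator_def)
  ultimately show ?thesis by (simp add: nn_integral_eq_integral)
qed

lemma h_mean_value:
  assumes "y \<in> \<Omega>" "0 < r" "cball x r \<subseteq> \<Omega>"
  shows "emeasure lborel (cball x r) * ennreal (h y x) \<le> (\<integral>\<^sup>+z. ennreal (h y z) * indicator (cball x r) z \<partial>lborel)"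
proof -
  have "emeasure lborel (cball x r) = ennreal (measure lborel (cball x r))"
    using emeasure_lborel_cball_finite[of x r] by (intro emeasure_eq_ennreal_measure) auto
  then have "emeasure lborel (cball x r) * ennreal (h y x) = ennreal (measure lborel (cball x r) * h y x)"
    using assms by (subst ennreal_mult) (auto intro!: h_nonneg)
  also have "\<dots> \<le> ennreal (\<integral>z. indicator (cball x r) z *\<^sub>R h y z \<partial>lborel)"
    by (intro ennreal_leI harmonic_mean_value[OF open_dom h_harmonic]) (use assms in auto)
  finally show ?thesis using nn_integral_h[OF assms(1,3)] by simp
qed

text \<open>The pointwise bound by the Newtonian kernel degenerates when x approaches y. Averaging
  \<open>h y\<close> over a ball of fixed radius first removes the singularity, as the kernel
  integrates over that ball to an amount independent of the pole.\<close>

lemma h_locally_bounded: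
  assumes "0 < s" "cball y0 (2 * s) \<subseteq> \<Omega>"
  obtains L where "0 < L" "\<And>x y. y \<in> \<Omega> \<Longrightarrow> x \<in> cball y0 s \<Longrightarrow> h y x \<le> L"
proof -
  obtain C where C: "0 < C" "\<And>(x::'a) E. E \<in> sets borel \<Longrightarrow>
    (\<integral>\<^sup>+y. newton (x - y) * indicator E y \<partial>lborel) \<le> ennreal C * epowr (emeasure lborel E) (2 / real DIM('a))"
    using newton_integral_bound[OF dim] by blast
  define V where "V = unit_ball_vol (real DIM('a)) * s ^ DIM('a)"
  have V: "0 < V" "\<And>x::'a. emeasure lborel (cball x s) = ennreal V" using assms by (auto simp: V_def emeasure_cball)
  show ?thesis
  proof (rule that[of "C * V powr (2 / real DIM('a)) / V"])
    show "0 < C * V powr (2 / real DIM('a)) / V" using C V by simp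
    fix x y assume y: "y \<in> \<Omega>" and x: "x \<in> cball y0 s"
    have sub: "cball x s \<subseteq> \<Omega>"
    proof
      fix z assume "z \<in> cball x s"
      then have "dist y0 z \<le> 2 * s" using x dist_triangle[of y0 z x] by simp
      then show "z \<in> \<Omega>" using assms(2) by auto
    qed
    have "ennreal V * ennreal (h y x) \<le> (\<integral>\<^sup>+z. ennreal (h y z) * indicator (cball x s) z \<partial>lborel)"
      using h_mean_value[OF y assms(1) sub] V by simp
    also have "\<dots> \<le> (\<integral>\<^sup>+z. newton (y - z) * indicator (cball x s) z \<partial>lborel)"
    proof (rule nn_integral_mono)
      fix z
      show "ennreal (h y z) * indicator (cball x s) z \<le> newton (y - z) * indicator (cball x s) z"
        using h_le_newton[of z y] sub y newton_minus[of "z - y"] by (cases "z \<in> cball x s") auto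
    qed
    also have "\<dots> \<le> ennreal C * ennreal (V powr (2 / real DIM('a)))"
      using C(2)[of "cball x s" y] V by simp
    finally have "ennreal V * ennreal (h y x) \<le> ennreal C * ennreal (V powr (2 / real DIM('a)))" .
    moreover have "x \<in> \<Omega>" using sub assms(1) by auto
    ultimately have "ennreal (V * h y x) \<le> ennreal (C * V powr (2 / real DIM('a)))"
      using C(1) V(1) h_nonneg[of x y] y by (simp add: ennreal_mult)
    then have "V * h y x \<le> C * V powr (2 / real DIM('a))" using C by (subst (asm) ennreal_le_iff) auto
    then show "h y x \<le> C * V powr (2 / real DIM('a)) / V" using V by (simp add: field_simps)
  qed
qed

text \<open>Outside a small ball about \<open>y0\<close> the fundamental solutions with poles \<open>y\<close> and \<open>y0\<close> are comparable
  with constant close to 1; inside that ball the one with pole \<open>y0\<close> exceeds the local bound on \<open>h y\<close>.\<close>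

lemma h_upper_semicontinuous_pole:
  assumes y0: "y0 \<in> \<Omega>" and \<theta>: "1 < \<theta>"
  obtains \<eta> where "0 < \<eta>" "\<And>x y. y \<in> \<Omega> \<Longrightarrow> dist y y0 < \<eta> \<Longrightarrow> x \<in> \<Omega> \<Longrightarrow> h y x \<le> \<theta> powr (real DIM('a) - 2) * h y0 x"
proof -
  obtain s' where s': "0 < s'" "cball y0 s' \<subseteq> \<Omega>" using open_dom y0 open_contains_cball by blast
  define s where "s = s' / 2"
  have s: "0 < s" "cball y0 (2 * s) \<subseteq> \<Omega>" using s' by (auto simp: s_def)
  obtain L where L: "0 < L" "\<And>x y. y \<in> \<Omega> \<Longrightarrow> x \<in> cball y0 s \<Longrightarrow> h y x \<le> L"
    using h_locally_bounded[OF s] by blast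
  \<comment> \<open>Within distance \<kappa> of y0 the bound L for \<open>h y\<close> is valid and
    the kernel with pole y0 exceeds L.\<close>
  define \<kappa> where "\<kappa> = min s (newton_radius TYPE('a) L)"
  have \<kappa>: "0 < \<kappa>" using s L newton_const_pos[OF dim] by (simp add: \<kappa>_def newton_radius_def)
  \<comment> \<open>The solution of \<theta>(\<kappa>-\<eta>) = \<kappa>: for |z-y0| \<ge> \<kappa>
    and |y-y0| < \<eta> it yields |z-y0| \<le> \<theta> |z-y|.\<close>
  define \<eta> where "\<eta> = (\<theta> - 1) * \<kappa> / \<theta>"
  have \<eta>: "0 < \<eta>" "\<eta> < \<kappa>" "\<theta> * \<eta> = (\<theta> - 1) * \<kappa>" using \<theta> \<kappa> by (auto simp: \<eta>_def field_simps)
  define c where "c = newton_const TYPE('a)"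
  have c: "0 < c" unfolding c_def by (rule newton_const_pos[OF dim])
  define p where "p = real DIM('a) - 2"
  have p: "0 < p" using dim by (simp add: p_def)
  define T where "T = \<theta> powr p"
  have T: "1 \<le> T" using \<theta> p by (simp add: T_def ge_one_powr_ge_zero)
  show ?thesis
  proof (rule that[OF \<eta>(1)])
    fix x y assume y: "y \<in> \<Omega>" "dist y y0 < \<eta>" and x: "x \<in> \<Omega>"
    \<comment> \<open>\<open>h y\<close> divided by T competes as a harmonic minorant for the pole
      y0, and maximality of \<open>h y0\<close> decides.\<close>
    have "(1 / T) * h y x \<le> h y0 x"
    proof (rule h_greatest[OF y0 _ _ _ x])
      show "harmonic_on \<Omega> (\<lambda>x. 1 / T * h y x)" by (rule harmonic_on_cmult[OF h_harmonic[OF y(1)]])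
      fix z assume z: "z \<in> \<Omega>"
      show "0 \<le> 1 / T * h y z" using T h_nonneg[OF z y(1)] by simp
      have le: "1 / T * h y z \<le> h y z" using T h_nonneg[OF z y(1)] mult_right_mono[of "1 / T" 1 "h y z"] by simp
      show "ennreal (1 / T * h y z) \<le> newton (z - y0)"
      proof (cases "norm (z - y0) < \<kappa>")
        case True
        then have "z \<in> cball y0 s" by (simp add: \<kappa>_def dist_norm norm_minus_commute)
        then have "ennreal (1 / T * h y z) \<le> ennreal L" using L(2)[OF y(1)] le by (intro ennreal_leI) force
        also have "\<dots> < newton (z - y0)" using True newton_gt_iff[OF dim L(1), of "z - y0"] by (simp add: \<kappa>_def)
        finally show ?thesis by simp
      next
        case False
        have tri: "norm (z - y0) \<le> norm (z - y) + dist y y0"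
          using norm_triangle_ineq[of "z - y" "y - y0"] by (simp add: dist_norm)
        have zy: "0 < norm (z - y)" using False tri y(2) \<eta> by linarith
        have "norm (z - y0) \<le> \<theta> * norm (z - y)"
        proof -
          have "\<theta> * (norm (z - y0) - \<eta>) \<le> \<theta> * norm (z - y)" using tri y(2) \<theta> by (intro mult_left_mono) auto
          moreover have "(\<theta> - 1) * \<kappa> \<le> (\<theta> - 1) * norm (z - y0)" using False \<theta> by (intro mult_left_mono) auto
          ultimately show ?thesis using \<eta>(3) by (simp add: algebra_simps)
        qed
        then have "norm (z - y) powr - p \<le> (norm (z - y0) / \<theta>) powr - p"
          using \<theta> zy p False \<kappa> by (intro powr_mono2') (auto simp: field_simps)
        also have "\<dots> = T * norm (z - y0) powr - p" using \<theta> by (simp add: powr_divide T_def powr_minus field_simps)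
        finally have *: "1 / T * (norm (z - y) powr - p / c) \<le> norm (z - y0) powr - p / c"
          using T c by (simp add: field_simps)
        have "z \<noteq> y" "z \<noteq> y0" using zy False \<kappa> by auto
        have "ennreal (h y z) \<le> ennreal (norm (z - y) powr - p / c)"
          using h_le_newton[OF z y(1)] newton_eq[of "z - y"] \<open>z \<noteq> y\<close> by (simp add: p_def c_def)
        then have "h y z \<le> norm (z - y) powr - p / c" using c by (subst (asm) ennreal_le_iff) auto
        then have "1 / T * h y z \<le> 1 / T * (norm (z - y) powr - p / c)" using T by (intro mult_left_mono) auto
        also note *
        finally have "ennreal (1 / T * h y z) \<le> ennreal (norm (z - y0) powr - p / c)" by (rule ennreal_leI)
        then show ?thesis using newton_eq[of "z - y0"] \<open>z \<noteq> y0\<close> by (simp add: p_def c_def)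
      qed
    qed
    then show "h y x \<le> \<theta> powr (real DIM('a) - 2) * h y0 x" using T by (simp add: T_def[symmetric] p_def[symmetric] field_simps)
  qed
qed

text \<open>Extended by zero, so that potentials become integrals over the whole space. The
  subtraction on [0, \<infinity>] is faithful: the minorant never exceeds the kernel, and at the
  pole infinity minus a finite value is infinity.\<close>

definition G :: "'a \<Rightarrow> 'a \<Rightarrow> ennreal" where
  "G x y = (if x \<in> \<Omega> \<and> y \<in> \<Omega> then newton (x - y) - ennreal (h y x) else 0)"

lemma G_le_newton: "G x y \<le> newton (x - y)"
  by (simp add: G_def diff_le_self_ennreal)

lemma G_plus_h: "x \<in> \<Omega> \<Longrightarrow> y \<in> \<Omega> \<Longrightarrow> G x y + ennreal (h y x) = newton (x - y)"
  by (simp add: G_def diff_add_cancel_ennreal h_le_newton)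

text \<open>A number b is put between a + h y0 x0 and the kernel at the given point. Nearby the
  kernel stays above b, and \<open>h_upper_semicontinuous_pole\<close> with continuity of
  \<open>h y0\<close> keeps a + h y x below b.\<close>

lemma G_lower_semicontinuous: "open {p. a < G (fst p) (snd p)}"
proof (rule open_subopen[THEN iffD2], rule ballI)
  let ?d = "real DIM('a) - 2"
  fix p0 assume "p0 \<in> {p. a < G (fst p) (snd p)}"
  then obtain x0 y0 where p0: "p0 = (x0, y0)" and aG: "a < G x0 y0" by (cases p0) auto
  then have dom: "x0 \<in> \<Omega>" "y0 \<in> \<Omega>" by (auto simp: G_def split: if_splits)
  define c where "c = h y0 x0"
  have c: "0 \<le> c" using h_nonneg dom by (simp add: c_def)
  obtain a' where a': "a = ennreal a'" "0 \<le> a'" using aG by (cases a) auto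
  have "a + ennreal c < newton (x0 - y0)"
  proof -
    have "a + ennreal c < G x0 y0 + ennreal c" using aG by (simp add: add.commute[of _ "ennreal c"] ennreal_add_left_cancel_less)
    then show ?thesis using G_plus_h[OF dom] by (simp add: c_def)
  qed
  then have "ennreal (a' + c) < newton (x0 - y0)" using a' c by simp
  then obtain b' where b': "ennreal (a' + c) < b'" "b' < newton (x0 - y0)" using dense by blast
  then obtain b where b: "b' = ennreal b" "0 \<le> b" by (cases b') auto
  have bac: "a' + c < b" using b b'(1) a' c by (simp add: ennreal_less_iff del: ennreal_plus)
  have b0: "0 < b" using bac a' c by linarith
  \<comment> \<open>The gap between h y0 x0 and b-a' is shared: moving x may raise
    \<open>h y0\<close> up to m, and moving the pole may multiply by (b-a')/m, which is then the
    value required of \<theta>^(n-2).\<close>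
  define m where "m = (c + (b - a')) / 2"
  have m: "c < m" "m < b - a'" "0 < m" using bac c a' by (auto simp: m_def)
  define \<theta> where "\<theta> = ((b - a') / m) powr (1 / (?d))"
  have dim2: "?d > 0" using dim by simp
  have quo: "1 < (b - a') / m" using m by simp
  have \<theta>: "1 < \<theta>" unfolding \<theta>_def using quo dim2 by (intro gr_one_powr) auto
  have \<theta>p: "\<theta> powr (?d) = (b - a') / m"   proof -
    have "1 / (?d) * (?d) = 1" using dim2 by simp
    then show ?thesis unfolding \<theta>_def powr_powr using quo by (simp only: powr_one)
  qed
  obtain \<eta> where \<eta>: "0 < \<eta>" "\<And>x y. y \<in> \<Omega> \<Longrightarrow> dist y y0 < \<eta> \<Longrightarrow> x \<in> \<Omega> \<Longrightarrow> h y x \<le> (b - a') / m * h y0 x"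
    using h_upper_semicontinuous_pole[OF dom(2) \<theta>] unfolding \<theta>p by blast
  have "continuous_on \<Omega> (h y0)" by (rule harmonic_on_imp_continuous_on[OF h_harmonic[OF dom(2)]])
  then have "open (h y0 -` {..<m} \<inter> \<Omega>)" using open_dom by (simp add: continuous_on_open_vimage)
  moreover have "x0 \<in> h y0 -` {..<m} \<inter> \<Omega>" using m dom by (simp add: c_def)
  ultimately obtain X where X: "open X" "x0 \<in> X" "\<And>x. x \<in> X \<Longrightarrow> x \<in> \<Omega> \<and> h y0 x < m" by auto
  define W where "W = (X \<times> (\<Omega> \<inter> ball y0 \<eta>)) \<inter> (\<lambda>p. fst p - snd p) -` ball 0 (newton_radius TYPE('a) b)"
  have "open W" unfolding W_def using X(1) open_dom
    by (intro open_Int open_Times open_vimage) (auto intro!: continuous_intros)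
  moreover have "p0 \<in> W" unfolding W_def using X dom \<eta> b'(2) newton_gt_iff[OF dim b0, of "x0 - y0"] b by (simp add: p0)
  moreover have "W \<subseteq> {p. a < G (fst p) (snd p)}"
  proof
    fix p assume p: "p \<in> W"
    obtain x y where xy: "p = (x, y)" by (cases p)
    have x: "x \<in> \<Omega>" "h y0 x < m" and y: "y \<in> \<Omega>" "dist y y0 < \<eta>" and n: "norm (x - y) < newton_radius TYPE('a) b"
      using p X(3)[of x] by (auto simp: W_def xy dist_commute)
    have "h y x \<le> (b - a') / m * h y0 x" by (rule \<eta>(2)[OF y x(1)])
    also have "\<dots> < (b - a') / m * m" using x quo by (intro mult_strict_left_mono) auto
    finally have hlt: "h y x < b - a'" using m by simp
    have "a + ennreal (h y x) = ennreal (a' + h y x)" using a' h_nonneg[OF x(1) y(1)] by simp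
    also have "\<dots> < ennreal b" using hlt a' h_nonneg[OF x(1) y(1)] b by (simp add: ennreal_less_iff del: ennreal_plus)
    also have "\<dots> < newton (x - y)" using n newton_gt_iff[OF dim b0, of "x - y"] by simp
    also have "\<dots> = G x y + ennreal (h y x)" using G_plus_h[OF x(1) y(1)] by simp
    finally have "a < G x y" by (simp add: add.commute[of _ "ennreal (h y x)"] ennreal_add_left_cancel_less)
    then show "p \<in> {p. a < G (fst p) (snd p)}" by (simp add: xy)
  qed
  ultimately show "\<exists>T. open T \<and> p0 \<in> T \<and> T \<subseteq> {p. a < G (fst p) (snd p)}" by blast
qed

lemma borel_measurable_G [measurable]: "(\<lambda>(x, y). G x y) \<in> borel_measurable (borel \<Otimes>\<^sub>M borel)"
proof -
  have "(\<lambda>p. G (fst p) (snd p)) \<in> borel_measurable borel"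
    by (rule borel_measurableI_greater) (simp add: G_lower_semicontinuous)
  then show ?thesis by (simp add: borel_prod case_prod_unfold)
qed

text \<open>The inequality for the kernel combined with the opposite one for \<open>h y\<close>, in
  the additive form G + h = kernel so that no infinite quantities are subtracted. The integral of
  \<open>h y\<close> over the ball is finite and cancels at the end.\<close>

lemma G_mean_value:
  assumes y: "y \<in> \<Omega>" and r: "0 < r" "cball x r \<subseteq> \<Omega>"
  shows "(\<integral>\<^sup>+z. G z y * indicator (cball x r) z \<partial>lborel) \<le> emeasure lborel (cball x r) * G x y"
proof -
  let ?I = "indicator (cball x r)" and ?V = "emeasure lborel (cball x r)"
  have [measurable]: "cball x r \<in> sets borel" by simp
  have x: "x \<in> \<Omega>" using r by auto
  have Gm[measurable]: "(\<lambda>z. G z y) \<in> borel_measurable borel" by measurable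
  let ?H = "\<integral>\<^sup>+z. ennreal (h y z) * ?I z \<partial>lborel"
  have hm: "(\<lambda>z. ennreal (h y z) * ?I z) \<in> borel_measurable borel"
  proof -
    have "(\<lambda>z. ?I z *\<^sub>R h y z) \<in> borel_measurable borel"
      by (rule borel_measurable_continuous_on_indicator[OF _ h_continuous_on[OF y r(2)]]) simp
    then have "(\<lambda>z. ennreal (?I z *\<^sub>R h y z)) \<in> borel_measurable borel" by measurable
    moreover have "(\<lambda>z. ennreal (?I z *\<^sub>R h y z)) = (\<lambda>z. ennreal (h y z) * ?I z)"
      by (auto simp: fun_eq_iff indicator_def)
    ultimately show ?thesis by simp
  qed
  have "(\<integral>\<^sup>+z. G z y * ?I z \<partial>lborel) + ?H
    = (\<integral>\<^sup>+z. G z y * ?I z + ennreal (h y z) * ?I z \<partial>lborel)"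
    using hm by (intro nn_integral_add[symmetric]) auto
  also have "\<dots> = (\<integral>\<^sup>+z. newton (z - y) * ?I z \<partial>lborel)"
    using r y by (intro nn_integral_cong) (auto simp: indicator_def G_plus_h)
  also have "\<dots> \<le> ?V * newton (x - y)" by (rule newton_mean_value[OF dim r(1)])
  also have "\<dots> = ?V * G x y + ?V * ennreal (h y x)"
    unfolding G_plus_h[OF x y, symmetric] by (simp add: distrib_left)
  also have "\<dots> \<le> ?V * G x y + ?H" by (intro add_left_mono h_mean_value y r)
  finally show ?thesis unfolding nn_integral_h[OF y r(2)] by simp
qed

end

section \<open>Existence by monotone iteration\<close>

lemma rearr_mono: "(\<And>x. x \<in> space M \<Longrightarrow> f x \<le> f' x) \<Longrightarrow> f' \<in> borel_measurable M \<Longrightarrow> rearr M f t \<le> rearr M f' t"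
  unfolding rearr_def
  by (rule Inf_superset_mono, clarsimp, erule order.trans[rotated], intro emeasure_mono) (auto intro: less_le_trans)

text \<open>The Fatou property by which the uniform bound on the iterates passes to their
  limit.\<close>

lemma lorentz_int_SUP:
  fixes u :: "nat \<Rightarrow> 'b \<Rightarrow> ennreal"
  assumes u[measurable]: "\<And>k. u k \<in> borel_measurable M" and inc: "incseq u" and \<rho>: "0 < \<rho>"
  shows "lorentz_int M \<beta> \<rho> (\<lambda>x. SUP k. u k x) \<le> (SUP k. lorentz_int M \<beta> \<rho> (u k))"
proof -
  define F where "F k t = epowr (ennreal (t powr \<beta>) * rearr M (u k) t) \<rho> * ennreal (1 / t) * indicator {0<..} t" for k and t :: real
  have F[measurable]: "F k \<in> borel_measurable borel" for k unfolding F_def by measurable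
  have "incseq F"
    using inc \<rho> unfolding incseq_def le_fun_def F_def
    by (auto intro!: mult_right_mono epowr_mono mult_left_mono rearr_mono)
  have "lorentz_int M \<beta> \<rho> (\<lambda>x. SUP k. u k x) \<le> (\<integral>\<^sup>+t. (SUP k. F k t) \<partial>lborel)"
    unfolding lorentz_int_def weighted_int_def
  proof (rule nn_integral_mono)
    fix t :: real
    have "epowr (ennreal (t powr \<beta>) * rearr M (\<lambda>x. SUP k. u k x) t) \<rho> \<le> epowr (ennreal (t powr \<beta>) * (SUP k. rearr M (u k) t)) \<rho>"
      using \<rho> by (intro epowr_mono mult_left_mono rearr_SUP inc) auto
    also have "\<dots> = (SUP k. epowr (ennreal (t powr \<beta>) * rearr M (u k) t) \<rho>)"
      unfolding SUP_mult_left_ennreal using \<rho> by (rule epowr_SUP)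
    finally have "epowr (ennreal (t powr \<beta>) * rearr M (\<lambda>x. SUP k. u k x) t) \<rho> * (ennreal (1 / t) * indicator {0<..} t)
      \<le> (SUP k. epowr (ennreal (t powr \<beta>) * rearr M (u k) t) \<rho>) * (ennreal (1 / t) * indicator {0<..} t)"
      by (rule mult_right_mono) simp
    also have "\<dots> = (SUP k. F k t)" unfolding F_def SUP_mult_right_ennreal by (simp add: mult.assoc)
    finally show "epowr (ennreal (t powr \<beta>) * rearr M (\<lambda>x. SUP k. u k x) t) \<rho> * ennreal (1 / t) * indicator {0<..} t \<le> (SUP k. F k t)"
      by (simp add: mult.assoc)
  qed
  also have "\<dots> = (SUP k. lorentz_int M \<beta> \<rho> (u k))"
  proof -
    have "lorentz_int M \<beta> \<rho> (u k) = integral\<^sup>N lborel (F k)" for k by (simp add: F_def[abs_def] lorentz_int_def weighted_int_def)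
    then show ?thesis using nn_integral_monotone_convergence_SUP[OF \<open>incseq F\<close>, of lborel] F by simp
  qed
  finally show ?thesis .
qed

lemma lorentz_int_0: "0 < \<rho> \<Longrightarrow> lorentz_int M \<beta> \<rho> (\<lambda>_. 0) = 0"
proof -
  have "rearr M (\<lambda>_. 0) t = 0" for t using rearr_le[of M 0 "\<lambda>_. 0" t] by simp
  then show ?thesis by (simp add: lorentz_int_def weighted_int_def)
qed

text \<open>Admits a bump on a compact set as start of the iteration: its rearrangement is at most
  \<epsilon> up to \<open>v\<close> and zero afterwards, and t^(\<beta>\<rho>-1) is integrable at
  0.\<close>

lemma lorentz_int_indicator_finite:
  assumes A: "A \<in> sets M" "emeasure M A = ennreal v" "0 \<le> v" and \<epsilon>: "0 \<le> \<epsilon>" and \<beta>: "0 < \<beta>" and \<rho>: "0 < \<rho>"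
  shows "lorentz_int M \<beta> \<rho> (\<lambda>x. ennreal \<epsilon> * indicator A x) < \<infinity>"
proof -
  let ?f = "\<lambda>x. ennreal \<epsilon> * indicator A x"
  have r1: "rearr M ?f t \<le> ennreal \<epsilon>" for t
    by (rule rearr_le) (auto simp: indicator_def)
  have r2: "rearr M ?f t = 0" if "v < t" for t
  proof -
    have "emeasure M {x \<in> space M. 0 < ennreal \<epsilon> * indicator A x} \<le> emeasure M A"
      using A by (intro emeasure_mono) (auto simp: indicator_def split: if_splits)
    also have "\<dots> \<le> ennreal t" using A that by (simp add: ennreal_leI)
    finally show ?thesis using rearr_le[of M 0] by (metis le_zero_eq)
  qed
  have hi: "((\<lambda>t. t powr (\<beta> * \<rho> - 1)) has_integral (v powr (\<beta> * \<rho> - 1 + 1) / (\<beta> * \<rho> - 1 + 1))) {0..v}"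
    by (rule has_integral_powr_from_0) (use assms in auto)
  have "lorentz_int M \<beta> \<rho> ?f \<le> (\<integral>\<^sup>+t. ennreal (\<epsilon> powr \<rho>) * (ennreal (t powr (\<beta> * \<rho> - 1)) * indicator {0..v} t) \<partial>lborel)"
    unfolding lorentz_int_def weighted_int_def
  proof (rule nn_integral_mono)
    fix t :: real
    show "epowr (ennreal (t powr \<beta>) * rearr M ?f t) \<rho> * ennreal (1 / t) * indicator {0<..} t
      \<le> ennreal (\<epsilon> powr \<rho>) * (ennreal (t powr (\<beta> * \<rho> - 1)) * indicator {0..v} t)"
    proof (cases "0 < t \<and> t \<le> v")
      case True
      have "epowr (ennreal (t powr \<beta>) * rearr M ?f t) \<rho> \<le> epowr (ennreal (t powr \<beta>) * ennreal \<epsilon>) \<rho>"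
        using \<rho> by (intro epowr_mono mult_left_mono r1) auto
      also have "\<dots> = ennreal (\<epsilon> powr \<rho> * t powr (\<beta> * \<rho>))"
        using \<rho> \<epsilon> by (simp add: epowr_mult powr_powr ennreal_mult mult.commute)
      finally have "epowr (ennreal (t powr \<beta>) * rearr M ?f t) \<rho> * ennreal (1 / t) \<le> ennreal (\<epsilon> powr \<rho> * t powr (\<beta> * \<rho>)) * ennreal (1 / t)"
        by (rule mult_right_mono) simp
      also have "\<dots> = ennreal (\<epsilon> powr \<rho>) * ennreal (t powr (\<beta> * \<rho> - 1))"
        using True by (simp add: ennreal_mult[symmetric] powr_diff)
      finally show ?thesis using True by simp
    next
      case False
      then show ?thesis using r2[of t] by (cases "0 < t") auto
    qed
  qed
  also have "\<dots> = ennreal (\<epsilon> powr \<rho>) * (\<integral>\<^sup>+t. (ennreal (t powr (\<beta> * \<rho> - 1)) * indicator {0..v} t) \<partial>lborel)"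
    by (rule nn_integral_cmult) measurable
  also have "\<dots> < \<infinity>"
    using nn_integral_set_has_integral[OF hi] by (simp add: ennreal_mult_less_top infinity_ennreal_def)
  finally show ?thesis .
qed

section \<open>Potentials of the Green kernel\<close>

context green_domain
begin

definition pot :: "('a \<Rightarrow> ennreal) \<Rightarrow> 'a \<Rightarrow> ennreal" where
  "pot f x = (\<integral>\<^sup>+y. G x y * f y \<partial>lborel)"

lemma measurable_G_section [measurable]: "G x \<in> borel_measurable borel"
  using measurable_compose_Pair1[of x borel "\<lambda>(x, y). G x y"] borel_measurable_G by simp

lemma G_Liminf:
  assumes "X \<longlonglongrightarrow> x"
  shows "G x y \<le> liminf (\<lambda>k. G (X k) y)"
  unfolding le_Liminf_iff
proof (intro allI impI)
  fix a assume a: "a < G x y"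
  have "(\<lambda>k. (X k, y)) \<longlonglongrightarrow> (x, y)" using assms by (intro tendsto_intros)
  from topological_tendstoD[OF this G_lower_semicontinuous[of a]] a
  show "\<forall>\<^sub>F k in sequentially. a < G (X k) y" by simp
qed

text \<open>Sublevel sets are sequentially closed by Fatou's lemma and the lower semicontinuity of G
  in its first variable; Borel measurability of the potential comes as a consequence.\<close>

lemma pot_lower_semicontinuous:
  assumes f[measurable]: "f \<in> borel_measurable borel"
  shows "open {x. a < pot f x}"
proof -
  have "closed {x. pot f x \<le> a}"
    unfolding closed_sequential_limits
  proof (intro allI impI, elim conjE)
    fix X x assume X: "\<forall>n. X n \<in> {x. pot f x \<le> a}" and lim: "X \<longlonglongrightarrow> x"
    have "pot f x \<le> (\<integral>\<^sup>+y. liminf (\<lambda>k. G (X k) y * f y) \<partial>lborel)"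
      unfolding pot_def
    proof (rule nn_integral_mono)
      fix y
      have "G x y * f y \<le> liminf (\<lambda>k. G (X k) y) * f y" by (intro mult_right_mono G_Liminf lim) auto
      also have "\<dots> = (SUP n. (INF k\<in>{n..}. G (X k) y) * f y)"
        unfolding liminf_SUP_INF SUP_mult_right_ennreal ..
      also have "\<dots> \<le> liminf (\<lambda>k. G (X k) y * f y)"
        unfolding liminf_SUP_INF by (intro SUP_mono' INF_greatest mult_right_mono INF_lower) auto
      finally show "G x y * f y \<le> liminf (\<lambda>k. G (X k) y * f y)" .
    qed
    also have "\<dots> \<le> liminf (\<lambda>k. pot f (X k))" unfolding pot_def by (rule nn_integral_liminf) measurable
    also have "\<dots> \<le> a"
      using X by (intro order.trans[OF Liminf_le_Limsup Limsup_bounded]) auto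
    finally show "x \<in> {x. pot f x \<le> a}" by simp
  qed
  moreover have "{x. a < pot f x} = - {x. pot f x \<le> a}" by auto
  ultimately show ?thesis by (simp only: open_Compl)
qed

lemma borel_measurable_pot [measurable]: "f \<in> borel_measurable borel \<Longrightarrow> pot f \<in> borel_measurable borel"
  by (rule borel_measurableI_greater) (simp add: pot_lower_semicontinuous)

lemma pot_outside: "x \<notin> \<Omega> \<Longrightarrow> pot f x = 0"
  by (simp add: pot_def G_def)

lemma pot_mono: "(\<And>y. f y \<le> f' y) \<Longrightarrow> pot f x \<le> pot f' x"
  unfolding pot_def by (intro nn_integral_mono mult_left_mono) auto

lemma pot_mean_value:
  assumes f[measurable]: "f \<in> borel_measurable borel" and r: "0 < r" "cball x r \<subseteq> \<Omega>"
  shows "(\<integral>\<^sup>+z. pot f z * indicator (cball x r) z \<partial>lborel) \<le> emeasure lborel (cball x r) * pot f x"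
proof -
  have [measurable]: "cball x r \<in> sets borel" by simp
  have Gm[measurable]: "(\<lambda>z. G z y) \<in> borel_measurable borel" for y by measurable
  have "(\<integral>\<^sup>+z. pot f z * indicator (cball x r) z \<partial>lborel) = (\<integral>\<^sup>+z. (\<integral>\<^sup>+y. G z y * f y * indicator (cball x r) z \<partial>lborel) \<partial>lborel)"
    unfolding pot_def by (intro nn_integral_cong nn_integral_multc[symmetric]) measurable
  also have "\<dots> = (\<integral>\<^sup>+y. (\<integral>\<^sup>+z. G z y * f y * indicator (cball x r) z \<partial>lborel) \<partial>lborel)"
    by (rule lborel_pair.Fubini'[symmetric]) measurable
  also have "\<dots> = (\<integral>\<^sup>+y. f y * (\<integral>\<^sup>+z. G z y * indicator (cball x r) z \<partial>lborel) \<partial>lborel)"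
    by (subst nn_integral_cmult[symmetric]) (auto simp: mult_ac)
  also have "\<dots> \<le> (\<integral>\<^sup>+y. f y * (emeasure lborel (cball x r) * G x y) \<partial>lborel)"
  proof (intro nn_integral_mono mult_left_mono)
    fix y
    show "(\<integral>\<^sup>+z. G z y * indicator (cball x r) z \<partial>lborel) \<le> emeasure lborel (cball x r) * G x y"
    proof (cases "y \<in> \<Omega>")
      case True then show ?thesis by (rule G_mean_value[OF _ r])
    qed (simp add: G_def)
  qed simp
  also have "\<dots> = emeasure lborel (cball x r) * pot f x"
    unfolding pot_def by (subst nn_integral_cmult[symmetric]) (auto simp: mult_ac)
  finally show ?thesis .
qed

lemma pot_SUP:
  assumes f[measurable]: "\<And>k. f k \<in> borel_measurable borel" and inc: "incseq f"
  shows "pot (\<lambda>y. SUP k. f k y) x = (SUP k. pot (f k) x)"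
proof -
  have "pot (\<lambda>y. SUP k. f k y) x = (\<integral>\<^sup>+y. (SUP k. G x y * f k y) \<partial>lborel)"
    unfolding pot_def by (simp add: SUP_mult_left_ennreal)
  also have "\<dots> = (SUP k. pot (f k) x)" unfolding pot_def
    using inc by (intro nn_integral_monotone_convergence_SUP) (auto simp: incseq_def le_fun_def intro!: mult_left_mono)
  finally show ?thesis .
qed

lemma G_riesz_kernel:
  obtains C where "0 < C" "riesz_kernel lborel G (ennreal C) (2 / real DIM('a))"
proof -
  obtain C where C: "0 < C" "\<And>(x::'a) E. E \<in> sets borel \<Longrightarrow>
    (\<integral>\<^sup>+y. newton (x - y) * indicator E y \<partial>lborel) \<le> ennreal C * epowr (emeasure lborel E) (2 / real DIM('a))"
    using newton_integral_bound[OF dim] by blast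
  have G': "G x y \<le> newton (y - x)" for x y using G_le_newton[of x y] newton_minus[of "x - y"] by simp
  have "riesz_kernel lborel G (ennreal C) (2 / real DIM('a))"
    unfolding riesz_kernel_def
  proof (intro conjI ballI)
    show "sigma_finite_measure (lborel :: 'a measure)" ..
    show "(\<lambda>(x, y). G x y) \<in> borel_measurable (lborel \<Otimes>\<^sub>M lborel)" by measurable
    fix x :: 'a and E :: "'a set" assume "E \<in> sets lborel"
    then have E: "E \<in> sets borel" by simp
    show "(\<integral>\<^sup>+y. G x y * indicator E y \<partial>lborel) \<le> ennreal C * epowr (emeasure lborel E) (2 / real DIM('a))"
      by (rule order.trans[OF nn_integral_mono C(2)[OF E, of x]]) (auto intro!: mult_right_mono G_le_newton)
    show "(\<integral>\<^sup>+y. G y x * indicator E y \<partial>lborel) \<le> ennreal C * epowr (emeasure lborel E) (2 / real DIM('a))"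
      by (rule order.trans[OF nn_integral_mono C(2)[OF E, of x]]) (auto intro!: mult_right_mono G')
  qed
  with C(1) show ?thesis by (rule that)
qed

end

section \<open>Positivity, subsolutions and the monotone iteration\<close>

locale positive_green_domain = green_domain +
  assumes G_pos: "x \<in> \<Omega> \<Longrightarrow> y \<in> \<Omega> \<Longrightarrow> 0 < G x y"
begin

text \<open>Lower semicontinuity and positivity suffice: the open sets {G > 1/(k+1)} increase with k
  and cover the compact product.\<close>

lemma G_lower_bound:
  assumes K: "compact K" "K \<subseteq> \<Omega>" and L: "compact L" "L \<subseteq> \<Omega>"
  obtains \<delta> where "0 < \<delta>" "\<And>x y. x \<in> K \<Longrightarrow> y \<in> L \<Longrightarrow> ennreal \<delta> \<le> G x y"
proof -
  let ?W = "\<lambda>k. {p. ennreal (1 / real (Suc k)) < G (fst p) (snd p)}"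
  have cover: "K \<times> L \<subseteq> (\<Union>k\<in>UNIV. ?W k)"
  proof
    fix p assume "p \<in> K \<times> L"
    then have "0 < G (fst p) (snd p)" using K L by (intro G_pos) auto
    then obtain a where a: "0 < a" "a < G (fst p) (snd p)" using dense by blast
    then obtain a' where a': "a = ennreal a'" "0 < a'" by (cases a) (auto simp: less_top)
    then obtain k where "1 / real (Suc k) < a'" using nat_approx_posE by blast
    then have "ennreal (1 / real (Suc k)) < a" using a' by (simp add: ennreal_less_iff)
    then show "p \<in> (\<Union>k\<in>UNIV. ?W k)" using a by (auto intro: less_trans)
  qed
  obtain F where F: "finite F" "K \<times> L \<subseteq> (\<Union>k\<in>F. ?W k)"
    by (rule compactE_image[OF compact_Times[OF K(1) L(1)] _ cover]) (use G_lower_semicontinuous in auto)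
  define m where "m = Max (insert 0 F)"
  have mk: "k \<le> m" if "k \<in> F" for k unfolding m_def using F(1) that by (intro Max_ge) auto
  show ?thesis
  proof (rule that[of "1 / real (Suc m)"])
    fix x y assume "x \<in> K" "y \<in> L"
    then have "(x, y) \<in> (\<Union>k\<in>F. ?W k)" using F(2) by blast
    then obtain k where k: "k \<in> F" "ennreal (1 / real (Suc k)) < G x y" by auto
    have "ennreal (1 / real (Suc m)) \<le> ennreal (1 / real (Suc k))" using mk[OF k(1)] by (intro ennreal_leI divide_left_mono) auto
    then show "ennreal (1 / real (Suc m)) \<le> G x y" using k(2) order.trans less_imp_le by blast
  qed simp
qed

lemma pot_pos:
  assumes x: "x \<in> \<Omega>" and f[measurable]: "f \<in> borel_measurable borel"
    and nz: "\<not> (AE y in lborel. y \<in> \<Omega> \<longrightarrow> f y = 0)"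
  shows "0 < pot f x"
proof (rule ccontr)
  assume "\<not> 0 < pot f x"
  then have "pot f x = 0" by simp
  then have "AE y in lborel. G x y * f y = 0" unfolding pot_def by (subst (asm) nn_integral_0_iff_AE) auto
  then have "AE y in lborel. y \<in> \<Omega> \<longrightarrow> f y = 0"
    by eventually_elim (use G_pos[OF x] in force)
  with nz show False by simp
qed

definition sublinear_op :: "nat \<Rightarrow> (nat \<Rightarrow> real) \<Rightarrow> (nat \<Rightarrow> 'a \<Rightarrow> ennreal) \<Rightarrow> ('a \<Rightarrow> ennreal) \<Rightarrow> ('a \<Rightarrow> ennreal) \<Rightarrow> 'a \<Rightarrow> ennreal" where
  "sublinear_op m q s w u x = (\<Sum>i=1..m. pot (\<lambda>y. s i y * epowr (u y) (q i)) x) + pot w x"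

context
  fixes m :: nat and q :: "nat \<Rightarrow> real" and s :: "nat \<Rightarrow> 'a \<Rightarrow> ennreal" and w :: "'a \<Rightarrow> ennreal"
  assumes q: "\<And>i. i \<in> {1..m} \<Longrightarrow> 0 < q i \<and> q i < 1"
    and s[measurable]: "\<And>i. i \<in> {1..m} \<Longrightarrow> s i \<in> borel_measurable borel"
    and w[measurable]: "w \<in> borel_measurable borel"
begin

abbreviation "T \<equiv> sublinear_op m q s w"

lemma T_mono: "(\<And>y. u y \<le> u' y) \<Longrightarrow> T u x \<le> T u' x"
  unfolding sublinear_op_def using q by (intro add_mono sum_mono pot_mono mult_left_mono epowr_mono) (auto simp: less_imp_le)

lemma measurable_integrand:
  assumes "i \<in> {1..m}" "u \<in> borel_measurable borel"
  shows "(\<lambda>y. s i y * epowr (u y) (q i)) \<in> borel_measurable borel"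
proof -
  note [measurable] = s[OF assms(1)] assms(2)
  show ?thesis by measurable
qed

lemma borel_measurable_T: "u \<in> borel_measurable borel \<Longrightarrow> T u \<in> borel_measurable borel"
  unfolding sublinear_op_def[abs_def]
  by (intro borel_measurable_add borel_measurable_sum borel_measurable_pot measurable_integrand w) auto

text \<open>Monotone convergence through the powers and the potentials; it makes the supremum of the
  iterates a fixed point.\<close>

lemma T_SUP:
  assumes u: "\<And>k. u k \<in> borel_measurable borel" and inc: "incseq u"
  shows "T (\<lambda>x. SUP k. u k x) x = (SUP k. T (u k) x)"
proof -
  let ?f = "\<lambda>i k y. s i y * epowr (u k y) (q i)"
  have incf: "incseq (?f i)" if "i \<in> {1..m}" for i
    using inc q[OF that] by (auto simp: incseq_def le_fun_def intro!: mult_left_mono epowr_mono)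
  have incp: "incseq (\<lambda>k. pot (?f i k) x)" if "i \<in> {1..m}" for i
    using incf[OF that] unfolding incseq_def le_fun_def by (auto intro!: pot_mono)
  have "pot (\<lambda>y. s i y * epowr (SUP k. u k y) (q i)) x = (SUP k. pot (?f i k) x)" if i: "i \<in> {1..m}" for i
  proof -
    have "(\<lambda>y. s i y * epowr (SUP k. u k y) (q i)) = (\<lambda>y. SUP k. ?f i k y)"
      using q[OF i] by (simp add: epowr_SUP SUP_mult_left_ennreal)
    then show ?thesis using pot_SUP[OF measurable_integrand[OF i u] incf[OF i]] by simp
  qed
  then have "T (\<lambda>x. SUP k. u k x) x = (\<Sum>i=1..m. SUP k. pot (?f i k) x) + pot w x"
    unfolding sublinear_op_def by simp
  also have "\<dots> = (SUP k. \<Sum>i=1..m. pot (?f i k) x) + pot w x"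
    by (subst ennreal_SUP_sum) (use incp in auto)
  also have "\<dots> = (SUP k. T (u k) x)" unfolding sublinear_op_def by (rule ennreal_SUP_add_left[symmetric]) simp
  finally show ?thesis .
qed

text \<open>A subsolution makes the iterates increase, and the bound X(u0) + 2K reproduces itself
  under x -> x/2 + K, so it holds for all iterates and for their supremum.\<close>

lemma fixed_point_above:
  assumes \<beta>: "0 < \<beta>" "2 / real DIM('a) + \<beta> < 1" and \<rho>: "1 < \<rho>"
    and sfin: "\<And>i. i \<in> {1..m} \<Longrightarrow> lorentz_int lborel (2 / real DIM('a) + \<beta> - q i * \<beta>) (\<rho> / (1 - q i)) (s i) < \<infinity>"
    and wfin: "lorentz_int lborel (2 / real DIM('a) + \<beta>) \<rho> w < \<infinity>"
    and u0: "u0 \<in> borel_measurable borel" "\<And>x. u0 x \<le> T u0 x" "lorentz_int lborel \<beta> \<rho> u0 < \<infinity>"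
  obtains u where "u \<in> borel_measurable borel" "\<And>x. u x = T u x" "\<And>x. u0 x \<le> u x" "lorentz_int lborel \<beta> \<rho> u < \<infinity>"
proof -
  define U where "U k = (T ^^ k) u0" for k
  have U0: "U 0 = u0" and US: "U (Suc k) = T (U k)" for k by (simp_all add: U_def)
  have Um: "U k \<in> borel_measurable borel" for k
    by (induction k) (simp_all add: U0 u0 US borel_measurable_T)
  have step: "U k x \<le> U (Suc k) x" for k x
  proof (induction k arbitrary: x)
    case 0 then show ?case using u0(2) by (simp add: U0 US)
  next
    case (Suc k) then show ?case unfolding US[of "Suc k"] US[of k] using T_mono[of "U k" "U (Suc k)" x] by (simp add: US)
  qed
  then have inc: "incseq U" by (intro incseq_SucI) (auto simp: le_fun_def)
  obtain C where C: "0 < C" "riesz_kernel lborel G (ennreal C) (2 / real DIM('a))"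
    using G_riesz_kernel by blast
  obtain K where K: "K < \<infinity>"
    "\<And>u U. u \<in> borel_measurable lborel \<Longrightarrow> U \<in> borel_measurable lborel \<Longrightarrow>
      (\<And>x. x \<in> space lborel \<Longrightarrow> U x \<le> (\<Sum>i=1..m. \<integral>\<^sup>+y. G x y * (s i y * epowr (u y) (q i)) \<partial>lborel) + (\<integral>\<^sup>+y. G x y * w y \<partial>lborel)) \<Longrightarrow>
      lorentz_int lborel \<beta> \<rho> U \<le> ennreal (1/2) * lorentz_int lborel \<beta> \<rho> u + K"
    by (rule lorentz_potential_contraction[OF C(2,1) _ \<beta> \<rho>, of m q s w]) (use q s w sfin wfin in auto)
  let ?X = "lorentz_int lborel \<beta> \<rho>"
  have "?X (U k) \<le> ?X u0 + 2 * K" for k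
  proof (induction k)
    case 0 show ?case by (simp add: U0)
  next
    case (Suc k)
    have "?X (U (Suc k)) \<le> ennreal (1/2) * ?X (U k) + K"
    proof (rule K(2))
      show "U (Suc k) x \<le> (\<Sum>i=1..m. \<integral>\<^sup>+y. G x y * (s i y * epowr (U k y) (q i)) \<partial>lborel) + (\<integral>\<^sup>+y. G x y * w y \<partial>lborel)" for x
        by (simp add: US sublinear_op_def pot_def)
    qed (simp_all add: Um)
    also have "\<dots> \<le> ennreal (1/2) * (?X u0 + 2 * K) + K" by (intro add_right_mono mult_left_mono Suc) auto
    also have "\<dots> = ennreal (1/2) * ?X u0 + (ennreal (1/2) * 2) * K + K" by (simp add: distrib_left mult.assoc)
    also have "ennreal (1/2) * 2 = 1"
      using ennreal_mult[of "1/2" 2] by simp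
    also have "ennreal (1/2) * ?X u0 + 1 * K + K \<le> ?X u0 + 2 * K"
    proof -
      have "ennreal (1/2) \<le> 1" using ennreal_leI[of "1/2" 1] by simp
      then have "ennreal (1/2) * ?X u0 \<le> 1 * ?X u0" by (rule mult_right_mono) simp
      moreover have "1 * K + K = 2 * K" by (simp add: mult_2)
      ultimately show ?thesis by (simp add: add.assoc add_right_mono)
    qed
    finally show ?case .
  qed
  then have bnd: "(SUP k. ?X (U k)) \<le> ?X u0 + 2 * K" by (intro SUP_least)
  show ?thesis
  proof (rule that[of "\<lambda>x. SUP k. U k x"])
    show "(\<lambda>x. SUP k. U k x) \<in> borel_measurable borel" using Um by measurable
    show "(SUP k. U k x) = T (\<lambda>x. SUP k. U k x) x" for x
    proof -
      have "(SUP k. U k x) = (SUP k. U (Suc k) x)"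
      proof (rule antisym)
        show "(SUP k. U k x) \<le> (SUP k. U (Suc k) x)" by (intro SUP_mono' step)
        show "(SUP k. U (Suc k) x) \<le> (SUP k. U k x)" by (intro SUP_least SUP_upper) simp
      qed
      then show ?thesis using T_SUP[OF Um inc] by (simp add: US)
    qed
    show "u0 x \<le> (SUP k. U k x)" for x using SUP_upper[of 0 UNIV "\<lambda>k. U k x"] by (simp add: U0)
    have "?X (\<lambda>x. SUP k. U k x) \<le> (SUP k. ?X (U k))"
      using \<rho> Um inc by (intro lorentz_int_SUP) auto
    also have "\<dots> \<le> ?X u0 + 2 * K" by fact
    also have "\<dots> < \<infinity>" using u0(3) K(1) by (auto simp: ennreal_mult_less_top infinity_ennreal_def)
    finally show "?X (\<lambda>x. SUP k. U k x) < \<infinity>" .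
  qed
qed

text \<open>With \<omega> nonzero the first step from zero is already positive. Otherwise zero is
  reproduced by T, and a bump \<epsilon> on a compact K with nontrivial \<sigma>_i is used: its
  image on K is at least \<epsilon>^q \<delta> I, which dominates \<epsilon> for small \<epsilon>
  because q < 1.\<close>

lemma starting_function:
  assumes \<beta>: "0 < \<beta>" and \<rho>: "1 < \<rho>"
    and nz: "\<not> ((\<forall>i\<in>{1..m}. AE y in lborel. y \<in> \<Omega> \<longrightarrow> s i y = 0) \<and> (AE y in lborel. y \<in> \<Omega> \<longrightarrow> w y = 0))"
  obtains u0 where "u0 \<in> borel_measurable borel" "\<And>x. u0 x \<le> T u0 x" "lorentz_int lborel \<beta> \<rho> u0 < \<infinity>"
    "\<And>x. x \<in> \<Omega> \<Longrightarrow> 0 < T u0 x"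
proof (cases "AE y in lborel. y \<in> \<Omega> \<longrightarrow> w y = 0")
  case False
  show ?thesis
  proof (rule that[of "\<lambda>_. 0"])
    show "lorentz_int lborel \<beta> \<rho> (\<lambda>_::'a. 0) < \<infinity>" using \<rho> by (subst lorentz_int_0) auto
    fix x assume "x \<in> \<Omega>"
    then have "0 < pot w x" using False by (intro pot_pos w) auto
    then show "0 < T (\<lambda>_. 0) x" unfolding sublinear_op_def by (simp add: add_nonneg_pos)
  qed auto
next
  case True
  then obtain i where i: "i \<in> {1..m}" "\<not> (AE y in lborel. y \<in> \<Omega> \<longrightarrow> s i y = 0)" using nz by blast
  note [measurable] = s[OF i(1)]
  \<comment> \<open>Countably many compact boxes exhaust \<Omega>, so \<sigma>_i cannot vanish
    almost everywhere on each of them.\<close>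
  obtain \<D> where \<D>: "countable \<D>" "\<D> \<subseteq> Pow \<Omega>" "\<And>X. X \<in> \<D> \<Longrightarrow> \<exists>a b. X = cbox a b" "\<Union>\<D> = \<Omega>"
    using open_countable_Union_open_cbox[OF open_dom] by metis
  have "\<exists>K\<in>\<D>. \<not> (AE y in lborel. y \<in> K \<longrightarrow> s i y = 0)"
  proof (rule ccontr)
    assume "\<not> ?thesis"
    then have "AE y in lborel. \<forall>K\<in>\<D>. y \<in> K \<longrightarrow> s i y = 0" using \<D>(1) by (subst AE_ball_countable) auto
    then have "AE y in lborel. y \<in> \<Omega> \<longrightarrow> s i y = 0" by eventually_elim (use \<D>(4) in blast)
    with i(2) show False by simp
  qed
  then obtain K where K: "K \<in> \<D>" "\<not> (AE y in lborel. y \<in> K \<longrightarrow> s i y = 0)" by blast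
  have K\<Omega>: "K \<subseteq> \<Omega>" using \<D>(2) K(1) by blast
  have Kc: "compact K" using \<D>(3)[OF K(1)] by (auto simp: compact_cbox)
  have [measurable]: "K \<in> sets borel" using Kc by (simp add: compact_imp_closed)
  define I where "I = (\<integral>\<^sup>+y. s i y * indicator K y \<partial>lborel)"
  have "I \<noteq> 0"
  proof
    assume "I = 0"
    then have "AE y in lborel. s i y * indicator K y = 0" unfolding I_def by (subst (asm) nn_integral_0_iff_AE) auto
    then have "AE y in lborel. y \<in> K \<longrightarrow> s i y = 0" by eventually_elim (auto simp: indicator_def)
    with K(2) show False by simp
  qed
  obtain \<delta> where \<delta>: "0 < \<delta>" "\<And>x y. x \<in> K \<Longrightarrow> y \<in> K \<Longrightarrow> ennreal \<delta> \<le> G x y"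
    using G_lower_bound[OF Kc K\<Omega> Kc K\<Omega>] by blast
  have "0 < ennreal \<delta> * I" using \<delta> \<open>I \<noteq> 0\<close> by (simp add: ennreal_zero_less_mult_iff zero_less_iff_neq_zero)
  \<comment> \<open>\<open>I\<close> may be infinite; a finite positive number strictly below the
    product serves instead.\<close>
  then obtain c' where c': "0 < c'" "c' < ennreal \<delta> * I" using dense by blast
  then obtain c where c: "c' = ennreal c" "0 < c" by (cases c') (auto simp: less_top)
  \<comment> \<open>The solution of \<epsilon> = \<epsilon>^q c.\<close>
  define \<epsilon> where "\<epsilon> = c powr (1 / (1 - q i))"
  have qi: "0 < q i" "q i < 1" using q[OF i(1)] by auto
  have \<epsilon>: "0 < \<epsilon>" using c by (simp add: \<epsilon>_def)
  have "\<epsilon> powr (1 - q i) = c"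
  proof -
    have "1 / (1 - q i) * (1 - q i) = 1" using qi by simp
    then show ?thesis unfolding \<epsilon>_def powr_powr using c by (simp only: powr_one)
  qed
  then have \<epsilon>c: "\<epsilon> = \<epsilon> powr q i * c" using \<epsilon> powr_add[of \<epsilon> "q i" "1 - q i"] by simp
  define u0 where "u0 x = ennreal \<epsilon> * indicator K x" for x
  have u0m: "u0 \<in> borel_measurable borel" unfolding u0_def[abs_def] by measurable
  have low: "pot (\<lambda>y. s i y * epowr (u0 y) (q i)) x \<le> T u0 x" for x
  proof -
    have "pot (\<lambda>y. s i y * epowr (u0 y) (q i)) x \<le> (\<Sum>i=1..m. pot (\<lambda>y. s i y * epowr (u0 y) (q i)) x)"
      using i(1) by (intro member_le_sum[of i]) auto
    then show ?thesis unfolding sublinear_op_def by (simp add: add_increasing2)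
  qed
  show ?thesis
  proof (rule that[OF u0m])
    fix x
    show "u0 x \<le> T u0 x"
    proof (cases "x \<in> K")
      case True
      have "ennreal \<epsilon> = ennreal (\<epsilon> powr q i) * ennreal c" using \<epsilon>c c by (metis ennreal_mult less_imp_le powr_ge_zero)
      also have "\<dots> \<le> ennreal (\<epsilon> powr q i) * (ennreal \<delta> * I)" using c' c by (intro mult_left_mono) auto
      also have "\<dots> = (\<integral>\<^sup>+y. ennreal (\<epsilon> powr q i) * (ennreal \<delta> * (s i y * indicator K y)) \<partial>lborel)"
        unfolding I_def by (simp add: nn_integral_cmult)
      also have "\<dots> \<le> pot (\<lambda>y. s i y * epowr (u0 y) (q i)) x"
        unfolding pot_def
      proof (rule nn_integral_mono)
        fix y
        show "ennreal (\<epsilon> powr q i) * (ennreal \<delta> * (s i y * indicator K y)) \<le> G x y * (s i y * epowr (u0 y) (q i))"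
        proof (cases "y \<in> K")
          case yK: True
          have "ennreal \<delta> * (s i y * ennreal (\<epsilon> powr q i)) \<le> G x y * (s i y * ennreal (\<epsilon> powr q i))"
            by (intro mult_right_mono \<delta>(2) True yK) auto
          then show ?thesis using yK \<epsilon> by (simp add: u0_def mult_ac)
        qed simp
      qed
      also have "\<dots> \<le> T u0 x" by (rule low)
      finally show ?thesis using True by (simp add: u0_def)
    qed (simp add: u0_def)
  next
    fix x assume x: "x \<in> \<Omega>"
    have "0 < pot (\<lambda>y. s i y * epowr (u0 y) (q i)) x"
    proof (rule pot_pos[OF x measurable_integrand[OF i(1) u0m]])
      show "\<not> (AE y in lborel. y \<in> \<Omega> \<longrightarrow> s i y * epowr (u0 y) (q i) = 0)"
      proof
        assume "AE y in lborel. y \<in> \<Omega> \<longrightarrow> s i y * epowr (u0 y) (q i) = 0"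
        then have "AE y in lborel. y \<in> K \<longrightarrow> s i y = 0"
          by eventually_elim (use K\<Omega> \<epsilon> in \<open>auto simp: u0_def\<close>)
        with K(2) show False by simp
      qed
    qed
    then show "0 < T u0 x" using low[of x] by simp
  next
    have "emeasure lborel K < \<infinity>" using Kc by (rule emeasure_compact_finite)
    then obtain v where "emeasure lborel K = ennreal v" "0 \<le> v" by (cases "emeasure lborel K") auto
    then show "lorentz_int lborel \<beta> \<rho> u0 < \<infinity>"
      unfolding u0_def[abs_def] using \<epsilon> \<beta> \<rho> by (intro lorentz_int_indicator_finite) auto
  qed
qed

end

end

section \<open>From Lebesgue measurable data to Borel data\<close>

lemma borel_measurable_lebesgue_onI:
  "f \<in> borel_measurable borel \<Longrightarrow> f \<in> borel_measurable (lebesgue_on \<Omega>)"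
  by (intro measurable_restrict_space1 measurable_completion) simp

text \<open>Vanishing off \<Omega> lets rearrangements and potentials over the whole space replace
  those over \<Omega>; Borel measurability makes the products with G and the Fubini arguments
  available for \<open>lborel\<close>.\<close>

definition borel_version :: "'a::euclidean_space set \<Rightarrow> ('a \<Rightarrow> ennreal) \<Rightarrow> ('a \<Rightarrow> ennreal) \<Rightarrow> bool" where
  "borel_version \<Omega> f f' \<longleftrightarrow> f' \<in> borel_measurable borel \<and> (\<forall>x. x \<notin> \<Omega> \<longrightarrow> f' x = 0) \<and>
     (AE x in lborel. x \<in> \<Omega> \<longrightarrow> f x = f' x)"

lemma borel_version_exists:
  assumes \<Omega>: "open \<Omega>" and f: "f \<in> borel_measurable (lebesgue_on \<Omega>)"
  obtains f' where "borel_version \<Omega> f f'"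
proof -
  have [measurable]: "\<Omega> \<in> sets borel" using \<Omega> by simp
  have "(\<lambda>x. f x * indicator \<Omega> x) \<in> borel_measurable lebesgue"
    using f \<Omega> by (subst (asm) borel_measurable_restrict_space_iff_ennreal) auto
  from completion_ex_borel_measurable[OF this] obtain F where
    F[measurable]: "F \<in> borel_measurable lborel" and eq: "AE x in lborel. f x * indicator \<Omega> x = F x" by blast
  have "borel_version \<Omega> f (\<lambda>x. F x * indicator \<Omega> x)"
    unfolding borel_version_def
  proof (intro conjI allI impI)
    show "(\<lambda>x. F x * indicator \<Omega> x) \<in> borel_measurable borel" using F by measurable
    show "AE x in lborel. x \<in> \<Omega> \<longrightarrow> f x = F x * indicator \<Omega> x" using eq by eventually_elim auto
  qed simp
  then show ?thesis by (rule that)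
qed

lemma decreasing_rearrangement_eq_rearr:
  assumes \<Omega>: "open \<Omega>" and f: "f \<in> borel_measurable (lebesgue_on \<Omega>)" and v: "borel_version \<Omega> f f'"
  shows "decreasing_rearrangement \<Omega> f t = rearr lborel f' t"
proof -
  have f'[measurable]: "f' \<in> borel_measurable borel" and off: "\<And>x. x \<notin> \<Omega> \<Longrightarrow> f' x = 0"
    and eq: "AE x in lborel. x \<in> \<Omega> \<longrightarrow> f x = f' x" using v by (auto simp: borel_version_def)
  have "emeasure (lebesgue_on \<Omega>) {x \<in> \<Omega>. s < f x} = emeasure lborel {x \<in> space lborel. s < f' x}" for s
  proof -
    have S: "{x \<in> \<Omega>. s < f x} \<in> sets lebesgue"
    proof -
      have "{x \<in> space (lebesgue_on \<Omega>). s < f x} \<in> sets (lebesgue_on \<Omega>)" using f by measurable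
      then show ?thesis using \<Omega> by (simp add: sets_restrict_space_iff space_restrict_space)
    qed
    have "emeasure (lebesgue_on \<Omega>) {x \<in> \<Omega>. s < f x} = emeasure lebesgue {x \<in> \<Omega>. s < f x}"
      using \<Omega> by (intro emeasure_restrict_space) auto
    also have "\<dots> = emeasure lebesgue {x. s < f' x}"
    proof (rule emeasure_eq_AE)
      have "AE x in lebesgue. x \<in> \<Omega> \<longrightarrow> f x = f' x" using eq by (rule AE_completion)
      then show "AE x in lebesgue. (x \<in> {x \<in> \<Omega>. s < f x}) = (x \<in> {x. s < f' x})"
        by eventually_elim (use off in force)
      show "{x. s < f' x} \<in> sets lebesgue" by (intro sets_completionI_sets) simp
    qed (rule S)
    also have "\<dots> = emeasure lborel {x. s < f' x}" by simp
    finally show ?thesis by simp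
  qed
  then show ?thesis unfolding decreasing_rearrangement_def rearr_def by simp
qed

lemma lorentz_space_iff:
  assumes \<Omega>: "open \<Omega>" and f: "f \<in> borel_measurable (lebesgue_on \<Omega>)" and v: "borel_version \<Omega> f f'"
  shows "f \<in> lorentz_space \<Omega> r \<rho> \<longleftrightarrow> lorentz_int lborel (1 / r) \<rho> f' < \<infinity>"
  using f by (simp add: lorentz_space_def lorentz_norm_def lorentz_int_def weighted_int_def decreasing_rearrangement_eq_rearr[OF assms])

lemma nn_integral_lebesgue_on:
  assumes "open \<Omega>"
  shows "(\<integral>\<^sup>+x. f x \<partial>lebesgue_on \<Omega>) = (\<integral>\<^sup>+x. f x * indicator \<Omega> x \<partial>lborel)"
  using assms by (subst nn_integral_restrict_space) (auto simp: nn_integral_completion)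

text \<open>Superharmonic functions must not be identically infinite. If u were infinite on all of
  \<Omega>, its rearrangement would be infinite on an interval (0, t1], and the functional with
  it.\<close>

lemma lorentz_int_finite_imp:
  assumes \<Omega>: "open \<Omega>" "\<Omega> \<noteq> {}" and u: "u \<in> borel_measurable borel" and \<rho>: "0 < \<rho>"
    and fin: "lorentz_int lborel \<beta> \<rho> u < \<infinity>"
  shows "\<exists>x\<in>\<Omega>. u x < \<infinity>"
proof (rule ccontr)
  assume "\<not> (\<exists>x\<in>\<Omega>. u x < \<infinity>)"
  then have inf: "\<And>x. x \<in> \<Omega> \<Longrightarrow> u x = top" by (metis infinity_ennreal_def less_top)
  obtain z e where "0 < e" "ball z e \<subseteq> \<Omega>" using \<Omega> open_contains_ball by blast
  then have "0 < emeasure lborel (ball z e)" by (simp add: emeasure_ball)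
  also have "\<dots> \<le> emeasure lborel \<Omega>" using \<open>ball z e \<subseteq> \<Omega>\<close> \<Omega>(1) by (intro emeasure_mono) simp_all
  finally have "0 < emeasure lborel \<Omega>" .
  then obtain c where c: "0 < c" "c < emeasure lborel \<Omega>" using dense by blast
  then obtain t1 where t1: "c = ennreal t1" "0 < t1" by (cases c) (auto simp: less_top)
  have r: "rearr lborel u t = top" if "t \<le> t1" for t
  proof (rule ennreal_eq_topI)
    fix B
    have "ennreal t < emeasure lborel \<Omega>" using that t1 c by (meson ennreal_leI le_less_trans)
    also have "\<dots> \<le> emeasure lborel {x \<in> space lborel. ennreal B < u x}"
      using inf u by (intro emeasure_mono) auto
    finally show "ennreal B \<le> rearr lborel u t" using u by (intro rearr_ge) auto
  qed
  have "(\<integral>\<^sup>+t. \<infinity> * indicator {0<..t1} t \<partial>lborel) \<le> lorentz_int lborel \<beta> \<rho> u"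
    unfolding lorentz_int_def weighted_int_def
  proof (rule nn_integral_mono)
    fix t :: real
    show "\<infinity> * indicator {0<..t1} t \<le> epowr (ennreal (t powr \<beta>) * rearr lborel u t) \<rho> * ennreal (1 / t) * indicator {0<..} t"
      using r[of t] by (cases "t \<in> {0<..t1}") (auto simp: ennreal_mult_top ennreal_top_mult)
  qed
  moreover have "(\<integral>\<^sup>+t. \<infinity> * indicator {0<..t1} t \<partial>lborel) = \<infinity>"
    using t1 by (subst nn_integral_cmult_indicator) (auto simp: ennreal_top_mult infinity_ennreal_def)
  ultimately show False using fin by (simp add: infinity_ennreal_def top_unique)
qed

section \<open>Potentials with Lebesgue measurable densities and properties of solutions\<close>

context positive_green_domain
begin

lemma green_potential_eq_pot:
  assumes g: "\<And>y. y \<in> \<Omega> \<Longrightarrow> e2ennreal (g x y) = G x y"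
    and f: "f \<in> borel_measurable (lebesgue_on \<Omega>)" and v: "borel_version \<Omega> f f'"
  shows "green_potential g (density (lebesgue_on \<Omega>) f) x = pot f' x"
proof -
  have f'[measurable]: "f' \<in> borel_measurable borel" and off: "\<And>x. x \<notin> \<Omega> \<Longrightarrow> f' x = 0"
    and eq: "AE x in lborel. x \<in> \<Omega> \<longrightarrow> f x = f' x" using v by (auto simp: borel_version_def)
  have gm: "(\<lambda>y. e2ennreal (g x y)) \<in> borel_measurable (lebesgue_on \<Omega>)"
    using borel_measurable_lebesgue_onI[OF measurable_G_section[of x], of \<Omega>]
    by (subst measurable_cong[of _ _ "G x"]) (auto simp: g)
  have "green_potential g (density (lebesgue_on \<Omega>) f) x = (\<integral>\<^sup>+y. f y * e2ennreal (g x y) \<partial>lebesgue_on \<Omega>)"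
    unfolding green_potential_def by (rule nn_integral_density[OF f gm])
  also have "\<dots> = (\<integral>\<^sup>+y. f y * e2ennreal (g x y) * indicator \<Omega> y \<partial>lborel)" by (rule nn_integral_lebesgue_on[OF open_dom])
  also have "\<dots> = pot f' x" unfolding pot_def
  proof (rule nn_integral_cong_AE)
    show "AE y in lborel. f y * e2ennreal (g x y) * indicator \<Omega> y = G x y * f' y"
      using eq
    proof eventually_elim
      case (elim y)
      then show ?case using g[of y] off[of y] by (cases "y \<in> \<Omega>") (auto simp: mult.commute)
    qed
  qed
  finally show ?thesis .
qed

lemma pot_nonneg_superharmonic:
  assumes f: "f \<in> borel_measurable borel" and fin: "\<exists>x\<in>\<Omega>. pot f x < \<infinity>"
  shows "nonneg_superharmonic_on \<Omega> (pot f)"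
  unfolding nonneg_superharmonic_on_def
proof (intro conjI allI impI)
  fix a
  have "{x \<in> \<Omega>. a < pot f x} = \<Omega> \<inter> {x. a < pot f x}" by auto
  then show "openin (top_of_set \<Omega>) {x \<in> \<Omega>. a < pot f x}"
    using pot_lower_semicontinuous[OF f, of a] by (simp add: openin_open_Int)
next
  fix x r assume r: "0 < r \<and> cball x r \<subseteq> \<Omega>"
  then have "0 < emeasure lborel (cball x r)" by (simp add: emeasure_cball)
  then show "(\<integral>\<^sup>+y\<in>cball x r. pot f y \<partial>lborel) / emeasure lborel (cball x r) \<le> pot f x"
    using pot_mean_value[OF f, of r x] r by (intro divide_le_posI_ennreal) (auto simp: mult.commute)
qed (rule fin)

text \<open>All sources are gathered into one density, so superharmonicity has to be verified for a
  single potential only.\<close>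

lemma sublinear_op_eq_pot:
  assumes "\<And>i. i \<in> {1..m} \<Longrightarrow> s i \<in> borel_measurable borel" "w \<in> borel_measurable borel" "u \<in> borel_measurable borel"
  shows "sublinear_op m q s w u x = pot (\<lambda>y. (\<Sum>i=1..m. s i y * epowr (u y) (q i)) + w y) x"
proof -
  have m: "(\<lambda>y. G x y * (s i y * epowr (u y) (q i))) \<in> borel_measurable borel" if "i \<in> {1..m}" for i
    using assms(1)[OF that] assms(3) by measurable
  have "pot (\<lambda>y. (\<Sum>i=1..m. s i y * epowr (u y) (q i)) + w y) x
    = (\<integral>\<^sup>+y. (\<Sum>i=1..m. G x y * (s i y * epowr (u y) (q i))) + G x y * w y \<partial>lborel)"
    unfolding pot_def by (simp add: distrib_left sum_distrib_left)
  also have "\<dots> = (\<integral>\<^sup>+y. (\<Sum>i=1..m. G x y * (s i y * epowr (u y) (q i))) \<partial>lborel) + pot w x"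
    unfolding pot_def using m assms(2) by (intro nn_integral_add) (auto intro!: borel_measurable_sum)
  also have "(\<integral>\<^sup>+y. (\<Sum>i=1..m. G x y * (s i y * epowr (u y) (q i))) \<partial>lborel) = (\<Sum>i=1..m. pot (\<lambda>y. s i y * epowr (u y) (q i)) x)"
    unfolding pot_def using m by (intro nn_integral_sum) auto
  finally show ?thesis by (simp add: sublinear_op_def)
qed

text \<open>G(x0, .) is at least some \<delta> > 0 on the compact set, so the integral over that set
  is at most 1/\<delta> times the potential at x0.\<close>

lemma Lq_loc_of_finite_potential:
  assumes f: "f \<in> borel_measurable (lebesgue_on \<Omega>)" and v: "borel_version \<Omega> f f'"
    and u: "u \<in> borel_measurable borel"
    and x0: "x0 \<in> \<Omega>" "pot (\<lambda>y. f' y * epowr (u y) q) x0 < \<infinity>"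
  shows "Lq_loc \<Omega> (density (lebesgue_on \<Omega>) f) q u"
  unfolding Lq_loc_def
proof (intro conjI allI impI, goal_cases)
  case 1
  show ?case using borel_measurable_lebesgue_onI[OF u, of \<Omega>] by simp
next
  case (2 K)
  have f'[measurable]: "f' \<in> borel_measurable borel"
    and eq: "AE x in lborel. x \<in> \<Omega> \<longrightarrow> f x = f' x" using v by (auto simp: borel_version_def)
  note u[measurable]
  have K: "compact K" "K \<subseteq> \<Omega>" using 2 by auto
  have [measurable]: "K \<in> sets borel" using K(1) by (simp add: compact_imp_closed)
  obtain \<delta> where \<delta>: "0 < \<delta>" "\<And>x y. x \<in> {x0} \<Longrightarrow> y \<in> K \<Longrightarrow> ennreal \<delta> \<le> G x y"
    using G_lower_bound[of "{x0}" K] x0 K by auto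
  have "(\<integral>\<^sup>+x\<in>K. epowr (u x) q \<partial>density (lebesgue_on \<Omega>) f) = (\<integral>\<^sup>+x. f x * (epowr (u x) q * indicator K x) \<partial>lebesgue_on \<Omega>)"
    by (rule nn_integral_density[OF f], rule borel_measurable_lebesgue_onI) measurable
  also have "\<dots> = (\<integral>\<^sup>+x. f x * (epowr (u x) q * indicator K x) * indicator \<Omega> x \<partial>lborel)"
    by (rule nn_integral_lebesgue_on[OF open_dom])
  also have "\<dots> = (\<integral>\<^sup>+x. f' x * epowr (u x) q * indicator K x \<partial>lborel)"
  proof (rule nn_integral_cong_AE)
    show "AE x in lborel. f x * (epowr (u x) q * indicator K x) * indicator \<Omega> x = f' x * epowr (u x) q * indicator K x"
      using eq by eventually_elim (use K in \<open>auto simp: indicator_def\<close>)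
  qed
  finally have e: "(\<integral>\<^sup>+x\<in>K. epowr (u x) q \<partial>density (lebesgue_on \<Omega>) f) = (\<integral>\<^sup>+x. f' x * epowr (u x) q * indicator K x \<partial>lborel)" .
  have "ennreal \<delta> * (\<integral>\<^sup>+x. f' x * epowr (u x) q * indicator K x \<partial>lborel) = (\<integral>\<^sup>+x. ennreal \<delta> * (f' x * epowr (u x) q * indicator K x) \<partial>lborel)"
    by (rule nn_integral_cmult[symmetric]) measurable
  also have "\<dots> \<le> pot (\<lambda>y. f' y * epowr (u y) q) x0"
    unfolding pot_def
  proof (rule nn_integral_mono)
    fix y
    show "ennreal \<delta> * (f' y * epowr (u y) q * indicator K y) \<le> G x0 y * (f' y * epowr (u y) q)"
      using \<delta>(2)[of x0 y] by (cases "y \<in> K") (auto intro!: mult_right_mono)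
  qed
  finally have "ennreal \<delta> * (\<integral>\<^sup>+x. f' x * epowr (u x) q * indicator K x \<partial>lborel) < \<infinity>" using x0(2) by (rule le_less_trans)
  then show ?case unfolding e using \<delta>(1) by (auto simp: ennreal_mult_less_top infinity_ennreal_def)
qed

end

section \<open>Choice of exponents and verification of the solution\<close>

theorem corollary1p4:
  fixes \<Omega> :: "'a::euclidean_space set"
    and g :: "'a \<Rightarrow> 'a \<Rightarrow> ereal"
    and n M :: nat
    and \<gamma> :: real
    and q :: "nat \<Rightarrow> real"
    and \<sigma> :: "nat \<Rightarrow> 'a \<Rightarrow> real"
    and \<omega> :: "'a \<Rightarrow> real"
  assumes "n = DIM('a)" and "3 \<le> n"
    and "open \<Omega>" and "connected \<Omega>" and "\<Omega> \<noteq> {}"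
    and "is_green_function \<Omega> g" and "\<forall>x\<in>\<Omega>. \<forall>y\<in>\<Omega>. 0 < g x y"
    and "0 < \<gamma>" and "1 \<le> M"
    and "\<forall>i\<in>{1..M}. 0 < q i \<and> q i < 1"
    and "\<forall>i\<in>{1..M}. \<forall>x\<in>\<Omega>. 0 \<le> \<sigma> i x"
    and "\<forall>x\<in>\<Omega>. 0 \<le> \<omega> x"
    and "\<not> ((\<forall>i\<in>{1..M}. AE x in lebesgue_on \<Omega>. \<sigma> i x = 0) \<and> (AE x in lebesgue_on \<Omega>. \<omega> x = 0))"
    and "\<forall>i\<in>{1..M}. (\<lambda>x. ennreal (\<sigma> i x)) \<in>
           lorentz_space \<Omega> (real n * (\<gamma> + 1) / (real n * (1 - q i) + 2 * (\<gamma> + q i)))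
                           ((\<gamma> + 1) / (1 - q i))"
    and "(\<lambda>x. ennreal (\<omega> x)) \<in>
           lorentz_space \<Omega> (real n * (\<gamma> + 1) / (real n + 2 * \<gamma>)) (\<gamma> + 1)"
  shows "\<exists>u. is_solution \<Omega> g M q
               (\<lambda>i. density (lebesgue_on \<Omega>) (\<lambda>x. ennreal (\<sigma> i x)))
               (density (lebesgue_on \<Omega>) (\<lambda>x. ennreal (\<omega> x))) u \<and>
             (\<forall>x\<in>\<Omega>. 0 < u x) \<and>
             u \<in> lorentz_space \<Omega> (real n * (\<gamma> + 1) / (real n - 2)) (\<gamma> + 1)"
proof -
  note \<Omega> = assms(3) and q = assms(10)
  have n3: "3 \<le> DIM('a)" using assms(1,2) by simp
  obtain h where h: "\<forall>y\<in>\<Omega>. greatest_harmonic_minorant \<Omega> (\<lambda>x. fundamental_solution (x - y)) (h y) \<and>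
      (\<forall>x\<in>\<Omega>. g x y = fundamental_solution (x - y) - ereal (h y x))"
    using assms(6) unfolding is_green_function_def by metis
  interpret green_domain \<Omega> h by unfold_locales (use n3 \<Omega> h in auto)
  \<comment> \<open>On the diagonal both sides are infinite. Off it, the truncation at 0 in
    \<open>e2ennreal\<close> agrees with the truncated subtraction in \<open>G\<close>.\<close>
  have gG: "e2ennreal (g x y) = G x y" if xy: "x \<in> \<Omega>" "y \<in> \<Omega>" for x y
  proof (cases "x = y")
    case True
    then have "g x y = \<infinity>" using h xy by (simp add: fundamental_solution_def)
    then show ?thesis using True xy by (simp add: G_def)
  next
    case False
    define A where "A = norm (x - y) powr (2 - real DIM('a)) / newton_const TYPE('a)"
    have "g x y = ereal (A - h y x)" using h xy False by (simp add: fundamental_solution_def newton_const_def A_def)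
    moreover have "newton (x - y) = ennreal A" using newton_eq[of "x - y"] False by (simp add: A_def)
    ultimately show ?thesis using xy h_nonneg[OF xy] by (simp add: G_def ennreal_minus)
  qed
  interpret positive_green_domain \<Omega> h
  proof unfold_locales
    fix x y assume xy: "x \<in> \<Omega>" "y \<in> \<Omega>"
    then have "0 < g x y" using assms(7) by blast
    then have "enn2ereal (e2ennreal (g x y)) \<noteq> 0" by (subst enn2ereal_e2ennreal) auto
    then have "e2ennreal (g x y) \<noteq> 0" by (metis zero_ennreal.rep_eq)
    then show "0 < G x y" using gG[OF xy] by (simp add: zero_less_iff_neq_zero)
  qed
  have \<sigma>m: "(\<lambda>x. ennreal (\<sigma> i x)) \<in> borel_measurable (lebesgue_on \<Omega>)" if "i \<in> {1..M}" for i
    using assms(14) that by (auto simp: lorentz_space_def)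
  have \<omega>m: "(\<lambda>x. ennreal (\<omega> x)) \<in> borel_measurable (lebesgue_on \<Omega>)"
    using assms(15) by (simp add: lorentz_space_def)
  have "\<exists>s. borel_version \<Omega> (\<lambda>x. ennreal (\<sigma> i x)) s" if "i \<in> {1..M}" for i
    using borel_version_exists[OF \<Omega> \<sigma>m[OF that]] by blast
  then obtain s where s: "\<And>i. i \<in> {1..M} \<Longrightarrow> borel_version \<Omega> (\<lambda>x. ennreal (\<sigma> i x)) (s i)" by metis
  obtain w where w: "borel_version \<Omega> (\<lambda>x. ennreal (\<omega> x)) w" using borel_version_exists[OF \<Omega> \<omega>m] by blast
  have sm: "s i \<in> borel_measurable borel" if "i \<in> {1..M}" for i using s[OF that] by (simp add: borel_version_def)
  have wm: "w \<in> borel_measurable borel" using w by (simp add: borel_version_def)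
  \<comment> \<open>\<beta> is the reciprocal of the first index of the target space;
    \<alpha>+\<beta> and \<alpha>+\<beta>-q_i \<beta> turn out to be those for \<omega> and
    \<sigma>_i.\<close>
  define \<alpha> \<beta> \<rho> where "\<alpha> = 2 / real DIM('a)" and "\<beta> = (real n - 2) / (real n * (\<gamma> + 1))" and "\<rho> = \<gamma> + 1"
  have n0: "0 < real n" "0 < real n - 2" using assms(2) by auto
  have \<gamma>: "0 < \<gamma>" by fact
  have \<beta>: "0 < \<beta>" using n0 \<gamma> by (simp add: \<beta>_def)
  have \<rho>: "1 < \<rho>" using \<gamma> by (simp add: \<rho>_def)
  have \<alpha>\<beta>: "\<alpha> + \<beta> = (real n + 2 * \<gamma>) / (real n * (\<gamma> + 1))"
  proof -
    have "\<gamma> + 1 \<noteq> 0" using \<gamma> by simp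
    then have "\<alpha> = (2 * (\<gamma> + 1)) / (real n * (\<gamma> + 1))"
      unfolding \<alpha>_def assms(1)[symmetric] by (rule mult_divide_mult_cancel_right[symmetric])
    then show ?thesis unfolding \<beta>_def by (simp add: add_divide_distrib[symmetric] algebra_simps)
  qed
  \<comment> \<open>Equivalent to n+2\<gamma> < n(\<gamma>+1), which is the condition
    \<alpha>+\<beta> < 1 of the Hardy inequality.\<close>
  have "2 * \<gamma> < real n * \<gamma>" using n0 \<gamma> by (intro mult_strict_right_mono) auto
  then have lt1: "\<alpha> + \<beta> < 1" unfolding \<alpha>\<beta>
    using mult_pos_pos[of "real n" "\<gamma> + 1"] n0 \<gamma>
    by (subst divide_less_eq_1_pos) (assumption | simp add: distrib_left)+
  have sfin: "lorentz_int lborel (\<alpha> + \<beta> - q i * \<beta>) (\<rho> / (1 - q i)) (s i) < \<infinity>" if i: "i \<in> {1..M}" for i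
  proof -
    have e: "\<alpha> + \<beta> - q i * \<beta> = 1 / (real n * (\<gamma> + 1) / (real n * (1 - q i) + 2 * (\<gamma> + q i)))"
      unfolding \<alpha>\<beta> unfolding \<beta>_def by (simp add: diff_divide_distrib[symmetric]) (simp add: algebra_simps)
    show ?thesis unfolding e \<rho>_def lorentz_space_iff[OF \<Omega> \<sigma>m[OF i] s[OF i], symmetric]
      using assms(14) i by blast
  qed
  have wfin: "lorentz_int lborel (\<alpha> + \<beta>) \<rho> w < \<infinity>"
    using assms(15) lorentz_space_iff[OF \<Omega> \<omega>m w] unfolding \<alpha>\<beta> by (simp add: \<rho>_def)
  \<comment> \<open>Nontriviality is assumed for the real-valued data. Since they are nonnegative on
    \<Omega>, \<open>ennreal\<close> creates no new zeros there.\<close>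
  have zero: "(AE x in lebesgue_on \<Omega>. f x = 0) \<longleftrightarrow> (AE x in lborel. x \<in> \<Omega> \<longrightarrow> f' x = 0)"
    if v: "borel_version \<Omega> (\<lambda>x. ennreal (f x)) f'" and nn: "\<forall>x\<in>\<Omega>. 0 \<le> f x" for f f'
  proof -
    have eq: "AE x in lborel. x \<in> \<Omega> \<longrightarrow> ennreal (f x) = f' x" using v by (auto simp: borel_version_def)
    have f'm: "f' \<in> borel_measurable borel" using v by (simp add: borel_version_def)
    have P: "x \<in> \<Omega> \<longrightarrow> f x = 0 \<longleftrightarrow> f' x = 0" if "x \<in> \<Omega> \<longrightarrow> ennreal (f x) = f' x" for x
      using that nn by (metis ennreal_eq_0_iff order_antisym)
    have "(AE x in lebesgue_on \<Omega>. f x = 0) \<longleftrightarrow> (AE x in lebesgue. x \<in> \<Omega> \<longrightarrow> f x = 0)"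
      using \<Omega> by (intro AE_restrict_space_iff) auto
    also have "\<dots> \<longleftrightarrow> (AE x in lborel. x \<in> \<Omega> \<longrightarrow> f x = 0)" by (rule AE_completion_iff)
    also have "\<dots> \<longleftrightarrow> (AE x in lborel. x \<in> \<Omega> \<longrightarrow> f' x = 0)"
    proof
      assume "AE x in lborel. x \<in> \<Omega> \<longrightarrow> f x = 0"
      with eq show "AE x in lborel. x \<in> \<Omega> \<longrightarrow> f' x = 0" by eventually_elim (use P in blast)
    next
      assume "AE x in lborel. x \<in> \<Omega> \<longrightarrow> f' x = 0"
      with eq show "AE x in lborel. x \<in> \<Omega> \<longrightarrow> f x = 0" by eventually_elim (use P in blast)
    qed
    finally show ?thesis .
  qed
  have nz: "\<not> ((\<forall>i\<in>{1..M}. AE y in lborel. y \<in> \<Omega> \<longrightarrow> s i y = 0) \<and> (AE y in lborel. y \<in> \<Omega> \<longrightarrow> w y = 0))"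
    using assms(13) zero[OF s] zero[OF w] assms(11,12) by blast
  have q': "\<And>i. i \<in> {1..M} \<Longrightarrow> 0 < q i \<and> q i < 1" using q by blast
  obtain u0 where u0: "u0 \<in> borel_measurable borel" "\<And>x. u0 x \<le> sublinear_op M q s w u0 x" "lorentz_int lborel \<beta> \<rho> u0 < \<infinity>"
    "\<And>x. x \<in> \<Omega> \<Longrightarrow> 0 < sublinear_op M q s w u0 x"
    using starting_function[where m = M and q = q and s = s and w = w, OF q' sm wm \<beta> \<rho> nz] by blast
  obtain u where u: "u \<in> borel_measurable borel" "\<And>x. u x = sublinear_op M q s w u x" "\<And>x. u0 x \<le> u x" "lorentz_int lborel \<beta> \<rho> u < \<infinity>"
    using fixed_point_above[where m = M and q = q and s = s and w = w, OF q' sm wm \<beta> lt1[unfolded \<alpha>_def] \<rho> sfin[unfolded \<alpha>_def] wfin[unfolded \<alpha>_def] u0(1,2,3)] by blast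
  define F where "F y = (\<Sum>i=1..M. s i y * epowr (u y) (q i)) + w y" for y
  have Fm: "F \<in> borel_measurable borel" unfolding F_def[abs_def]
    by (intro borel_measurable_add borel_measurable_sum measurable_integrand[where m = M and q = q and s = s and w = w, OF q' sm wm] u(1) wm) auto
  have uF: "u = pot F"
  proof
    fix x show "u x = pot F x" unfolding u(2)[of x] F_def[abs_def] by (rule sublinear_op_eq_pot[OF sm wm u(1)])
  qed
  have off: "u x = 0" if "x \<notin> \<Omega>" for x unfolding uF by (rule pot_outside[OF that])
  obtain x0 where x0: "x0 \<in> \<Omega>" "u x0 < \<infinity>"
    using lorentz_int_finite_imp[OF \<Omega> assms(5) u(1) _ u(4)] \<rho> by auto
  have part: "pot (\<lambda>y. s i y * epowr (u y) (q i)) x \<le> u x" if i: "i \<in> {1..M}" for i x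
  proof -
    have "pot (\<lambda>y. s i y * epowr (u y) (q i)) x \<le> (\<Sum>i=1..M. pot (\<lambda>y. s i y * epowr (u y) (q i)) x)"
      using i by (intro member_le_sum[of i]) auto
    also have "\<dots> \<le> sublinear_op M q s w u x" unfolding sublinear_op_def by simp
    finally show ?thesis using u(2)[of x] by simp
  qed
  have uL: "u \<in> borel_measurable (lebesgue_on \<Omega>)" by (rule borel_measurable_lebesgue_onI[OF u(1)])
  show ?thesis
  proof (intro exI[of _ u] conjI ballI)
    show "is_solution \<Omega> g M q (\<lambda>i. density (lebesgue_on \<Omega>) (\<lambda>x. ennreal (\<sigma> i x))) (density (lebesgue_on \<Omega>) (\<lambda>x. ennreal (\<omega> x))) u"
      unfolding is_solution_def
    proof (intro conjI ballI)
      show "nonneg_superharmonic_on \<Omega> u"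
        unfolding uF by (rule pot_nonneg_superharmonic[OF Fm]) (use x0 in \<open>auto simp: uF[symmetric]\<close>)
      show "Lq_loc \<Omega> (density (lebesgue_on \<Omega>) (\<lambda>x. ennreal (\<sigma> i x))) (q i) u" if i: "i \<in> {1..M}" for i
        by (rule Lq_loc_of_finite_potential[OF \<sigma>m[OF i] s[OF i] u(1) x0(1)])
           (rule le_less_trans[OF part[OF i] x0(2)])
      fix x assume x: "x \<in> \<Omega>"
      have "green_potential g (density (density (lebesgue_on \<Omega>) (\<lambda>x. ennreal (\<sigma> i x))) (\<lambda>y. epowr (u y) (q i))) x
        = pot (\<lambda>y. s i y * epowr (u y) (q i)) x" if i: "i \<in> {1..M}" for i
      proof -
        have eL: "(\<lambda>y. epowr (u y) (q i)) \<in> borel_measurable (lebesgue_on \<Omega>)" using uL by measurable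
        have "borel_version \<Omega> (\<lambda>y. ennreal (\<sigma> i y) * epowr (u y) (q i)) (\<lambda>y. s i y * epowr (u y) (q i))"
          using s[OF i] measurable_integrand[where m = M and q = q and s = s and w = w, OF q' sm wm i u(1)] unfolding borel_version_def by auto
        then show ?thesis
          unfolding density_density_eq[OF \<sigma>m[OF i] eL]
          by (intro green_potential_eq_pot[where g = g and x = x] borel_measurable_times_ennreal \<sigma>m[OF i] eL)
             (simp add: gG[OF x])
      qed
      moreover have "green_potential g (density (lebesgue_on \<Omega>) (\<lambda>x. ennreal (\<omega> x))) x = pot w x"
        by (rule green_potential_eq_pot[where g = g and x = x, OF _ \<omega>m w]) (simp add: gG[OF x])
      ultimately show "u x = (\<Sum>i=1..M. green_potential g (density (density (lebesgue_on \<Omega>) (\<lambda>x. ennreal (\<sigma> i x))) (\<lambda>y. epowr (u y) (q i))) x)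
        + green_potential g (density (lebesgue_on \<Omega>) (\<lambda>x. ennreal (\<omega> x))) x"
        using u(2)[of x] by (simp add: sublinear_op_def)
    qed
  next
    fix x assume "x \<in> \<Omega>"
    \<comment> \<open>The starting function may vanish in \<Omega>; positivity appears after one
      application of the operator and is inherited by the larger fixed point.\<close>
    then have "0 < sublinear_op M q s w u0 x" by (rule u0(4))
    also have "\<dots> \<le> sublinear_op M q s w u x" by (rule T_mono[where m = M and q = q and s = s and w = w, OF q' sm wm u(3)])
    finally show "0 < u x" using u(2)[of x] by simp
  next
    have "borel_version \<Omega> u u" using u(1) off by (simp add: borel_version_def)
    from lorentz_space_iff[OF \<Omega> uL this] u(4)
    show "u \<in> lorentz_space \<Omega> (real n * (\<gamma> + 1) / (real n - 2)) (\<gamma> + 1)"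
      by (simp add: \<beta>_def \<rho>_def)
  qed
qed

end
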